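(* Let $\Omega$ be a $\mathbb C$-convex domain in $\mathbb C^n$ and let $w\in\Omega$. Then $$K_\Omega(w)\le\frac{C^n}{\lambda(I^A_\Omega(w))}$$ holds with $C=16$. If $\Omega$ is convex, then the estimate holds with $C=4$. If $\Omega$ is convex and in addition symmetric with respect to $w$, then the estimate holds with $C=16/\pi^2$. Here $K_\Omega$ is the Bergman kernel of $\Omega$ on the diagonal and $I^A_\Omega(w)$ is the Azukawa indicatrix of $\Omega$ at $w$.
   Context: $\lambda$ is Lebesgue measure on $\mathbb C^n\cong\mathbb R^{2n}$, $|\cdot|$ is the Euclidean norm (absolute value for scalars), and $C^n/\infty=0$. A domain $\Omega\subset\mathbb C^n$ is $\mathbb C$-convex if its intersection with every complex affine line is either empty or connected and simply connected. $\Omega$ is symmetric with respect to $w$ if $w+z\in\Omega$ implies $w-z\in\Omega$. The Bergman kernel on the diagonal is $$K_\Omega(w)=\sup\Big\{|f(w)|^2: f\in\mathcal O(\Omega),\ \int_\Omega|f|^2\,d\lambda\le1\Big\}.$$ The pluricomplex Green function with pole at $w$ is $$G_{\Omega,w}=\sup\{u\in PSH^-(\Omega): u\le \log|\cdot-w|+C'\text{ near }w\text{ for some constant }C'\},$$ where $PSH^-(\Omega)$ is the set of negative plurisubharmonic functions on $\Omega$ (and $G_{\Omega,w}\equiv-\infty$ if there is no such $u\not\equiv-\infty$). The Azukawa indicatrix is $$I^A_\Omega(w)=\Big\{X\in\mathbb C^n:\ \limsup_{\zeta\to0}\big(G_{\Omega,w}(w+\zeta X)-\log|\zeta|\big)<0\Big\},$$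 with $\zeta\in\mathbb C\setminus\{0\}$. *)

theory Defs
  imports "HOL-Analysis.Analysis"
begin

text \<open>
  The space \<open>\<complex>\<^sup>n\<close> is \<^typ>\<open>complex ^ 'n\<close> with \<open>n = CARD('n)\<close>; its norm is the Euclidean
  norm and its Lebesgue measure is that of the underlying real space of dimension \<open>2n\<close>.
\<close>

definition is_domain :: "(complex ^ 'n) set \<Rightarrow> bool" where
  "is_domain \<Omega> \<longleftrightarrow> open \<Omega> \<and> connected \<Omega> \<and> \<Omega> \<noteq> {}"

definition complex_line :: "complex ^ 'n \<Rightarrow> complex ^ 'n \<Rightarrow> (complex ^ 'n) set" where
  "complex_line a b = range (\<lambda>\<zeta>. a + \<zeta> *s b)"

definition C_convex :: "(complex ^ 'n) set \<Rightarrow> bool" where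
  "C_convex \<Omega> \<longleftrightarrow> (\<forall>a b. b \<noteq> 0 \<longrightarrow>
     \<Omega> \<inter> complex_line a b = {} \<or>
     connected (\<Omega> \<inter> complex_line a b) \<and> simply_connected (\<Omega> \<inter> complex_line a b))"

definition symmetric_wrt :: "(complex ^ 'n) set \<Rightarrow> complex ^ 'n \<Rightarrow> bool" where
  "symmetric_wrt \<Omega> w \<longleftrightarrow> (\<forall>z. w + z \<in> \<Omega> \<longrightarrow> w - z \<in> \<Omega>)"

text \<open>
  Holomorphy in several variables, for open \<open>\<Omega>\<close>: the real derivative exists and is complex linear.
\<close>

definition holomorphic_on_Cn :: "(complex ^ 'n \<Rightarrow> complex) \<Rightarrow> (complex ^ 'n) set \<Rightarrow> bool" where
  "holomorphic_on_Cn f \<Omega> \<longleftrightarrow>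
     (\<forall>z\<in>\<Omega>. \<exists>D. (f has_derivative D) (at z) \<and> (\<forall>c x. D (c *s x) = c * D x))"

definition bergman_kernel :: "(complex ^ 'n) set \<Rightarrow> complex ^ 'n \<Rightarrow> ennreal" where
  "bergman_kernel \<Omega> w =
     (SUP f \<in> {f. holomorphic_on_Cn f \<Omega> \<and>
                  (\<integral>\<^sup>+z\<in>\<Omega>. ennreal ((cmod (f z))\<^sup>2) \<partial>lebesgue) \<le> 1}.
        ennreal ((cmod (f w))\<^sup>2))"

text \<open>The logarithm with \<open>log 0 = -\<infinity>\<close>; only used for nonnegative arguments.\<close>

definition elog :: "real \<Rightarrow> ereal" where
  "elog t = (if t \<le> 0 then -\<infinity> else ereal (ln t))"

text \<open>
  The mean over \<open>[0, 2\<pi>]\<close> of an extended real function bounded above; it may be \<open>-\<infinity>\<close>.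
  Since \<^const>\<open>e2ennreal\<close> sends negative numbers to \<open>0\<close>, the two terms are the integrals of the
  positive and of the negative part; the first is finite for upper semicontinuous \<open>g < \<infinity>\<close>.
\<close>

definition circle_mean :: "(real \<Rightarrow> ereal) \<Rightarrow> ereal" where
  "circle_mean g = ereal (1 / (2 * pi)) *
     (enn2ereal (\<integral>\<^sup>+\<theta>\<in>{0..2*pi}. e2ennreal (g \<theta>) \<partial>lebesgue)
      - enn2ereal (\<integral>\<^sup>+\<theta>\<in>{0..2*pi}. e2ennreal (- g \<theta>) \<partial>lebesgue))"

text \<open>
  Plurisubharmonicity: upper semicontinuous, with the sub-mean value inequality on every closed
  disc contained in \<open>\<Omega>\<close> and lying in a complex line. The constant function \<open>-\<infinity>\<close> is admitted.
\<close>

definition psh_on :: "(complex ^ 'n \<Rightarrow> ereal) \<Rightarrow> (complex ^ 'n) set \<Rightarrow> bool" where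
  "psh_on u \<Omega> \<longleftrightarrow>
     (\<forall>z\<in>\<Omega>. u z < \<infinity>) \<and>
     (\<forall>z\<in>\<Omega>. Limsup (at z within \<Omega>) u \<le> u z) \<and>
     (\<forall>a b. (\<lambda>\<zeta>. a + \<zeta> *s b) ` cball 0 1 \<subseteq> \<Omega> \<longrightarrow>
        u a \<le> circle_mean (\<lambda>\<theta>. u (a + cis \<theta> *s b)))"

definition neg_psh :: "(complex ^ 'n) set \<Rightarrow> (complex ^ 'n \<Rightarrow> ereal) set" where
  "neg_psh \<Omega> = {u. psh_on u \<Omega> \<and> (\<forall>z\<in>\<Omega>. u z < 0)}"

text \<open>
  In \<^typ>\<open>ereal\<close> the supremum of the empty family is \<open>-\<infinity>\<close>. Values outside \<open>\<Omega>\<close> are meaningless.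
\<close>

definition green :: "(complex ^ 'n) set \<Rightarrow> complex ^ 'n \<Rightarrow> complex ^ 'n \<Rightarrow> ereal" where
  "green \<Omega> w z =
     (SUP u \<in> {u \<in> neg_psh \<Omega>. \<exists>C::real. \<forall>\<^sub>F y in nhds w. u y \<le> elog (norm (y - w)) + ereal C}. u z)"

definition azukawa_indicatrix :: "(complex ^ 'n) set \<Rightarrow> complex ^ 'n \<Rightarrow> (complex ^ 'n) set" where
  "azukawa_indicatrix \<Omega> w =
     {X. Limsup (at 0) (\<lambda>\<zeta>::complex. green \<Omega> w (w + \<zeta> *s X) - elog (cmod \<zeta>)) < 0}"

end

(* For X in the Azukawa indicatrix I of Omega at w one shows w + t X in Omega with t = 1/4, 1/2, pi/4
   in the three cases. Since I is balanced, the mean value property of holomorphic functions on the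
   balanced set w + t I gives |f(w)|^2 t^(2n) vol(I) <= int |f|^2, which is the estimate with C = 1/t^2.

   If a = w + t X is not in Omega, a complex linear functional L maps Omega - w into a plane domain F
   whose boundary position is controlled by L(a - w): a half-plane or strip by separation in the
   convex cases, and a simply connected domain omitting L(a - w) in the C-convex case, where a complex
   hyperplane through a misses Omega. For the Riemann map phi of F with phi(0) = 0 the function
   log |phi(L(z - w))| competes in the definition of the Green function, so |phi'(0) L(X)| < 1. This
   contradicts the explicit value of phi'(0) or, for C-convex Omega, the Koebe quarter theorem. *)

theory Submission
  imports Defs "HOL-Complex_Analysis.Complex_Analysis"
begin

section \<open>Invariance of Lebesgue measure under linear isometries\<close>

text \<open>The hard input is the complex hyperplane through a point outside a C-convex domain: real
  separation does not give it, and a condition on single complex lines has to be turned into a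
  global one. Both this and the simple connectedness of the image under a functional are encoded by
  continuous logarithms of affine functions, which can be continued along complex lines and compared
  up to constants, in place of homology. The competitor for the Green function may equal
  -\<infinity> on the circles over which it is averaged, so its sub-mean value property rests on
  Jensen's inequality rather than on harmonicity. The constants are the values of 1/|\<phi>'(0)|:
  with \<alpha> the real part of L(a - w) it is 2\<alpha> for the half-plane and 4\<alpha>/pi for
  the strip, and it is at most 4|L(a - w)| for a simply connected F omitting L(a - w). The last
  bound comes from a comparison of areas in logarithmic coordinates.\<close>

lemma emeasure_open_le_isometry_image:
  fixes T :: "'a::euclidean_space \<Rightarrow> 'b::euclidean_space"
  assumes lin: "linear T" and iso: "\<And>x. norm (T x) = norm x" and sur: "surj T" and U: "open U"
  shows "emeasure lborel U \<le> emeasure lborel (T ` U)" and "open (T ` U)"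
proof -
  have dist: "dist (T x) (T y) = dist x y" for x y
    by (metis dist_norm iso lin linear_diff)
  have inj: "inj T"
    by (metis dist dist_eq_0_iff injI)
  have dim: "DIM('b) = DIM('a)"
    using dim_image_eq[OF lin, of UNIV] inj sur by simp
  have ball: "T ` ball x r = ball (T x) r" for x r
  proof
    show "T ` ball x r \<subseteq> ball (T x) r" using dist by auto
    show "ball (T x) r \<subseteq> T ` ball x r"
    proof
      fix y assume "y \<in> ball (T x) r"
      moreover obtain z where "y = T z" using sur by blast
      ultimately show "y \<in> T ` ball x r" using dist by auto
    qed
  qed
  have opT: "open (T ` V)" if "open V" for V
  proof (rule openI)
    fix y assume "y \<in> T ` V"
    then obtain x where x: "x \<in> V" "y = T x" by blast
    then obtain e where "e > 0" "ball x e \<subseteq> V" using \<open>open V\<close> by (meson open_contains_ball)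
    then show "\<exists>e>0. ball y e \<subseteq> T ` V" using ball[of x e] x by (metis image_mono)
  qed
  show "open (T ` U)" using opT U .
  \<comment> \<open>Vitali: disjoint balls from \<open>K\<close> exhaust \<open>U\<close> up to a
    null set. \<open>T\<close> carries them to disjoint balls of the same radii, and the volume of a
    ball depends only on its radius and the dimension.\<close>
  define K where "K = {p::'a \<times> real. 0 < snd p \<and> ball (fst p) (snd p) \<subseteq> U}"
  have "\<exists>i. i \<in> K \<and> x \<in> ball (fst i) (snd i) \<and> snd i < d" if xU: "x \<in> U" "0 < d" for x d
  proof -
    obtain e where e: "e > 0" "ball x e \<subseteq> U" using xU U by (meson open_contains_ball)
    have "ball x (min e (d/2)) \<subseteq> U" using e(2) by (auto simp: subset_eq)
    then show ?thesis
      by (intro exI[of _ "(x, min e (d/2))"]) (use e xU in \<open>auto simp: K_def\<close>)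
  qed
  then obtain C where C: "countable C" "C \<subseteq> K"
    "pairwise (\<lambda>i j. disjnt (ball (fst i) (snd i)) (ball (fst j) (snd j))) C"
    "negligible (U - (\<Union>i \<in> C. ball (fst i) (snd i)))"
    using Vitali_covering_theorem_balls[of U K fst snd] by blast
  let ?B = "\<lambda>i. ball (fst i) (snd i)"
  have dis: "disjoint_family_on ?B C"
    using C(3) by (auto simp: disjoint_family_on_def pairwise_def disjnt_def)
  have dis': "disjoint_family_on (\<lambda>i. T ` ?B i) C"
    using dis inj by (auto simp: disjoint_family_on_def image_Int[symmetric])
  have "open (\<Union>i\<in>C. ?B i)" "open (U \<union> (\<Union>i\<in>C. ?B i))" using U by blast+
  then have sets: "(\<Union>i\<in>C. ?B i) \<in> sets lborel" "U - (\<Union>i\<in>C. ?B i) \<in> sets lborel" "T ` U \<in> sets lborel"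
    using U opT[OF U] by (auto intro: borel_open)
  have "emeasure lborel U \<le> emeasure lborel ((U - (\<Union>i\<in>C. ?B i)) \<union> (\<Union>i\<in>C. ?B i))"
    by (rule emeasure_mono) (use sets \<open>open (U \<union> (\<Union>i\<in>C. ?B i))\<close> in auto)
  also have "\<dots> \<le> emeasure lborel (U - (\<Union>i\<in>C. ?B i)) + emeasure lborel (\<Union>i\<in>C. ?B i)"
    by (rule emeasure_subadditive) (use sets in auto)
  also have "emeasure lborel (U - (\<Union>i\<in>C. ?B i)) = 0"
    using C(4) sets(2) by (simp add: negligible_iff_null_sets null_sets_completion_iff null_setsD1)
  also have "emeasure lborel (\<Union>i\<in>C. ?B i) = (\<integral>\<^sup>+i. emeasure lborel (?B i) \<partial>count_space C)"
    by (rule emeasure_UN_countable) (use C dis in auto)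
  also have "\<dots> = (\<integral>\<^sup>+i. emeasure lborel (T ` ?B i) \<partial>count_space C)"
  proof (rule nn_integral_cong)
    fix i assume "i \<in> space (count_space C)"
    then have "snd i > 0" using C K_def by auto
    then show "emeasure lborel (?B i) = emeasure lborel (T ` ?B i)"
      by (simp add: ball emeasure_ball dim)
  qed
  also have "\<dots> = emeasure lborel (\<Union>i\<in>C. T ` ?B i)"
    by (rule emeasure_UN_countable[symmetric]) (use C dis' ball in auto)
  also have "0 + \<dots> \<le> emeasure lborel (T ` U)"
    unfolding add_0 by (rule emeasure_mono) (use C K_def sets in auto)
  finally show "emeasure lborel U \<le> emeasure lborel (T ` U)" by simp
qed

text \<open>The inequality for \<open>T\<close> and the one for its inverse squeeze the volume of a
  box, and boxes determine the measure. Two different types are allowed because the complex plane is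
  later identified with \<open>real ^ 2\<close> and with \<open>real \<times> real\<close>.\<close>

lemma distr_lborel_isometry:
  fixes T :: "'a::euclidean_space \<Rightarrow> 'b::euclidean_space"
  assumes lin: "linear T" and iso: "\<And>x. norm (T x) = norm x" and sur: "surj T"
  shows "distr lborel borel T = lborel"
proof (rule lborel_eqI[symmetric])
  have inj: "inj T"
    by (metis (full_types) iso lin linear_injective_0 norm_eq_zero)
  define T' where "T' = inv T"
  have T'T: "T' (T x) = x" and TT': "T (T' y) = y" for x y
    using inj sur by (auto simp: T'_def surj_f_inv_f)
  have lin': "linear T'"
  proof (rule linearI)
    show "T' (x + y) = T' x + T' y" for x y
      using linear_add[OF lin, of "T' x" "T' y"] T'T[of "T' x + T' y"] TT' by simp
    show "T' (r *\<^sub>R x) = r *\<^sub>R T' x" for r x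
      using linear_cmul[OF lin, of r "T' x"] T'T[of "r *\<^sub>R T' x"] TT' by simp
  qed
  have iso': "norm (T' y) = norm y" for y by (metis TT' iso)
  have sur': "surj T'" by (metis T'T surjI)
  have meas: "T \<in> borel_measurable borel"
    using lin by (intro borel_measurable_continuous_onI linear_continuous_on linear_conv_bounded_linear[THEN iffD1])
  show "sets (distr lborel borel T) = sets borel" by simp
  fix l u :: 'b assume lu: "\<And>b. b \<in> Basis \<Longrightarrow> l \<bullet> b \<le> u \<bullet> b"
  let ?U = "box l u"
  have e1: "emeasure lborel ?U \<le> emeasure lborel (T' ` ?U)"
    and o1: "open (T' ` ?U)"
    using emeasure_open_le_isometry_image[OF lin' iso' sur', of ?U] by (auto simp: open_box)
  have e2: "emeasure lborel (T' ` ?U) \<le> emeasure lborel (T ` T' ` ?U)"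
    using emeasure_open_le_isometry_image[OF lin iso sur o1] by auto
  have "T ` T' ` ?U = ?U" using TT' by (auto simp: image_image)
  moreover have "T -` ?U \<inter> space lborel = T' ` ?U" using TT' T'T by (auto simp: image_iff) (metis)+
  moreover have "emeasure (distr lborel borel T) ?U = emeasure lborel (T -` ?U \<inter> space lborel)"
    by (rule emeasure_distr) (use meas in auto)
  ultimately have "emeasure (distr lborel borel T) ?U = emeasure lborel ?U"
    using e1 e2 by auto
  then show "emeasure (distr lborel borel T) ?U = (\<Prod>b\<in>Basis. (u - l) \<bullet> b)"
    using lu by (simp add: emeasure_lborel_box)
qed

lemma distr_lebesgue_isometry:
  fixes T :: "'a::euclidean_space \<Rightarrow> 'b::euclidean_space"
  assumes lin: "linear T" and iso: "\<And>x. norm (T x) = norm x" and sur: "surj T"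
  shows "T \<in> lebesgue \<rightarrow>\<^sub>M lebesgue" and "distr lebesgue lebesgue T = lebesgue"
proof -
  have meas: "T \<in> borel_measurable borel"
    using lin by (intro borel_measurable_continuous_onI linear_continuous_on linear_conv_bounded_linear[THEN iffD1])
  then have eq0: "distr lebesgue lborel T = (lborel :: 'b measure)"
    using distr_lborel_isometry[OF assms] by (simp add: distr_completion cong: distr_cong)
  then have eq: "null_sets lborel = null_sets (distr lebesgue lborel T)" by simp
  show "T \<in> lebesgue \<rightarrow>\<^sub>M lebesgue"
    using meas by (simp add: completion.measurable_completion2 eq measurable_completion)
  show "distr lebesgue lebesgue T = lebesgue"
    using meas eq0 by (subst completion.completion_distr_eq[symmetric]) (auto simp: measurable_completion)
qed

lemma nn_integral_lebesgue_isometry: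
  fixes T :: "'a::euclidean_space \<Rightarrow> 'b::euclidean_space"
  assumes "linear T" and "\<And>x. norm (T x) = norm x" and "surj T"
    and "f \<in> borel_measurable lebesgue"
  shows "(\<integral>\<^sup>+x. f (T x) \<partial>lebesgue) = (\<integral>\<^sup>+y. f y \<partial>lebesgue)"
  using nn_integral_distr[of T lebesgue lebesgue f] distr_lebesgue_isometry[OF assms(1-3)] assms(4)
  by simp

section \<open>Mean values on balanced sets\<close>

lemma suminf_tail_tendsto_0:
  fixes a :: "nat \<Rightarrow> real"
  assumes "summable a"
  shows "(\<lambda>N. \<Sum>n. a (n + N)) \<longlonglongrightarrow> 0"
proof -
  have "(\<lambda>N. suminf a - sum a {..<N}) \<longlonglongrightarrow> suminf a - suminf a"
    by (intro tendsto_intros summable_LIMSEQ assms)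
  then show ?thesis
    using suminf_minus_initial_segment[OF assms] by simp
qed

lemma ball_subset_Union_cball:
  fixes a :: "'a::real_normed_vector"
  assumes "r > 0" "e > 0"
  shows "ball a (r + e) \<subseteq> (\<Union>x\<in>cball a r. cball x e)"
proof
  fix z assume z: "z \<in> ball a (r + e)"
  show "z \<in> (\<Union>x\<in>cball a r. cball x e)"
  proof (cases "z \<in> cball a r")
    case True
    then show ?thesis using assms by force
  next
    case False
    \<comment> \<open>The radial projection of \<open>z\<close> onto the sphere of radius
      \<open>r\<close>.\<close>
    define x where "x = a + (r / dist a z) *\<^sub>R (z - a)"
    have d: "dist a z > r" "dist a z > 0" using False assms by auto
    have "dist a x = r" using d assms by (simp add: x_def dist_norm norm_minus_commute)
    moreover have "z - x = (1 - r / dist a z) *\<^sub>R (z - a)" by (simp add: x_def algebra_simps)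
    then have "dist x z = (1 - r / dist a z) * dist a z"
      using d by (simp add: dist_commute[of x] dist_norm[of z x]) (simp add: dist_norm norm_minus_commute)
    then have "dist x z = dist a z - r" using d by (simp add: left_diff_distrib)
    ultimately show ?thesis using z by (intro UN_I[of x]) auto
  qed
qed

text \<open>Averaging over roots of unity instead of the circle avoids product measures below.\<close>

lemma roots_of_unity_mean_tendsto:
  fixes g :: "complex \<Rightarrow> complex"
  assumes hol: "g holomorphic_on ball 0 R" and R: "R > 1"
  shows "(\<lambda>N. (\<Sum>j<N. g (cis (2 * pi * real j / real N))) / of_nat N) \<longlonglongrightarrow> g 0"
proof -
  define c where "c n = (deriv ^^ n) g 0 / fact n" for n
  have ps: "(\<lambda>n. c n * z ^ n) sums g z" if "norm z < R" for z
    using holomorphic_power_series[OF hol, of z] that by (simp add: c_def)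
  define q where "q = (1 + R) / 2"
  have q: "1 < q" "q < R" using R by (auto simp: q_def)
  have "summable (\<lambda>n. c n * of_real q ^ n)"
    using ps[of "of_real q"] q by (auto simp: sums_iff)
  then have "summable (\<lambda>n. norm (c n * 1 ^ n))"
    by (rule powser_insidea) (use q in auto)
  then have sum: "summable (\<lambda>n. norm (c n))" by simp
  define u where "u N = cis (2 * pi / real N)" for N
  \<comment> \<open>\<open>s N n\<close> is the mean of the n-th powers of the N-th roots of unity:
    1 for n = 0 and 0 for 0 < n < N. Hence the N-point mean of \<open>g\<close> differs from
    \<open>g 0\<close> only through the power series coefficients of index at least N.\<close>
  define s where "s N n = (\<Sum>j<N. (u N ^ n) ^ j) / of_nat N" for N n :: nat
  have s_le: "norm (s N n) \<le> 1" for N n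
  proof -
    have "norm (\<Sum>j<N. (u N ^ n) ^ j) \<le> (\<Sum>j<N. norm ((u N ^ n) ^ j))" by (rule norm_sum)
    also have "\<dots> = real N" by (simp add: u_def norm_power)
    finally show ?thesis by (cases "N = 0") (auto simp: s_def norm_divide)
  qed
  have s_0: "s N 0 = 1" if "N > 0" for N using that by (simp add: s_def)
  have s_small: "s N n = 0" if "0 < n" "n < N" for N n
  proof -
    have ne: "u N ^ n \<noteq> 1"
    proof
      assume "u N ^ n = 1"
      then have "cis (2 * pi * (real n / real N)) = 1"
        using Complex.DeMoivre[of "2 * pi / real N" n] by (simp add: u_def mult_ac)
      then obtain k :: int where "2 * pi * (real n / real N) = 2 * pi * of_int k"
        by (auto simp: complex_eq_iff cos_one_2pi_int)
      then have "(2 * pi) * (real n / real N) = (2 * pi) * of_int k" by (simp only: times_divide_eq_right)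
      then have "real n / real N = of_int k" unfolding mult_cancel_left using pi_gt_zero by simp
      then have "real_of_int k > 0" "real_of_int k < 1"
        using that by (simp_all flip: \<open>real n / real N = of_int k\<close>)
      then have "0 < k" "k < 1" by (simp_all only: of_int_0_less_iff of_int_less_1_iff)
      then show False by presburger
    qed
    have "(u N ^ n) ^ N = 1"
    proof -
      have "u N ^ N = 1" using that by (simp add: u_def Complex.DeMoivre)
      then show ?thesis by (metis mult.commute power_mult power_one)
    qed
    then show ?thesis using geometric_sum[OF ne, of N] by (simp add: s_def)
  qed
  have bound: "norm ((\<Sum>j<N. g (cis (2 * pi * real j / real N))) / of_nat N - g 0) \<le> (\<Sum>n. norm (c (n + N)))"
    if N: "N > 0" for N
  proof -
    have "(\<lambda>n. (\<Sum>j<N. c n * cis (2 * pi * real j / real N) ^ n) / of_nat N)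
          sums ((\<Sum>j<N. g (cis (2 * pi * real j / real N))) / of_nat N)"
      by (intro sums_divide sums_sum ps) (use R in auto)
    moreover have "(\<Sum>j<N. c n * cis (2 * pi * real j / real N) ^ n) / of_nat N = c n * s N n" for n
      by (simp add: s_def u_def Complex.DeMoivre sum_distrib_left mult_ac)
    ultimately have S: "(\<lambda>n. c n * s N n) sums ((\<Sum>j<N. g (cis (2 * pi * real j / real N))) / of_nat N)"
      by simp
    have ini: "(\<Sum>n<N. c n * s N n) = g 0"
    proof -
      have "(\<Sum>n<N. c n * s N n) = (\<Sum>n<N. if n = 0 then c 0 else 0)"
        by (rule sum.cong) (use N s_0 s_small in auto)
      also have "\<dots> = c 0" using N by simp
      finally show ?thesis by (simp add: c_def)
    qed
    have "(\<Sum>j<N. g (cis (2 * pi * real j / real N))) / of_nat N - g 0 = (\<Sum>n. c (n + N) * s N (n + N))"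
      using suminf_minus_initial_segment[OF sums_summable[OF S], of N] S ini by (simp add: sums_iff)
    moreover have "norm (\<Sum>n. c (n + N) * s N (n + N)) \<le> (\<Sum>n. norm (c (n + N)))"
    proof (rule norm_suminf_le)
      show "norm (c (n + N) * s N (n + N)) \<le> norm (c (n + N))" for n
        using s_le by (simp add: norm_mult mult_left_le)
      show "summable (\<lambda>n. norm (c (n + N)))" using sum by (rule summable_ignore_initial_segment)
    qed
    ultimately show ?thesis by simp
  qed
  have "(\<lambda>N. (\<Sum>j<N. g (cis (2 * pi * real j / real N))) / of_nat N - g 0) \<longlonglongrightarrow> 0"
    by (rule Lim_null_comparison[OF _ suminf_tail_tendsto_0[OF sum]])
       (use bound in \<open>auto intro!: eventually_sequentiallyI[of 1]\<close>)
  then show ?thesis by (simp add: LIM_zero_iff)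
qed

section \<open>Complex scalings and restriction to complex lines\<close>

lemma linear_vector_scale: "linear (\<lambda>x :: complex ^ 'n. c *s x)"
  by (rule linearI) (auto simp: vec_eq_iff algebra_simps)

lemma surj_vector_scale: "c \<noteq> 0 \<Longrightarrow> surj (\<lambda>x :: complex ^ 'n. c *s x)"
  by (rule surjI[of _ "\<lambda>x. inverse c *s x"]) (simp add: vector_smult_assoc)

lemma norm_vector_scale: "norm (c *s x) = cmod c * norm (x :: complex ^ 'n)"
  by (simp add: norm_vec_def L2_set_def norm_mult power_mult_distrib real_sqrt_mult flip: sum_distrib_left)

lemma holomorphic_on_complex_line:
  assumes f: "holomorphic_on_Cn f \<Omega>" and T: "\<And>\<zeta>. \<zeta> \<in> T \<Longrightarrow> a + \<zeta> *s b \<in> \<Omega>"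
  shows "(\<lambda>\<zeta>. f (a + \<zeta> *s b)) holomorphic_on T"
proof -
  have "((\<lambda>\<zeta>. f (a + \<zeta> *s b)) has_field_derivative D b) (at \<zeta>)"
    if D: "(f has_derivative D) (at (a + \<zeta> *s b))" "\<forall>c x. D (c *s x) = c * D x" for \<zeta> D
  proof -
    have "((\<lambda>\<zeta>. a + \<zeta> *s b) has_derivative (\<lambda>h. h *s b)) (at \<zeta>)"
    proof -
      have "linear (\<lambda>h::complex. h *s b)"
        by (rule linearI) (auto simp: vec_eq_iff algebra_simps)
      then have "bounded_linear (\<lambda>h::complex. h *s b)" by (simp add: linear_conv_bounded_linear)
      from bounded_linear_imp_has_derivative[OF this] show ?thesis
        by (auto intro!: derivative_eq_intros)
    qed
    from has_derivative_compose[OF this D(1)] have "((\<lambda>\<zeta>. f (a + \<zeta> *s b)) has_derivative (\<lambda>h. D (h *s b))) (at \<zeta>)" .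
    then show ?thesis using D(2)
      by (simp add: has_field_derivative_def mult.commute[of "D b", abs_def])
  qed
  then show ?thesis using f T unfolding holomorphic_on_Cn_def holomorphic_on_def field_differentiable_def
    by (meson has_field_derivative_at_within)
qed

lemma continuous_on_holomorphic_on_Cn:
  "holomorphic_on_Cn f \<Omega> \<Longrightarrow> continuous_on \<Omega> f"
  unfolding holomorphic_on_Cn_def
  by (meson continuous_at_imp_continuous_on has_derivative_continuous)

text \<open>Rotations by roots of unity preserve both \<open>J\<close> and the measure, so averaging
  \<open>h\<close> over them keeps its integral. On the disc through each \<open>Y\<close> the
  averages of \<open>f\<close> tend to its value at the centre, and Fatou's lemma passes from the
  pointwise bound to the integrals.\<close>

lemma sub_mean_value_balanced:
  fixes f :: "complex ^ 'n \<Rightarrow> complex" and J :: "(complex ^ 'n) set"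
  assumes op: "open \<Omega>" and f: "holomorphic_on_Cn f \<Omega>"
    and J: "J \<in> sets lebesgue"
    and sub: "\<And>Y. Y \<in> J \<Longrightarrow> w + Y \<in> \<Omega>"
    and bal: "\<And>Y c. Y \<in> J \<Longrightarrow> cmod c \<le> 1 \<Longrightarrow> c *s Y \<in> J"
  shows "ennreal ((cmod (f w))\<^sup>2) * emeasure lebesgue J \<le> (\<integral>\<^sup>+z\<in>\<Omega>. ennreal ((cmod (f z))\<^sup>2) \<partial>lebesgue)"
proof -
  define F where "F = (\<lambda>z. ennreal ((cmod (f z))\<^sup>2) * indicator \<Omega> z)"
  have contf: "continuous_on \<Omega> f" using continuous_on_holomorphic_on_Cn f .
  have Fm: "F \<in> borel_measurable borel"
  proof -
    have "F = (\<lambda>z. if z \<in> \<Omega> then ennreal ((cmod (f z))\<^sup>2) else 0)" by (auto simp: F_def)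
    moreover have "(\<lambda>z. if z \<in> \<Omega> then ennreal ((cmod (f z))\<^sup>2) else 0) \<in> borel_measurable borel"
      by (rule borel_measurable_continuous_on_if)
         (use op contf in \<open>auto intro!: continuous_intros continuous_on_ennreal\<close>)
    ultimately show ?thesis by simp
  qed
  define h where "h Y = F (w + Y) * indicator J Y" for Y
  have hm: "h \<in> borel_measurable lebesgue"
  proof -
    have "(\<lambda>Y. F (w + Y)) \<in> borel_measurable lborel"
      using Fm by measurable
    then have "(\<lambda>Y. F (w + Y)) \<in> borel_measurable lebesgue"
      by (rule measurable_completion)
    moreover have "(indicator J :: _ \<Rightarrow> ennreal) \<in> borel_measurable lebesgue"
      using J by (rule borel_measurable_indicator)
    ultimately show ?thesis unfolding h_def by (rule borel_measurable_times_ennreal)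
  qed
  have int_le: "(\<integral>\<^sup>+Y. h Y \<partial>lebesgue) \<le> (\<integral>\<^sup>+z. F z \<partial>lebesgue)"
  proof -
    have "(\<integral>\<^sup>+Y. h Y \<partial>lebesgue) \<le> (\<integral>\<^sup>+Y. F (w + Y) \<partial>lebesgue)"
      by (intro nn_integral_mono) (auto simp: h_def indicator_def)
    also have "\<dots> = (\<integral>\<^sup>+Y. F (w + Y) \<partial>lborel)"
      using Fm by (intro nn_integral_completion)
    also have "\<dots> = (\<integral>\<^sup>+z. F z \<partial>distr lborel borel ((+) w))"
      using Fm by (subst nn_integral_distr) auto
    also have "\<dots> = (\<integral>\<^sup>+z. F z \<partial>lborel)" by (simp add: lborel_distr_plus)
    also have "\<dots> = (\<integral>\<^sup>+z. F z \<partial>lebesgue)"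
      using Fm by (intro nn_integral_completion[symmetric])
    finally show ?thesis .
  qed
  have rot: "(\<integral>\<^sup>+Y. h (c *s Y) \<partial>lebesgue) = (\<integral>\<^sup>+Y. h Y \<partial>lebesgue)" if c: "cmod c = 1" for c
  proof (rule nn_integral_lebesgue_isometry[OF linear_vector_scale _ _ hm])
    show "norm (c *s x) = norm x" for x :: "complex ^ 'n" using c by (simp add: norm_vector_scale)
    show "surj (\<lambda>x :: complex ^ 'n. c *s x)" using c by (intro surj_vector_scale) auto
  qed
  define u where "u N j = cis (2 * pi * real j / real N)" for N j :: nat
  define M where "M N Y = (\<Sum>j<N. h (u N j *s Y)) / of_nat N" for N Y
  have hcm: "(\<lambda>Y. h (c *s Y)) \<in> borel_measurable lebesgue" if c: "cmod c = 1" for c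
  proof -
    have "(\<lambda>x :: complex ^ 'n. c *s x) \<in> lebesgue \<rightarrow>\<^sub>M lebesgue"
    proof (rule distr_lebesgue_isometry(1)[OF linear_vector_scale])
      show "norm (c *s x) = norm x" for x :: "complex ^ 'n" using c by (simp add: norm_vector_scale)
      show "surj (\<lambda>x :: complex ^ 'n. c *s x)" using c by (intro surj_vector_scale) auto
    qed
    then show ?thesis using hm by (rule measurable_compose)
  qed
  have Mm: "M N \<in> borel_measurable lebesgue" for N
    unfolding M_def by (intro borel_measurable_divide_ennreal borel_measurable_sum hcm) (auto simp: u_def)
  have M_int: "(\<integral>\<^sup>+Y. M N Y \<partial>lebesgue) = (\<integral>\<^sup>+Y. h Y \<partial>lebesgue)" if N: "N > 0" for N
  proof -
    have "(\<integral>\<^sup>+Y. M N Y \<partial>lebesgue) = (\<Sum>j<N. (\<integral>\<^sup>+Y. h (u N j *s Y) \<partial>lebesgue)) / of_nat N"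
      unfolding M_def by (subst nn_integral_divide nn_integral_sum, auto intro!: hcm borel_measurable_sum simp: u_def)+
    also have "\<dots> = (of_nat N * (\<integral>\<^sup>+Y. h Y \<partial>lebesgue)) / of_nat N"
      using rot by (simp add: u_def)
    also have "\<dots> = (\<integral>\<^sup>+Y. h Y \<partial>lebesgue)"
      using N by (simp add: ennreal_times_divide mult.commute[of "of_nat N"] ennreal_mult_divide_eq)
    finally show ?thesis .
  qed
  have pt: "ennreal ((cmod (f w))\<^sup>2) * indicator J Y \<le> liminf (\<lambda>N. M N Y)" for Y
  proof (cases "Y \<in> J")
    case True
    define g where "g \<zeta> = f (w + \<zeta> *s Y)" for \<zeta>
    have "open ((\<lambda>\<zeta>. w + \<zeta> *s Y) -` \<Omega>)"
    proof (rule open_vimage[OF op])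
      have "continuous_on UNIV (\<lambda>\<zeta>::complex. \<zeta> *s Y)"
        unfolding vector_scalar_mult_def by (intro continuous_intros)
      then show "continuous_on UNIV (\<lambda>\<zeta>. w + \<zeta> *s Y)" by (intro continuous_intros)
    qed
    moreover have "cball 0 1 \<subseteq> (\<lambda>\<zeta>. w + \<zeta> *s Y) -` \<Omega>"
      using sub bal True by auto
    ultimately obtain e where e: "e > 0" "(\<Union>x\<in>cball 0 1. cball x e) \<subseteq> (\<lambda>\<zeta>. w + \<zeta> *s Y) -` \<Omega>"
      using compact_subset_open_imp_cball_epsilon_subset[OF compact_cball] by blast
    \<comment> \<open>A radius above 1 puts the roots of unity strictly inside the disc where
      \<open>g\<close> has its power series.\<close>
    have "ball 0 (1+e) \<subseteq> (\<Union>x\<in>cball 0 1. cball (x::complex) e)"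
      using ball_subset_Union_cball[of 1 e 0] e(1) by simp
    with e(2) have "ball 0 (1+e) \<subseteq> (\<lambda>\<zeta>. w + \<zeta> *s Y) -` \<Omega>" by blast
    then have "g holomorphic_on ball 0 (1+e)"
      unfolding g_def by (intro holomorphic_on_complex_line[OF f]) auto
    from roots_of_unity_mean_tendsto[OF this] e
    have lim: "(\<lambda>N. (\<Sum>j<N. g (u N j)) / of_nat N) \<longlonglongrightarrow> f w"
      by (simp add: u_def g_def)
    have "(\<lambda>N. ennreal ((cmod ((\<Sum>j<N. g (u N j)) / of_nat N))\<^sup>2)) \<longlonglongrightarrow> ennreal ((cmod (f w))\<^sup>2)"
      by (intro tendsto_intros tendsto_ennrealI lim)
    then have "ennreal ((cmod (f w))\<^sup>2) = liminf (\<lambda>N. ennreal ((cmod ((\<Sum>j<N. g (u N j)) / of_nat N))\<^sup>2))"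
      using lim_imp_Liminf trivial_limit_sequentially by metis
    also have "\<dots> \<le> liminf (\<lambda>N. M N Y)"
    proof (rule Liminf_mono, rule eventually_sequentiallyI[of 1])
      fix N :: nat assume N: "1 \<le> N"
      have "(cmod ((\<Sum>j<N. g (u N j)) / of_nat N))\<^sup>2 = (cmod (\<Sum>j<N. g (u N j)))\<^sup>2 / (real N)\<^sup>2"
        by (simp add: norm_divide power_divide)
      also have "\<dots> \<le> (\<Sum>j<N. cmod (g (u N j)))\<^sup>2 / (real N)\<^sup>2"
        by (intro divide_right_mono power_mono norm_sum) auto
      \<comment> \<open>Cauchy-Schwarz: the square of a mean is at most the mean of the
        squares.\<close>
      also have "\<dots> \<le> (real N * (\<Sum>j<N. (cmod (g (u N j)))\<^sup>2)) / (real N)\<^sup>2"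
        using sum_squared_le_sum_of_squares[of "\<lambda>j. cmod (g (u N j))" "{..<N}"]
        by (intro divide_right_mono) (auto simp: mult.commute[of "real N"])
      also have "\<dots> = (\<Sum>j<N. (cmod (g (u N j)))\<^sup>2) / real N"
        using N by (simp add: power2_eq_square)
      finally have "ennreal ((cmod ((\<Sum>j<N. g (u N j)) / of_nat N))\<^sup>2) \<le> ennreal ((\<Sum>j<N. (cmod (g (u N j)))\<^sup>2) / real N)"
        by (rule ennreal_leI)
      also have "\<dots> = (\<Sum>j<N. ennreal ((cmod (g (u N j)))\<^sup>2)) / of_nat N"
        using N by (simp add: divide_ennreal[symmetric] sum_nonneg ennreal_of_nat_eq_real_of_nat)
      also have "\<dots> = M N Y"
        unfolding M_def
        by (intro arg_cong2[of _ _ _ _ "(/)"] sum.cong refl)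
           (use True sub bal in \<open>auto simp: h_def F_def g_def u_def\<close>)
      finally show "ennreal ((cmod ((\<Sum>j<N. g (u N j)) / of_nat N))\<^sup>2) \<le> M N Y" .
    qed
    finally show ?thesis using True by simp
  qed auto
  have "ennreal ((cmod (f w))\<^sup>2) * emeasure lebesgue J = (\<integral>\<^sup>+Y. ennreal ((cmod (f w))\<^sup>2) * indicator J Y \<partial>lebesgue)"
    using J by (simp add: nn_integral_cmult_indicator)
  also have "\<dots> \<le> (\<integral>\<^sup>+Y. liminf (\<lambda>N. M N Y) \<partial>lebesgue)"
    by (intro nn_integral_mono pt)
  also have "\<dots> \<le> liminf (\<lambda>N. \<integral>\<^sup>+Y. M N Y \<partial>lebesgue)"
    by (rule nn_integral_liminf) (rule Mm)
  also have "\<dots> = liminf (\<lambda>N::nat. \<integral>\<^sup>+Y. h Y \<partial>lebesgue)"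
    by (rule Liminf_eq) (auto intro!: eventually_sequentiallyI[of 1] M_int)
  also have "\<dots> = (\<integral>\<^sup>+Y. h Y \<partial>lebesgue)" by (simp add: Liminf_const)
  also have "\<dots> \<le> (\<integral>\<^sup>+z. F z \<partial>lebesgue)" by (rule int_le)
  finally show ?thesis by (simp add: F_def)
qed

section \<open>Jensen's inequality for injective functions\<close>

lemma elog_mono: "s \<le> t \<Longrightarrow> elog s \<le> elog t"
  by (auto simp: elog_def)

lemma elog_mult: "0 < s \<Longrightarrow> elog (t * s) = elog t + ereal (ln s)"
  by (auto simp: elog_def ln_mult mult_le_0_iff)

lemma tendsto_elog:
  assumes "(f \<longlongrightarrow> t) A"
  shows "((\<lambda>x. elog (f x)) \<longlongrightarrow> elog t) A"
proof (cases "t > 0")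
  case True
  have "\<forall>\<^sub>F x in A. f x > 0" using assms True by (rule order_tendstoD)
  then have "\<forall>\<^sub>F x in A. ereal (ln (f x)) = elog (f x)"
    by eventually_elim (simp add: elog_def)
  moreover have "((\<lambda>x. ereal (ln (f x))) \<longlongrightarrow> ereal (ln t)) A"
    using assms True by (intro tendsto_intros) auto
  ultimately have "((\<lambda>x. elog (f x)) \<longlongrightarrow> ereal (ln t)) A"
    by (rule Lim_transform_eventually[rotated])
  then show ?thesis using True by (simp add: elog_def)
next
  case False
  have "((\<lambda>x. elog (f x)) \<longlongrightarrow> -\<infinity>) A"
  proof (rule tendsto_MInfty[THEN iffD2], rule allI)
    fix r :: real
    have "\<forall>\<^sub>F x in A. f x < exp r" using assms False
      by (intro order_tendstoD[OF assms]) (meson exp_gt_zero linorder_not_less order_le_less_trans)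
    then show "\<forall>\<^sub>F x in A. elog (f x) < ereal r"
    proof eventually_elim
      case (elim x)
      then show ?case using ln_less_cancel_iff[of "f x" "exp r"] by (auto simp: elog_def)
    qed
  qed
  then show ?thesis using False by (simp add: elog_def)
qed

lemma circle_integral_holomorphic:
  fixes l :: "complex \<Rightarrow> complex"
  assumes l: "l holomorphic_on ball 0 1" and r: "0 < r" "r < 1"
  shows "((\<lambda>\<theta>. l (of_real r * cis \<theta>)) has_integral (2 * pi * l 0)) {0..2 * pi}"
proof -
  have "l holomorphic_on cball 0 r"
    by (rule holomorphic_on_subset[OF l]) (use r in auto)
  then have "((\<lambda>u. l u / (u - 0)) has_contour_integral 2 * of_real pi * \<i> * l 0) (circlepath 0 r)"
    by (rule Cauchy_integral_circlepath_simple) (use r in auto)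
  then have "((\<lambda>x. l (circlepath 0 r x) / circlepath 0 r x * vector_derivative (circlepath 0 r) (at x)) has_integral 2 * of_real pi * \<i> * l 0) {0..1}"
    by (simp add: has_contour_integral)
  moreover have "l (circlepath 0 r x) / circlepath 0 r x * vector_derivative (circlepath 0 r) (at x)
     = 2 * of_real pi * \<i> * l (of_real r * cis (2 * pi * x))" for x
    unfolding vector_derivative_circlepath using r by (simp add: circlepath cis_conv_exp mult_ac)
  ultimately have "((\<lambda>x. 2 * of_real pi * \<i> * l (of_real r * cis (2 * pi * x))) has_integral 2 * of_real pi * \<i> * l 0) {0..1}"
    by simp
  then have "((\<lambda>x. (- \<i>) * (2 * of_real pi * \<i> * l (of_real r * cis (2 * pi * x)))) has_integral (- \<i>) * (2 * of_real pi * \<i> * l 0)) {0..1}"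
    by (rule has_integral_mult_right)
  then have "((\<lambda>x. 2 * of_real pi * l (of_real r * cis (2 * pi * x))) has_integral 2 * of_real pi * l 0) (cbox 0 1)"
    by (simp add: mult_ac)
  from has_integral_affinity[OF this, of "1 / (2 * pi)" 0]
  have "((\<lambda>x. 2 * of_real pi * l (of_real r * cis x)) has_integral (2 * pi) *\<^sub>R (2 * of_real pi * l 0)) {0..2*pi}"
    by simp
  from has_integral_mult_right[OF this, of "1 / (2 * of_real pi)"] show ?thesis
    by (simp add: scaleR_conv_of_real field_simps)
qed

text \<open>Without zeros in the disc, log |q| is the real part of a holomorphic function, so its
  mean over a circle of radius below 1 is its value at 0. Fatou's lemma for radii tending to 1
  tolerates zeros of \<open>q\<close> on the unit circle and costs only equality.\<close>

lemma nn_integral_neg_log_circle_le: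
  fixes q :: "complex \<Rightarrow> complex"
  assumes hol: "q holomorphic_on ball 0 1" and cont: "continuous_on (cball 0 1) q"
    and nz: "\<And>z. z \<in> ball 0 1 \<Longrightarrow> q z \<noteq> 0" and le1: "\<And>z. z \<in> ball 0 1 \<Longrightarrow> cmod (q z) \<le> 1"
  shows "(\<integral>\<^sup>+\<theta>\<in>{0..2*pi}. e2ennreal (- elog (cmod (q (cis \<theta>)))) \<partial>lebesgue) \<le> ennreal (- (2 * pi * ln (cmod (q 0))))"
proof -
  obtain l where l: "l holomorphic_on ball 0 1" "\<And>z. z \<in> ball 0 1 \<Longrightarrow> q z = exp (l z)"
    using simply_connected_imp_holomorphic_log[OF hol _ _ nz]
    by (metis convex_ball convex_imp_locally_path_connected convex_imp_simply_connected)
  have Re_l: "Re (l z) = ln (cmod (q z))" if "z \<in> ball 0 1" for z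
    using l(2)[OF that] by simp
  \<comment> \<open>The shift by 2 makes even \<open>r 0\<close> lie strictly between 0 and
    1.\<close>
  define r where "r n = 1 - 1 / (real n + 2)" for n :: nat
  have r: "0 < r n" "r n < 1" for n by (auto simp: r_def)
  have in_ball: "of_real (r n) * cis \<theta> \<in> ball 0 1" for n \<theta>
    using r[of n] by (simp add: norm_mult)
  have r_lim: "r \<longlonglongrightarrow> 1"
  proof -
    have "(\<lambda>n. 1 - inverse (real n + 2)) \<longlonglongrightarrow> 1 - 0"
      by (intro tendsto_intros tendsto_inverse_0_at_top filterlim_tendsto_add_at_top[OF tendsto_const, of _ _ 2, unfolded add.commute[of 2]] filterlim_real_sequentially)
    then show ?thesis by (simp add: r_def[abs_def] inverse_eq_divide)
  qed
  define p where "p n \<theta> = - ln (cmod (q (of_real (r n) * cis \<theta>)))" for n \<theta>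
  have p_nn: "0 \<le> p n \<theta>" for n \<theta>
    using le1[OF in_ball] nz[OF in_ball] by (simp add: p_def)
  define H where "H n \<theta> = ennreal (p n \<theta>) * indicator {0..2*pi} \<theta>" for n \<theta>
  have meas: "H n \<in> borel_measurable borel" for n
  proof -
    have "continuous_on UNIV (p n)"
      unfolding p_def
      by (intro continuous_intros continuous_on_compose2[OF holomorphic_on_imp_continuous_on[OF hol]])
         (use in_ball nz in auto)
    then have "(\<lambda>\<theta>. ennreal (p n \<theta>)) \<in> borel_measurable borel"
      by (intro measurable_compose[OF borel_measurable_continuous_onI measurable_ennreal])
    then show ?thesis unfolding H_def
      by (intro borel_measurable_times_ennreal borel_measurable_indicator) auto
  qed
  then have meas': "H n \<in> borel_measurable lebesgue" for n
    by (simp add: measurable_completion)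
  have int: "integral\<^sup>N lebesgue (H n) = ennreal (- (2 * pi * ln (cmod (q 0))))" for n
  proof -
    have "((\<lambda>\<theta>. Re (l (of_real (r n) * cis \<theta>))) has_integral Re (2 * pi * l 0)) {0..2 * pi}"
      using circle_integral_holomorphic[OF l(1) r] by (rule has_integral_Re)
    then have "((\<lambda>\<theta>. - Re (l (of_real (r n) * cis \<theta>))) has_integral - Re (2 * pi * l 0)) {0..2 * pi}"
      by (rule has_integral_neg)
    then have "(p n has_integral - (2 * pi * ln (cmod (q 0)))) {0..2 * pi}"
      using Re_l[OF in_ball] Re_l[of 0] by (simp add: p_def[abs_def])
    then have "integral\<^sup>N lborel (H n) = ennreal (- (2 * pi * ln (cmod (q 0))))"
      unfolding H_def using p_nn by (intro nn_integral_has_integral_lebesgue')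
    then show ?thesis using meas by (simp add: nn_integral_completion)
  qed
  have pt: "e2ennreal (- elog (cmod (q (cis \<theta>)))) * indicator {0..2*pi} \<theta> \<le> liminf (\<lambda>n. H n \<theta>)" for \<theta>
  proof (cases "\<theta> \<in> {0..2*pi}")
    case True
    have "(\<lambda>n. of_real (r n) * cis \<theta>) \<longlonglongrightarrow> of_real 1 * cis \<theta>"
      by (intro tendsto_intros r_lim)
    then have "(\<lambda>n. q (of_real (r n) * cis \<theta>)) \<longlonglongrightarrow> q (cis \<theta>)"
      by (intro continuous_on_tendsto_compose[OF cont]) (use in_ball in \<open>auto simp: less_imp_le\<close>)
    then have "(\<lambda>n. - elog (cmod (q (of_real (r n) * cis \<theta>)))) \<longlonglongrightarrow> - elog (cmod (q (cis \<theta>)))"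
      by (intro tendsto_uminus_ereal tendsto_elog tendsto_norm)
    moreover have "- elog (cmod (q (of_real (r n) * cis \<theta>))) = ereal (p n \<theta>)" for n
      using nz[OF in_ball] by (simp add: elog_def p_def)
    ultimately have "(\<lambda>n. e2ennreal (ereal (p n \<theta>))) \<longlonglongrightarrow> e2ennreal (- elog (cmod (q (cis \<theta>))))"
      by (intro tendsto_e2ennrealI) simp
    then have "(\<lambda>n. ennreal (p n \<theta>)) \<longlonglongrightarrow> e2ennreal (- elog (cmod (q (cis \<theta>))))"
      by (simp add: e2ennreal_ereal)
    then have "liminf (\<lambda>n. ennreal (p n \<theta>)) = e2ennreal (- elog (cmod (q (cis \<theta>))))"
      by (intro lim_imp_Liminf) auto
    then show ?thesis using True by (simp add: H_def)
  qed (auto simp: H_def)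
  have "(\<integral>\<^sup>+\<theta>\<in>{0..2*pi}. e2ennreal (- elog (cmod (q (cis \<theta>)))) \<partial>lebesgue)
     \<le> (\<integral>\<^sup>+\<theta>. liminf (\<lambda>n. H n \<theta>) \<partial>lebesgue)"
    by (intro nn_integral_mono pt)
  also have "\<dots> \<le> liminf (\<lambda>n. \<integral>\<^sup>+\<theta>. H n \<theta> \<partial>lebesgue)"
    by (rule nn_integral_liminf) (rule meas')
  also have "\<dots> = ennreal (- (2 * pi * ln (cmod (q 0))))"
    unfolding int by (simp add: Liminf_const)
  finally show ?thesis .
qed

text \<open>Injectivity leaves at most one zero in the disc, and it is simple. Dividing by one
  Blaschke factor removes it, keeps the modulus on the circle and increases it at 0, which reduces
  Jensen's inequality to the zero-free case.\<close>

lemma elog_le_circle_mean: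
  fixes g :: "complex \<Rightarrow> complex"
  assumes U: "open U" "cball 0 1 \<subseteq> U" and hol: "g holomorphic_on U"
    and le1: "\<And>z. z \<in> U \<Longrightarrow> cmod (g z) \<le> 1"
    and inj: "inj_on g U \<or> g constant_on U"
  shows "elog (cmod (g 0)) \<le> circle_mean (\<lambda>\<theta>. elog (cmod (g (cis \<theta>))))"
proof (cases "g 0 = 0")
  case True
  then show ?thesis by (simp add: elog_def)
next
  case g0: False
  have cis_U: "cis \<theta> \<in> U" for \<theta> using U by (auto simp: subset_eq)
  have ball_U: "ball 0 1 \<subseteq> U" using U ball_subset_cball by blast
  obtain q where q: "q holomorphic_on U" "\<And>z. z \<in> ball 0 1 \<Longrightarrow> q z \<noteq> 0" "\<And>z. z \<in> ball 0 1 \<Longrightarrow> cmod (q z) \<le> 1"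
     "\<And>\<theta>. cmod (q (cis \<theta>)) = cmod (g (cis \<theta>))" "cmod (q 0) \<ge> cmod (g 0)"
  proof (cases "\<exists>a \<in> ball 0 1. g a = 0")
    case False
    show ?thesis by (rule that[of g]) (use False hol le1 ball_U in auto)
  next
    case True
    then obtain a where a: "a \<in> ball 0 1" "g a = 0" by blast
    have inj: "inj_on g U"
      using inj g0 a U ball_U unfolding constant_on_def by (metis centre_in_ball subsetD zero_less_one)
    have a1: "cmod a < 1" "a \<noteq> 0" using a g0 by auto
    \<comment> \<open>\<open>q\<close> is \<open>g\<close> divided by the Blaschke factor (z - a) /
      (1 - cnj a z); \<open>k\<close> is the difference quotient of \<open>g\<close> at its zero
      with the singularity filled in, nonzero at \<open>a\<close> because an injective holomorphic
      function has nonzero derivative.\<close>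
    define k where "k z = (if z = a then deriv g a else (g z - g a) / (z - a))" for z
    define q where "q z = k z * (1 - cnj a * z)" for z
    have "k holomorphic_on U"
      unfolding k_def using pole_lemma[OF hol] a ball_U U(1) interior_open by (metis subsetD)
    then have qhol: "q holomorphic_on U"
      unfolding q_def by (intro holomorphic_intros)
    have dg: "deriv g a \<noteq> 0"
      using holomorphic_injective_imp_regular[OF hol U(1) inj] a ball_U by (meson subsetD)
    have den: "1 - cnj a * z \<noteq> 0" if "cmod z \<le> 1" for z
    proof
      assume "1 - cnj a * z = 0"
      then have "cmod (cnj a * z) = 1" by (metis eq_iff_diff_eq_0 norm_one)
      moreover have "cmod (cnj a * z) < 1"
        using mult_left_le[OF that norm_ge_zero, of a] a1 unfolding norm_mult complex_mod_cnj by linarith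
      ultimately show False by simp
    qed
    have qnz: "q z \<noteq> 0" if "z \<in> ball 0 1" for z
    proof -
      have "k z \<noteq> 0"
      proof (cases "z = a")
        case True
        then show ?thesis using dg by (simp add: k_def)
      next
        case False
        then have "g z \<noteq> g a" using inj_onD[OF inj, of z a] that a ball_U by (meson subsetD)
        then show ?thesis using False by (simp add: k_def)
      qed
      then show ?thesis using den that by (simp add: q_def)
    qed
    have qcis: "cmod (q z) = cmod (g z)" if "cmod z = 1" for z
    proof -
      have "cmod (1 - cnj a * z) = cmod (z - a)"
      proof -
        have "1 = z * cnj z" using that complex_norm_square[of z] by simp
        then have "1 - cnj a * z = z * cnj (z - a)" by (simp add: algebra_simps)
        then show ?thesis using that by (simp add: norm_mult flip: complex_cnj_diff)
      qed
      moreover have "z \<noteq> a" using a1 that by auto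
      ultimately show ?thesis using a by (simp add: q_def k_def norm_mult norm_divide)
    qed
    \<comment> \<open>On the circle |q| = |g| \<le> 1, so the maximum principle bounds
      \<open>q\<close> inside.\<close>
    have qle: "cmod (q z) \<le> 1" if "z \<in> ball 0 1" for z
    proof (rule maximum_modulus_frontier[of q "ball 0 1"])
      show "q holomorphic_on interior (ball 0 1)" using qhol ball_U by (auto intro: holomorphic_on_subset)
      show "continuous_on (closure (ball 0 1)) q"
        using holomorphic_on_imp_continuous_on[OF qhol] U by (simp add: continuous_on_subset)
      show "cmod (q z) \<le> 1" if "z \<in> frontier (ball 0 1)" for z
      proof -
        have "cmod z = 1" "z \<in> cball 0 1" using that by (simp_all add: dist_norm)
        then show ?thesis using le1[of z] qcis[of z] U(2) by (metis subsetD)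
      qed
    qed (use that in auto)
    have "cmod (q 0) = cmod (g 0) / cmod a" using a a1 by (simp add: q_def k_def norm_divide)
    then have "cmod (q 0) \<ge> cmod (g 0)"
      using a1 by (simp add: pos_le_divide_eq mult_left_le)
    then show ?thesis using that[of q] qhol qnz qle qcis by simp
  qed
  define N where "N = (\<integral>\<^sup>+\<theta>\<in>{0..2*pi}. e2ennreal (- elog (cmod (g (cis \<theta>)))) \<partial>lebesgue)"
  have "N \<le> ennreal (- (2 * pi * ln (cmod (q 0))))"
    unfolding N_def q(4)[symmetric]
    by (rule nn_integral_neg_log_circle_le)
       (use q U ball_U in \<open>auto intro: holomorphic_on_subset continuous_on_subset holomorphic_on_imp_continuous_on\<close>)
  also have "\<dots> \<le> ennreal (- (2 * pi * ln (cmod (g 0))))"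
    using q(5) g0 by (intro ennreal_leI) (simp add: ln_mono)
  finally have N: "N \<le> ennreal (- (2 * pi * ln (cmod (g 0))))" .
  have nn: "0 \<le> - (2 * pi * ln (cmod (g 0)))"
    using le1[of 0] U g0 by (simp add: mult_nonneg_nonpos subset_eq)
  have "enn2ereal N \<le> ereal (- (2 * pi * ln (cmod (g 0))))"
    using N nn by (metis enn2ereal_ennreal less_eq_ennreal.rep_eq)
  then have le: "ereal (2 * pi * ln (cmod (g 0))) \<le> 0 - enn2ereal N"
    by (cases "enn2ereal N") auto
  \<comment> \<open>The positive part contributes nothing because |g| \<le> 1; the mean consists of
    the negative part \<open>N\<close> alone.\<close>
  have P: "(\<integral>\<^sup>+\<theta>\<in>{0..2*pi}. e2ennreal (elog (cmod (g (cis \<theta>)))) \<partial>lebesgue) = 0"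
  proof -
    have "e2ennreal (elog (cmod (g (cis \<theta>)))) = 0" for \<theta>
      using le1[OF cis_U] by (intro e2ennreal_neg) (auto simp: elog_def)
    then show ?thesis by simp
  qed
  have "elog (cmod (g 0)) = ereal (1 / (2 * pi)) * ereal (2 * pi * ln (cmod (g 0)))"
    using g0 by (simp add: elog_def)
  also have "\<dots> \<le> ereal (1 / (2 * pi)) * (0 - enn2ereal N)"
    using le by (intro ereal_mult_left_mono) auto
  also have "\<dots> = circle_mean (\<lambda>\<theta>. elog (cmod (g (cis \<theta>))))"
    unfolding circle_mean_def P N_def by (simp add: zero_ennreal.rep_eq)
  finally show ?thesis .
qed

section \<open>Bounds for the Azukawa indicatrix\<close>

text \<open>On a complex line with direction \<open>b\<close> the function is \<phi> after an affine
  map of slope \<open>L b\<close>: injective if \<open>L b\<close> is nonzero, constant otherwise.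
  These are the two cases that the sub-mean value inequality above admits.\<close>

lemma psh_on_elog_injective:
  fixes L :: "complex ^ 'n \<Rightarrow> complex"
  assumes op: "open \<Omega>"
    and L: "bounded_linear L" "\<And>c x. L (c *s x) = c * L x"
    and F: "open F" "\<phi> holomorphic_on F" "inj_on \<phi> F"
    and le1: "\<And>z. z \<in> F \<Longrightarrow> cmod (\<phi> z) < 1"
    and sub: "\<And>z. z \<in> \<Omega> \<Longrightarrow> L (z - w) \<in> F"
  shows "(\<lambda>z. elog (cmod (\<phi> (L (z - w))))) \<in> neg_psh \<Omega>"
proof -
  have Lin: "linear L" using L(1) by (rule bounded_linear.linear)
  have "elog (cmod (\<phi> (L (a - w)))) \<le> circle_mean (\<lambda>\<theta>. elog (cmod (\<phi> (L (a + cis \<theta> *s b - w)))))"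
    if ab: "(\<lambda>\<zeta>. a + \<zeta> *s b) ` cball 0 1 \<subseteq> \<Omega>" for a b
  proof -
    define g where "g \<zeta> = \<phi> (L (a - w) + \<zeta> * L b)" for \<zeta>
    define U where "U = (\<lambda>\<zeta>. L (a - w) + \<zeta> * L b) -` F"
    have aff: "L (a + \<zeta> *s b - w) = L (a - w) + \<zeta> * L b" for \<zeta>
      using linear_add[OF Lin, of "a - w" "\<zeta> *s b"] L(2) by (simp add: algebra_simps)
    have "elog (cmod (g 0)) \<le> circle_mean (\<lambda>\<theta>. elog (cmod (g (cis \<theta>))))"
    proof (rule elog_le_circle_mean[of U])
      show "open U" unfolding U_def by (intro open_vimage F continuous_intros)
      show "cball 0 1 \<subseteq> U" using ab sub aff by (force simp: U_def)
      show "g holomorphic_on U" unfolding g_def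
        by (intro holomorphic_on_compose_gen[OF _ F(2), unfolded o_def] holomorphic_intros) (auto simp: U_def)
      show "cmod (g z) \<le> 1" if "z \<in> U" for z
        using le1[of "L (a - w) + z * L b"] that by (simp add: U_def g_def)
      show "inj_on g U \<or> g constant_on U"
      proof (cases "L b = 0")
        case True
        then show ?thesis by (auto simp: g_def constant_on_def)
      next
        case False
        have "inj_on g U"
        proof (rule inj_onI)
          fix x y assume "x \<in> U" "y \<in> U" "g x = g y"
          then have "\<phi> (L (a - w) + x * L b) = \<phi> (L (a - w) + y * L b)"
            "L (a - w) + x * L b \<in> F" "L (a - w) + y * L b \<in> F"
            by (simp_all add: U_def g_def)
          then have "L (a - w) + x * L b = L (a - w) + y * L b"
            by (rule inj_onD[OF F(3)])
          then show "x = y" using False by simp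
        qed
        then show ?thesis ..
      qed
    qed
    then show ?thesis by (simp add: g_def aff)
  qed
  moreover have "Limsup (at z within \<Omega>) (\<lambda>z. elog (cmod (\<phi> (L (z - w))))) \<le> elog (cmod (\<phi> (L (z - w))))"
    if z: "z \<in> \<Omega>" for z
  proof -
    have "isCont \<phi> (L (z - w))"
      using holomorphic_on_imp_continuous_on[OF F(2)] continuous_on_eq_continuous_at[OF F(1)] sub[OF z] by blast
    moreover have "((\<lambda>z. L (z - w)) \<longlongrightarrow> L (z - w)) (at z)"
      by (intro bounded_linear.tendsto[OF L(1)] tendsto_intros)
    ultimately have "((\<lambda>z. \<phi> (L (z - w))) \<longlongrightarrow> \<phi> (L (z - w))) (at z)"
      by (rule isCont_tendsto_compose)
    then have "((\<lambda>z. elog (cmod (\<phi> (L (z - w))))) \<longlongrightarrow> elog (cmod (\<phi> (L (z - w))))) (at z)"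
      by (intro tendsto_elog tendsto_norm)
    then have "Limsup (at z) (\<lambda>z. elog (cmod (\<phi> (L (z - w))))) = elog (cmod (\<phi> (L (z - w))))"
      by (rule lim_imp_Limsup[OF trivial_limit_at])
    then show ?thesis unfolding at_within_open[OF z op] by (rule eq_refl)
  qed
  moreover have "elog (cmod (\<phi> (L (z - w)))) < 0" if "z \<in> \<Omega>" for z
    using le1[OF sub[OF that]] by (simp add: elog_def)
  moreover have "elog (cmod (\<phi> (L (z - w)))) < \<infinity>" for z
    by (simp add: elog_def)
  ultimately show ?thesis
    unfolding neg_psh_def psh_on_def by blast
qed

text \<open>The logarithmic pole comes from two Lipschitz bounds, that of \<phi> at its zero and
  that of the bounded functional \<open>L\<close>.\<close>

lemma green_ge_elog_injective:
  fixes L :: "complex ^ 'n \<Rightarrow> complex"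
  assumes op: "open \<Omega>"
    and L: "bounded_linear L" "\<And>c x. L (c *s x) = c * L x"
    and F: "open F" "0 \<in> F" "\<phi> holomorphic_on F" "inj_on \<phi> F" "\<phi> 0 = 0"
    and le1: "\<And>z. z \<in> F \<Longrightarrow> cmod (\<phi> z) < 1"
    and sub: "\<And>z. z \<in> \<Omega> \<Longrightarrow> L (z - w) \<in> F"
  shows "elog (cmod (\<phi> (L (z - w)))) \<le> green \<Omega> w z"
  unfolding green_def
proof (rule SUP_upper2[where i = "\<lambda>z. elog (cmod (\<phi> (L (z - w))))"])
  obtain K where K: "K > 0" "\<And>x. cmod (L x) \<le> norm x * K"
    using bounded_linear.pos_bounded[OF L(1)] by blast
  have "(\<phi> has_field_derivative deriv \<phi> 0) (at 0)"
    using F by (meson holomorphic_derivI)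
  then have "((\<lambda>z. \<phi> z / z) \<longlongrightarrow> deriv \<phi> 0) (at 0)"
    using F(5) by (simp add: has_field_derivative_iff)
  then have "((\<lambda>z. cmod (\<phi> z / z)) \<longlongrightarrow> cmod (deriv \<phi> 0)) (at 0)"
    by (rule tendsto_norm)
  \<comment> \<open>The added 1 makes the bound strict above the limit and keeps the constant under
    the logarithm positive.\<close>
  then have "\<forall>\<^sub>F z in at 0. cmod (\<phi> z / z) < cmod (deriv \<phi> 0) + 1"
    by (rule order_tendstoD) simp
  then have "\<forall>\<^sub>F z in nhds 0. cmod (\<phi> z) \<le> (cmod (deriv \<phi> 0) + 1) * cmod z"
    unfolding eventually_at_filter
    by eventually_elim (use F(5) in \<open>auto simp: norm_divide divide_less_eq split: if_splits\<close>)
  moreover have "((\<lambda>y. L (y - w)) \<longlongrightarrow> 0) (nhds w)"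
  proof -
    have "((\<lambda>y. L (y - w)) \<longlongrightarrow> L (w - w)) (nhds w)"
      by (intro bounded_linear.tendsto[OF L(1)] tendsto_intros) (simp add: tendsto_def eventually_nhds_x_imp_x filterlim_ident)
    then show ?thesis by (simp add: linear_0[OF bounded_linear.linear[OF L(1)]])
  qed
  ultimately have "\<forall>\<^sub>F y in nhds w. cmod (\<phi> (L (y - w))) \<le> (cmod (deriv \<phi> 0) + 1) * cmod (L (y - w))"
    by (rule eventually_compose_filterlim)
  then have "\<forall>\<^sub>F y in nhds w. elog (cmod (\<phi> (L (y - w)))) \<le> elog (norm (y - w)) + ereal (ln ((cmod (deriv \<phi> 0) + 1) * K))"
  proof eventually_elim
    case (elim y)
    have "(cmod (deriv \<phi> 0) + 1) * cmod (L (y - w)) \<le> (cmod (deriv \<phi> 0) + 1) * (norm (y - w) * K)"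
      using K by (intro mult_left_mono) auto
    with elim have "cmod (\<phi> (L (y - w))) \<le> norm (y - w) * ((cmod (deriv \<phi> 0) + 1) * K)"
      by (simp add: mult_ac)
    then have "elog (cmod (\<phi> (L (y - w)))) \<le> elog (norm (y - w) * ((cmod (deriv \<phi> 0) + 1) * K))"
      by (rule elog_mono)
    also have "\<dots> = elog (norm (y - w)) + ereal (ln ((cmod (deriv \<phi> 0) + 1) * K))"
      using K(1) by (intro elog_mult mult_pos_pos) (auto intro: add_nonneg_pos)
    finally show ?case .
  qed
  then show "(\<lambda>z. elog (cmod (\<phi> (L (z - w))))) \<in> {u \<in> neg_psh \<Omega>. \<exists>C. \<forall>\<^sub>F y in nhds w. u y \<le> elog (norm (y - w)) + ereal C}"
    using psh_on_elog_injective[OF op L F(1,3,4) le1 sub] by blast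
qed simp

text \<open>Along \<open>w + \<zeta> *s X\<close> the competitor minus log |\<zeta>| tends to the
  logarithm of |\<phi>'(0) L(X)|, which is therefore at most the upper limit that defines the
  indicatrix.\<close>

lemma azukawa_indicatrix_injective_less:
  fixes L :: "complex ^ 'n \<Rightarrow> complex"
  assumes op: "open \<Omega>"
    and L: "bounded_linear L" "\<And>c x. L (c *s x) = c * L x"
    and F: "open F" "0 \<in> F" "\<phi> holomorphic_on F" "inj_on \<phi> F" "\<phi> 0 = 0"
    and le1: "\<And>z. z \<in> F \<Longrightarrow> cmod (\<phi> z) < 1"
    and sub: "\<And>z. z \<in> \<Omega> \<Longrightarrow> L (z - w) \<in> F"
    and X: "X \<in> azukawa_indicatrix \<Omega> w"
  shows "cmod (deriv \<phi> 0 * L X) < 1"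
proof -
  have "(\<phi> has_field_derivative deriv \<phi> 0) (at 0)"
    using F by (meson holomorphic_derivI)
  then have "((\<lambda>\<zeta>. \<phi> (\<zeta> * L X)) has_field_derivative deriv \<phi> 0 * L X) (at 0)"
    using DERIV_chain2[of \<phi> "deriv \<phi> 0" "\<lambda>\<zeta>. \<zeta> * L X" 0 "L X" UNIV] DERIV_cmult_right[OF DERIV_ident, of "L X" 0 UNIV]
    by simp
  then have "((\<lambda>\<zeta>. \<phi> (\<zeta> * L X) / \<zeta>) \<longlongrightarrow> deriv \<phi> 0 * L X) (at 0)"
    using F(5) by (simp add: has_field_derivative_iff)
  then have lim: "((\<lambda>\<zeta>. elog (cmod (\<phi> (\<zeta> * L X) / \<zeta>))) \<longlongrightarrow> elog (cmod (deriv \<phi> 0 * L X))) (at 0)"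
    by (intro tendsto_elog tendsto_norm)
  have "elog (cmod (deriv \<phi> 0 * L X)) = Limsup (at 0) (\<lambda>\<zeta>. elog (cmod (\<phi> (\<zeta> * L X) / \<zeta>)))"
    using lim by (intro lim_imp_Limsup[symmetric]) auto
  also have "\<dots> \<le> Limsup (at 0) (\<lambda>\<zeta>. green \<Omega> w (w + \<zeta> *s X) - elog (cmod \<zeta>))"
  proof (rule Limsup_mono)
    show "\<forall>\<^sub>F \<zeta> in at 0. elog (cmod (\<phi> (\<zeta> * L X) / \<zeta>)) \<le> green \<Omega> w (w + \<zeta> *s X) - elog (cmod \<zeta>)"
    proof (rule eventually_at_filter[THEN iffD2], rule always_eventually, intro allI impI)
      fix \<zeta> :: complex assume "\<zeta> \<noteq> 0"
      have "elog (cmod (\<phi> (\<zeta> * L X) / \<zeta>)) = elog (cmod (\<phi> (\<zeta> * L X))) + ereal (ln (1 / cmod \<zeta>))"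
        using elog_mult[of "1 / cmod \<zeta>"] \<open>\<zeta> \<noteq> 0\<close> by (simp add: norm_divide)
      also have "\<dots> = elog (cmod (\<phi> (\<zeta> * L X))) - elog (cmod \<zeta>)"
        using \<open>\<zeta> \<noteq> 0\<close> by (simp add: elog_def[of "cmod \<zeta>"] ln_div minus_ereal_def)
      also have "\<dots> \<le> green \<Omega> w (w + \<zeta> *s X) - elog (cmod \<zeta>)"
        using green_ge_elog_injective[OF assms(1-10), where z="w + \<zeta> *s X"] sub
        by (intro ereal_minus_mono) (auto simp: L(2))
      finally show "elog (cmod (\<phi> (\<zeta> * L X) / \<zeta>)) \<le> green \<Omega> w (w + \<zeta> *s X) - elog (cmod \<zeta>)" .
    qed
  qed
  also have "\<dots> < 0" using X by (simp add: azukawa_indicatrix_def)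
  finally show ?thesis by (auto simp: elog_def split: if_splits)
qed

section \<open>The indicatrix is balanced\<close>

lemma Limsup_compose_filterlim_le:
  fixes h :: "'b \<Rightarrow> 'c::complete_linorder"
  assumes "filterlim g G F"
  shows "Limsup F (\<lambda>x. h (g x)) \<le> Limsup G h"
proof -
  have "Limsup F (\<lambda>x. h (g x)) \<le> Limsup (filtermap g F) h"
    by (rule Limsup_filtermap_ge)
  also have "\<dots> \<le> Limsup G h"
    using assms unfolding Limsup_def filterlim_def le_filter_def
    by (intro INF_superset_mono) auto
  finally show ?thesis .
qed

text \<open>For nonzero \<open>c\<close>, substitute \<open>c * \<zeta>\<close> in the upper limit
  for \<open>X\<close>: the Green function is evaluated at the same point as for
  \<open>c *s X\<close>, and the subtracted logarithm is no larger. The case c = 0 rests on the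
  value at the pole.\<close>

lemma azukawa_indicatrix_balanced:
  fixes X :: "complex ^ 'n"
  assumes X: "X \<in> azukawa_indicatrix \<Omega> w" and c: "cmod c \<le> 1"
  shows "c *s X \<in> azukawa_indicatrix \<Omega> w"
proof (cases "c = 0")
  case True
  \<comment> \<open>The bound at the pole is imposed on a full neighbourhood, \<open>w\<close>
    included, so every competitor is -\<infinity> there.\<close>
  have "green \<Omega> w w = -\<infinity>"
    unfolding green_def
  proof (rule SUP_eqI)
    fix u assume "u \<in> {u \<in> neg_psh \<Omega>. \<exists>C. \<forall>\<^sub>F y in nhds w. u y \<le> elog (norm (y - w)) + ereal C}"
    then obtain C where "\<forall>\<^sub>F y in nhds w. u y \<le> elog (norm (y - w)) + ereal C" by blast
    then have "u w \<le> elog (norm (w - w)) + ereal C" by (rule eventually_nhds_x_imp_x)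
    then show "u w \<le> -\<infinity>" by (simp add: elog_def)
  qed auto
  then have "\<forall>\<^sub>F \<zeta> in at (0::complex). green \<Omega> w (w + \<zeta> *s 0) - elog (cmod \<zeta>) = -\<infinity>"
    by (auto simp: eventually_at_filter elog_def)
  then have "Limsup (at 0) (\<lambda>\<zeta>::complex. green \<Omega> w (w + \<zeta> *s 0) - elog (cmod \<zeta>)) = Limsup (at (0::complex)) (\<lambda>_. -\<infinity>)"
    by (rule Limsup_eq)
  also have "\<dots> = -\<infinity>" by (simp add: Limsup_const)
  finally show ?thesis using True by (simp add: azukawa_indicatrix_def)
next
  case False
  define h where "h \<zeta> = green \<Omega> w (w + \<zeta> *s X) - elog (cmod \<zeta>)" for \<zeta>
  have "Limsup (at 0) (\<lambda>\<zeta>. green \<Omega> w (w + \<zeta> *s (c *s X)) - elog (cmod \<zeta>)) \<le> Limsup (at 0) (\<lambda>\<zeta>. h (c * \<zeta>))"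
  proof (rule Limsup_mono, rule eventually_at_filter[THEN iffD2], rule always_eventually, intro allI impI)
    fix \<zeta> :: complex assume "\<zeta> \<noteq> 0"
    have "elog (cmod (c * \<zeta>)) \<le> elog (cmod \<zeta>)"
      using c by (intro elog_mono) (simp add: norm_mult mult_left_le_one_le)
    then show "green \<Omega> w (w + \<zeta> *s (c *s X)) - elog (cmod \<zeta>) \<le> h (c * \<zeta>)"
      unfolding h_def by (intro ereal_minus_mono) (auto simp: vector_smult_assoc mult.commute)
  qed
  also have "\<dots> \<le> Limsup (at 0) h"
  proof (rule Limsup_compose_filterlim_le)
    have "((\<lambda>\<zeta>. c * \<zeta>) \<longlongrightarrow> c * 0) (at 0)" by (intro tendsto_intros)
    then show "filterlim (\<lambda>\<zeta>. c * \<zeta>) (at 0) (at 0)"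
      using False by (auto simp: filterlim_at eventually_at_filter)
  qed
  also have "\<dots> < 0" using X by (simp add: azukawa_indicatrix_def h_def[abs_def])
  finally show ?thesis by (simp add: azukawa_indicatrix_def)
qed

section \<open>Convex domains\<close>

text \<open>The mean value estimate is applied to the balanced set \<open>J\<close>, the indicatrix
  scaled by \<open>t\<close>. Volumes 0 and \<infinity> and a nonmeasurable indicatrix need separate
  treatment under the conventions for division in \<open>ennreal\<close>.\<close>

lemma bergman_kernel_le_if_scaled_azukawa_subset:
  fixes \<Omega> :: "(complex ^ 'n) set"
  assumes op: "open \<Omega>" and t: "t > 0"
    and sub: "\<And>X. X \<in> azukawa_indicatrix \<Omega> w \<Longrightarrow> w + t *\<^sub>R X \<in> \<Omega>"
  shows "bergman_kernel \<Omega> w \<le> ennreal ((1 / t\<^sup>2) ^ CARD('n)) / emeasure lebesgue (azukawa_indicatrix \<Omega> w)"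
    (is "_ \<le> ennreal ?C / emeasure lebesgue ?I")
proof -
  have C: "?C > 0" using t by simp
  show ?thesis
  proof (cases "?I \<in> sets lebesgue")
    \<comment> \<open>A nonmeasurable set has \<open>emeasure\<close> 0, which makes the right-hand
      side infinite.\<close>
    case False
    then show ?thesis using C t by (simp add: emeasure_notin_sets)
  next
    case I: True
    define J where "J = (\<lambda>X. t *\<^sub>R X) ` ?I"
    have J: "J \<in> sets lebesgue"
    proof -
      have "J = (\<lambda>X. (1/t) *\<^sub>R X) -` ?I \<inter> space lebesgue"
        using t by (auto simp: J_def image_iff intro!: bexI[of _ "(1/t) *\<^sub>R _"])
      then show ?thesis using measurable_sets[OF lebesgue_measurable_scaling I] by metis
    qed
    have eJ: "emeasure lebesgue J = ennreal (1 / ?C) * emeasure lebesgue ?I"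
    proof -
      have "emeasure lebesgue J = ennreal (\<bar>t\<bar> ^ DIM(complex ^ 'n)) * emeasure lebesgue ?I"
        using emeasure_lebesgue_affine[of t 0 ?I] by (simp add: J_def)
      \<comment> \<open>The real dimension is twice \<open>CARD('n)\<close>, hence the square of
        \<open>t\<close> in the constant.\<close>
      also have "\<bar>t\<bar> ^ DIM(complex ^ 'n) = 1 / ?C"
        using t by (simp add: power_one_over power_mult[symmetric] mult.commute)
      finally show ?thesis .
    qed
    show ?thesis
      unfolding bergman_kernel_def
    proof (rule SUP_least)
      fix f assume "f \<in> {f. holomorphic_on_Cn f \<Omega> \<and> (\<integral>\<^sup>+z\<in>\<Omega>. ennreal ((cmod (f z))\<^sup>2) \<partial>lebesgue) \<le> 1}"
      then have f: "holomorphic_on_Cn f \<Omega>" "(\<integral>\<^sup>+z\<in>\<Omega>. ennreal ((cmod (f z))\<^sup>2) \<partial>lebesgue) \<le> 1" by auto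
      have "ennreal ((cmod (f w))\<^sup>2) * emeasure lebesgue J \<le> (\<integral>\<^sup>+z\<in>\<Omega>. ennreal ((cmod (f z))\<^sup>2) \<partial>lebesgue)"
      proof (rule sub_mean_value_balanced[OF op f(1) J])
        show "w + Y \<in> \<Omega>" if "Y \<in> J" for Y using that sub by (auto simp: J_def)
        show "c *s Y \<in> J" if Y: "Y \<in> J" and c: "cmod c \<le> 1" for Y c
        proof -
          obtain X where X: "X \<in> ?I" "Y = t *\<^sub>R X" using Y by (auto simp: J_def)
          have "c *s Y = t *\<^sub>R (c *s X)" by (simp add: X vec_eq_iff)
          then show ?thesis using azukawa_indicatrix_balanced[OF X(1) c] by (auto simp: J_def)
        qed
      qed
      then have le: "ennreal ((cmod (f w))\<^sup>2) * (ennreal (1 / ?C) * emeasure lebesgue ?I) \<le> 1"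
        unfolding eJ using f(2) by (rule order_trans)
      show "ennreal ((cmod (f w))\<^sup>2) \<le> ennreal ?C / emeasure lebesgue ?I"
      proof (cases "emeasure lebesgue ?I")
        case top
        \<comment> \<open>Infinite volume makes the right-hand side 0, so the function must vanish
          at \<open>w\<close>.\<close>
        have "cmod (f w) = 0"
        proof (rule ccontr)
          assume "cmod (f w) \<noteq> 0"
          then have "ennreal ((cmod (f w))\<^sup>2) * (ennreal (1 / ?C) * emeasure lebesgue ?I) = top"
            using C t unfolding top by (simp add: ennreal_mult_top)
          then show False using neq_top_trans[OF _ le] by simp
        qed
        then show ?thesis by simp
      next
        case (real m)
        have "ennreal ((cmod (f w))\<^sup>2 * (1 / ?C * m)) \<le> 1"
          using le real C by (simp add: ennreal_mult[symmetric])
        then have m: "(cmod (f w))\<^sup>2 * (1 / ?C * m) \<le> 1" by simp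
        show ?thesis
        proof (cases "m = 0")
          case True
          then show ?thesis using C t real by simp
        next
          case False
          then have "m > 0" using real by simp
          then have "(cmod (f w))\<^sup>2 \<le> ?C / m" using m C by (simp add: field_simps)
          then show ?thesis unfolding real using \<open>m > 0\<close> C by (simp add: divide_ennreal ennreal_leI)
        qed
      qed
    qed
  qed
qed

text \<open>A real linear functional is the real part of a complex linear one, so real separation
  suffices.\<close>

lemma convex_open_complex_separation:
  fixes \<Omega> :: "(complex ^ 'n) set"
  assumes "convex \<Omega>" "open \<Omega>" "\<Omega> \<noteq> {}" "a \<notin> \<Omega>"
  obtains L :: "complex ^ 'n \<Rightarrow> complex" where
    "bounded_linear L" "\<And>c x. L (c *s x) = c * L x" "\<And>z. z \<in> \<Omega> \<Longrightarrow> Re (L z) < Re (L a)"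
proof -
  obtain v b where v: "v \<noteq> 0" "\<And>x. x \<in> \<Omega> \<Longrightarrow> v \<bullet> x \<le> b" "b \<le> v \<bullet> a"
    using separating_hyperplane_sets[of \<Omega> "{a}"] assms by auto
  define L where "L z = (\<Sum>i\<in>UNIV. cnj (v $ i) * z $ i)" for z :: "complex ^ 'n"
  have "linear L"
    by (rule linearI) (auto simp: L_def algebra_simps sum.distrib scaleR_sum_right)
  then have bl: "bounded_linear L" by (simp add: linear_conv_bounded_linear)
  have hom: "L (c *s x) = c * L x" for c x
    by (simp add: L_def sum_distrib_left mult_ac)
  have Re: "Re (L z) = v \<bullet> z" for z
    by (simp add: L_def inner_vec_def inner_complex_def)
  have "Re (L z) < Re (L a)" if z: "z \<in> \<Omega>" for z
  proof -
    obtain e where e: "e > 0" "cball z e \<subseteq> \<Omega>" using assms(2) z by (meson open_contains_cball)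
    \<comment> \<open>Openness makes the inequality strict: the point can still be moved in the
      direction of \<open>v\<close> within the domain.\<close>
    have "z + (e / norm v) *\<^sub>R v \<in> \<Omega>" using e v by (intro subsetD[OF e(2)]) (simp add: dist_norm)
    then have "v \<bullet> (z + (e / norm v) *\<^sub>R v) \<le> b" by (rule v)
    moreover have "v \<bullet> (z + (e / norm v) *\<^sub>R v) = v \<bullet> z + e / norm v * (v \<bullet> v)" by (simp add: inner_right_distrib)
    moreover have "e / norm v * (v \<bullet> v) > 0" using e v by simp
    ultimately show ?thesis unfolding Re using v(3) by linarith
  qed
  then show thesis using that bl hom by blast
qed

text \<open>This is why the Cayley transform \<open>(e - 1) / (e + 1)\<close> maps the right
  half-plane into the unit disc; it serves both the half-plane and the strip.\<close>

lemma cmod_diff_one_less_add_one_iff: "cmod (e - 1) < cmod (e + 1) \<longleftrightarrow> 0 < Re e"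
proof -
  have "cmod (e - 1) < cmod (e + 1) \<longleftrightarrow> (cmod (e - 1))\<^sup>2 < (cmod (e + 1))\<^sup>2"
    by (simp add: power_mono_iff linorder_not_le[symmetric])
  also have "\<dots> \<longleftrightarrow> 0 < Re e" unfolding cmod_power2 by (simp add: power2_eq_square algebra_simps)
  finally show ?thesis .
qed

lemma azukawa_indicatrix_convex_subset:
  fixes \<Omega> :: "(complex ^ 'n) set"
  assumes conv: "convex \<Omega>" and op: "open \<Omega>" and w: "w \<in> \<Omega>"
    and X: "X \<in> azukawa_indicatrix \<Omega> w"
  shows "w + (1/2) *\<^sub>R X \<in> \<Omega>"
proof (rule ccontr)
  assume "w + (1/2) *\<^sub>R X \<notin> \<Omega>"
  then obtain L :: "complex ^ 'n \<Rightarrow> complex" where L: "bounded_linear L" "\<And>c x. L (c *s x) = c * L x"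
    and sep: "\<And>z. z \<in> \<Omega> \<Longrightarrow> Re (L z) < Re (L (w + (1/2) *\<^sub>R X))"
    using convex_open_complex_separation[OF conv op] w by blast
  note Lin = bounded_linear.linear[OF L(1)]
  define \<alpha> where "\<alpha> = Re (L X) / 2"
  have \<alpha>: "Re (L (z - w)) < \<alpha>" if "z \<in> \<Omega>" for z
    using sep[OF that] by (simp add: \<alpha>_def linear_diff[OF Lin] linear_add[OF Lin] linear_cmul[OF Lin])
  have \<alpha>_pos: "\<alpha> > 0" using \<alpha>[OF w] by (simp add: linear_0[OF Lin])
  define F where "F = {\<zeta>. Re \<zeta> < \<alpha>}"
  \<comment> \<open>\<open>2 * \<alpha>\<close> is the mirror image of 0 in the boundary line, so
    this is the Riemann map of the half-plane. Its derivative at 0 is 1/(2\<alpha>) = 1/Re(L(X)),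
    too large for \<open>X\<close> in the indicatrix.\<close>
  define \<phi> where "\<phi> \<zeta> = \<zeta> / (2 * of_real \<alpha> - \<zeta>)" for \<zeta> :: complex
  have den: "2 * of_real \<alpha> - \<zeta> \<noteq> 0" if "\<zeta> \<in> F" for \<zeta>
    using that \<alpha>_pos by (auto simp: F_def complex_eq_iff)
  have "cmod (deriv \<phi> 0 * L X) < 1"
  proof (rule azukawa_indicatrix_injective_less[OF op L _ _ _ _ _ _ _ X])
    show "open F" unfolding F_def by (rule open_halfspace_Re_lt)
    show "0 \<in> F" using \<alpha>_pos by (simp add: F_def)
    show "\<phi> holomorphic_on F" unfolding \<phi>_def using den by (intro holomorphic_intros) auto
    show "inj_on \<phi> F"
    proof (rule inj_onI)
      fix x y assume xy: "x \<in> F" "y \<in> F" "\<phi> x = \<phi> y"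
      then have "x * (2 * of_real \<alpha> - y) = y * (2 * of_real \<alpha> - x)"
        using den by (simp add: \<phi>_def frac_eq_eq)
      then show "x = y" using \<alpha>_pos by (simp add: algebra_simps)
    qed
    show "\<phi> 0 = 0" by (simp add: \<phi>_def)
    show "cmod (\<phi> \<zeta>) < 1" if "\<zeta> \<in> F" for \<zeta>
    proof -
      have "0 < Re (1 - \<zeta> / of_real \<alpha>)" using that \<alpha>_pos by (simp add: F_def)
      then have "cmod (- \<zeta> / of_real \<alpha>) < cmod (2 - \<zeta> / of_real \<alpha>)"
        using cmod_diff_one_less_add_one_iff[of "1 - \<zeta> / of_real \<alpha>"] by (simp add: algebra_simps)
      also have "2 - \<zeta> / of_real \<alpha> = (2 * of_real \<alpha> - \<zeta>) / of_real \<alpha>" using \<alpha>_pos by (simp add: field_simps)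
      finally have "cmod \<zeta> < cmod (2 * of_real \<alpha> - \<zeta>)"
        using \<alpha>_pos by (simp add: norm_divide divide_less_cancel)
      then show ?thesis using den[OF that] by (simp add: \<phi>_def norm_divide)
    qed
    show "L (z - w) \<in> F" if "z \<in> \<Omega>" for z using \<alpha>[OF that] by (simp add: F_def)
  qed
  moreover have "deriv \<phi> 0 = 1 / (2 * of_real \<alpha>)"
    unfolding \<phi>_def using \<alpha>_pos by (intro DERIV_imp_deriv) (auto intro!: derivative_eq_intros simp: power2_eq_square)
  ultimately have "cmod (L X) < 2 * \<alpha>"
    using \<alpha>_pos by (simp add: norm_divide norm_mult)
  then show False using complex_Re_le_cmod[of "L X"] by (simp add: \<alpha>_def)
qed

lemma azukawa_indicatrix_convex_symmetric_subset:
  fixes \<Omega> :: "(complex ^ 'n) set"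
  assumes conv: "convex \<Omega>" and op: "open \<Omega>" and w: "w \<in> \<Omega>" and sym: "symmetric_wrt \<Omega> w"
    and X: "X \<in> azukawa_indicatrix \<Omega> w"
  shows "w + (pi/4) *\<^sub>R X \<in> \<Omega>"
proof (rule ccontr)
  assume "w + (pi/4) *\<^sub>R X \<notin> \<Omega>"
  then obtain L :: "complex ^ 'n \<Rightarrow> complex" where L: "bounded_linear L" "\<And>c x. L (c *s x) = c * L x"
    and sep: "\<And>z. z \<in> \<Omega> \<Longrightarrow> Re (L z) < Re (L (w + (pi/4) *\<^sub>R X))"
    using convex_open_complex_separation[OF conv op] w by blast
  note Lin = bounded_linear.linear[OF L(1)]
  define \<alpha> where "\<alpha> = Re (L X) * pi / 4"
  have \<alpha>: "Re (L (z - w)) < \<alpha>" if "z \<in> \<Omega>" for z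
    using sep[OF that] by (simp add: \<alpha>_def linear_diff[OF Lin] linear_add[OF Lin] linear_cmul[OF Lin] mult.commute)
  have \<alpha>': "\<bar>Re (L (z - w))\<bar> < \<alpha>" if "z \<in> \<Omega>" for z
  proof -
    \<comment> \<open>The reflection in \<open>w\<close> turns the one-sided bound into a
      strip.\<close>
    have "w - (z - w) \<in> \<Omega>" using sym[unfolded symmetric_wrt_def, rule_format, of "z - w"] that by simp
    from \<alpha>[OF this] have "- Re (L (z - w)) < \<alpha>" using linear_neg[OF Lin, of "z - w"] by simp
    then show ?thesis using \<alpha>[OF that] by linarith
  qed
  have \<alpha>_pos: "\<alpha> > 0" using \<alpha>[OF w] by (simp add: linear_0[OF Lin])
  define F where "F = {\<zeta>. \<bar>Re \<zeta>\<bar> < \<alpha>}"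
  define s where "s = \<i> * of_real (pi / (2 * \<alpha>))"
  \<comment> \<open>Multiplication by \<open>s\<close> turns the strip to |Im| < pi/2,
    \<open>exp\<close> opens it to the right half-plane, and the Cayley transform follows. The
    derivative at 0 has modulus pi/(4\<alpha>) = 1/Re(L(X)).\<close>
  define \<phi> where "\<phi> \<zeta> = (exp (s * \<zeta>) - 1) / (exp (s * \<zeta>) + 1)" for \<zeta> :: complex
  have Im_s: "\<bar>Im (s * \<zeta>)\<bar> < pi / 2" if "\<zeta> \<in> F" for \<zeta>
  proof -
    have "Im (s * \<zeta>) = Re \<zeta> / \<alpha> * (pi / 2)" by (simp add: s_def mult_ac)
    moreover have "\<bar>Re \<zeta> / \<alpha>\<bar> < 1" using that \<alpha>_pos by (simp add: F_def)
    ultimately show ?thesis using mult_strict_right_mono[of "\<bar>Re \<zeta> / \<alpha>\<bar>" 1 "pi / 2"] by (simp add: abs_mult)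
  qed
  have Re_e: "0 < Re (exp (s * \<zeta>))" if "\<zeta> \<in> F" for \<zeta>
    using Im_s[OF that] unfolding Re_exp by (intro mult_pos_pos cos_gt_zero_pi) (auto simp: abs_less_iff simp del: times_complex.sel)
  have den: "exp (s * \<zeta>) + 1 \<noteq> 0" if "\<zeta> \<in> F" for \<zeta>
    using Re_e[OF that] by (auto simp: complex_eq_iff)
  have "cmod (deriv \<phi> 0 * L X) < 1"
  proof (rule azukawa_indicatrix_injective_less[OF op L _ _ _ _ _ _ _ X])
    have "F = {\<zeta>. Re \<zeta> < \<alpha>} \<inter> {\<zeta>. Re \<zeta> > -\<alpha>}" by (auto simp: F_def)
    then show "open F" by (simp add: open_Int open_halfspace_Re_lt open_halfspace_Re_gt)
    show "0 \<in> F" using \<alpha>_pos by (simp add: F_def)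
    show "\<phi> holomorphic_on F" unfolding \<phi>_def using den by (intro holomorphic_intros) auto
    show "inj_on \<phi> F"
    proof (rule inj_onI)
      fix x y assume xy: "x \<in> F" "y \<in> F" "\<phi> x = \<phi> y"
      then have "(exp (s * x) - 1) * (exp (s * y) + 1) = (exp (s * y) - 1) * (exp (s * x) + 1)"
        using den by (simp add: \<phi>_def frac_eq_eq)
      then have e: "exp (s * x) = exp (s * y)" by (simp add: algebra_simps)
      have "s * x = s * y"
      proof (rule exp_complex_eqI[OF _ e])
        show "\<bar>Im (s * x) - Im (s * y)\<bar> < 2 * pi" using Im_s[OF xy(1)] Im_s[OF xy(2)] by linarith
      qed
      then show "x = y" using \<alpha>_pos by (simp add: s_def)
    qed
    show "\<phi> 0 = 0" by (simp add: \<phi>_def)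
    show "cmod (\<phi> \<zeta>) < 1" if "\<zeta> \<in> F" for \<zeta>
      using Re_e[OF that] den[OF that] cmod_diff_one_less_add_one_iff[of "exp (s * \<zeta>)"]
      by (simp add: \<phi>_def norm_divide)
    show "L (z - w) \<in> F" if "z \<in> \<Omega>" for z using \<alpha>'[OF that] by (simp add: F_def)
  qed
  moreover have "deriv \<phi> 0 = s / 2"
    unfolding \<phi>_def by (intro DERIV_imp_deriv) (auto intro!: derivative_eq_intros simp: field_simps)
  ultimately have "cmod (L X) * pi < 4 * \<alpha>"
    using \<alpha>_pos by (simp add: s_def norm_divide norm_mult field_simps)
  moreover have "Re (L X) * pi \<le> cmod (L X) * pi" using complex_Re_le_cmod by (intro mult_right_mono) auto
  ultimately show False by (simp add: \<alpha>_def)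
qed

section \<open>The Koebe quarter theorem\<close>

lemma has_integral_isometry:
  fixes T :: "'a::euclidean_space \<Rightarrow> 'b::euclidean_space" and f :: "'b \<Rightarrow> real"
  assumes T: "linear T" "\<And>x. norm (T x) = norm x" "surj T"
    and f: "\<And>y. y \<in> S \<Longrightarrow> 0 \<le> f y" "(f has_integral b) S"
  shows "((\<lambda>x. f (T x)) has_integral b) (T -` S)"
proof -
  define F where "F y = (if y \<in> S then f y else 0)" for y
  have F: "0 \<le> F y" for y using f(1) by (simp add: F_def)
  have "(F has_integral b) UNIV" using f(2) unfolding F_def by (simp add: has_integral_restrict_UNIV)
  then have m: "F \<in> borel_measurable lebesgue" and i: "integral\<^sup>N lebesgue F = b" and b: "0 \<le> b"
    using has_integral_iff_nn_integral_lebesgue[of F b] F by auto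
  have "(\<lambda>x. F (T x)) \<in> borel_measurable lebesgue"
    using distr_lebesgue_isometry(1)[OF T] m by (rule measurable_compose)
  moreover have "(\<integral>\<^sup>+x. ennreal (F (T x)) \<partial>lebesgue) = b"
    using nn_integral_lebesgue_isometry[OF T, of "\<lambda>y. ennreal (F y)"] m i by simp
  ultimately have "((\<lambda>x. F (T x)) has_integral b) UNIV"
    using has_integral_iff_nn_integral_lebesgue[of "\<lambda>x. F (T x)" b] F b by auto
  moreover have "(\<lambda>x. F (T x)) = (\<lambda>x. if x \<in> T -` S then f (T x) else 0)" by (auto simp: F_def)
  ultimately show ?thesis using has_integral_restrict_UNIV by metis
qed

text \<open>The problem is carried over to \<open>real ^ 2\<close>, where the change of variables
  formula is stated with determinants; multiplication by a complex number q has determinant |q|^2.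
  For nonnegative \<open>f\<close> integrability on one side gives it on the other.\<close>

lemma has_integral_holomorphic_image:
  fixes g :: "complex \<Rightarrow> complex" and f :: "complex \<Rightarrow> real"
  assumes S: "open S" and g: "g holomorphic_on S" "inj_on g S"
    and f: "\<And>w. 0 \<le> f w"
    and int: "((\<lambda>z. (cmod (deriv g z))\<^sup>2 * f (g z)) has_integral b) S"
  shows "(f has_integral b) (g ` S)"
proof -
  obtain h where h: "h holomorphic_on g ` S" "\<And>z. z \<in> S \<Longrightarrow> deriv g z * deriv h (g z) = 1" "\<And>z. z \<in> S \<Longrightarrow> h (g z) = z"
    using holomorphic_has_inverse[OF g(1) S g(2)] by metis
  have op: "open (g ` S)" using open_mapping_thm3[OF g(1) S g(2)] .
  define T :: "complex \<Rightarrow> real ^ 2" where "T z = vector [Re z, Im z]" for z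
  define T' :: "real ^ 2 \<Rightarrow> complex" where "T' y = Complex (y $ 1) (y $ 2)" for y
  have TT': "T (T' y) = y" and T'T: "T' (T z) = z" for y z
    by (simp_all add: T_def T'_def vec_eq_iff forall_2 complex_eq_iff)
  have linT: "linear T" by (rule linearI) (simp_all add: T_def vec_eq_iff forall_2)
  have linT': "linear T'" by (rule linearI) (simp_all add: T'_def complex_eq_iff)
  have normT: "norm (T z) = norm z" for z
    by (simp add: norm_vec_def L2_set_def T_def sum_2 cmod_def)
  have normT': "norm (T' y) = norm y" for y using normT[of "T' y"] by (simp add: TT')
  have surT: "surj T" "surj T'" by (metis TT' surjI, metis T'T surjI)
  note bl = linear_conv_bounded_linear[THEN iffD1]
  define D where "D = (\<lambda>q h. T (q * T' h))"
  have dT: "((\<lambda>y. T (q (T' y))) has_derivative D (deriv q (T' y))) (at y within X)"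
    if q: "(q has_field_derivative deriv q (T' y)) (at (T' y))" for q y X
    unfolding D_def
    by (rule has_derivative_at_withinI)
       (intro has_derivative_compose[OF bounded_linear_imp_has_derivative[OF bl[OF linT']]]
         has_derivative_compose[OF _ bounded_linear_imp_has_derivative[OF bl[OF linT]]]
         has_field_derivative_imp_has_derivative q)
  have det: "\<bar>det (matrix (D q))\<bar> = (cmod q)\<^sup>2" for q
  proof -
    have "det (matrix (D q)) = (cmod q)\<^sup>2"
      unfolding cmod_power2 by (simp add: det_2 matrix_def D_def T_def T'_def axis_def power2_eq_square)
    then show ?thesis by simp
  qed
  have vim: "T' -` X = T ` X" "T -` (T ` X) = X" for X
    using TT' T'T by (auto simp: image_iff) (metis+)
  have i1: "((\<lambda>y. (cmod (deriv g (T' y)))\<^sup>2 * f (g (T' y))) has_integral b) (T ` S)"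
    using has_integral_isometry[OF linT' normT' surT(2) _ int] f unfolding vim by simp
  have "((\<lambda>y. \<bar>det (matrix (D (deriv g (T' y))))\<bar> * f (T' (T (g (T' y))))) has_integral b) (T ` S)
     \<longleftrightarrow> ((\<lambda>y. f (T' y)) has_integral b) (T ` g ` S)"
  proof (rule cov_invertible_nonneg_eq[where h = "\<lambda>y. T (h (T' y))" and h' = "\<lambda>y. D (deriv h (T' y))" and g = "\<lambda>y. T (g (T' y))"])
    show "((\<lambda>y. T (g (T' y))) has_derivative D (deriv g (T' x))) (at x within T ` S)" if "x \<in> T ` S" for x
      using that by (intro dT holomorphic_derivI[OF g(1) S]) (auto simp: T'T)
    show "((\<lambda>y. T (h (T' y))) has_derivative D (deriv h (T' y))) (at y within T ` g ` S)" if "y \<in> T ` g ` S" for y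
      using that by (intro dT holomorphic_derivI[OF h(1) op]) (auto simp: T'T)
    show "D (deriv h (T' y)) \<circ> D (deriv g (T' (T (h (T' y))))) = id" if y: "y \<in> T ` g ` S" for y
    proof -
      obtain z where z: "z \<in> S" "y = T (g z)" using y by auto
      have e: "deriv h (g z) * (deriv g z * v) = v" for v
        using h(2)[OF z(1)] by (metis mult.assoc mult.commute mult_1)
      show ?thesis unfolding z(2) T'T h(3)[OF z(1)] D_def o_def e TT' id_def ..
    qed
  qed (use f h(3) in \<open>auto simp: T'T\<close>)
  with i1 have "((\<lambda>y. f (T' y)) has_integral b) (T ` g ` S)" by (simp add: det T'T)
  from has_integral_isometry[OF linT normT surT(1) _ this] f show ?thesis
    unfolding vim by (simp add: T'T)
qed

text \<open>Fubini for a continuous integrand, after an isometry from the complex plane to the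
  product of two lines.\<close>

lemma has_integral_complex_box:
  fixes f :: "complex \<Rightarrow> real"
  assumes f: "continuous_on (cbox a b) f" "\<And>z. z \<in> cbox a b \<Longrightarrow> 0 \<le> f z"
  shows "(f has_integral integral {Re a..Re b} (\<lambda>x. integral {Im a..Im b} (\<lambda>y. f (Complex x y)))) (cbox a b)"
proof -
  define T where "T z = (Re z, Im z)" for z
  have T: "linear T" "\<And>z. norm (T z) = norm z" "surj T"
    by (auto simp: T_def norm_prod_def cmod_def intro!: linearI surjI[of _ "\<lambda>p. Complex (fst p) (snd p)"])
  define F where "F p = f (Complex (fst p) (snd p))" for p
  let ?B = "cbox (Re a, Im a) (Re b, Im b)"
  have "continuous_on ?B F"
    unfolding F_def
    by (intro continuous_on_compose2[OF f(1)] continuous_on_Complex continuous_intros)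
       (auto simp: in_cbox_complex_iff cbox_Pair_eq)
  note contF = this
  have "integral ?B F = integral {Re a..Re b} (\<lambda>x. integral {Im a..Im b} (\<lambda>y. f (Complex x y)))"
    using integral_prod_continuous[OF contF] by (simp add: F_def)
  then have "(F has_integral integral {Re a..Re b} (\<lambda>x. integral {Im a..Im b} (\<lambda>y. f (Complex x y)))) ?B"
    using integrable_integral[OF integrable_continuous[OF contF]] by simp
  then have "((\<lambda>z. F (T z)) has_integral integral {Re a..Re b} (\<lambda>x. integral {Im a..Im b} (\<lambda>y. f (Complex x y)))) (T -` ?B)"
    by (rule has_integral_isometry[OF T, rotated]) (auto simp: F_def cbox_Pair_eq intro!: f(2) simp: in_cbox_complex_iff)
  moreover have "T -` ?B = cbox a b" by (auto simp: T_def cbox_Pair_eq in_cbox_complex_iff)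
  ultimately show ?thesis by (simp add: F_def T_def)
qed

text \<open>The open box omits the lines Im = pi and Im = -pi, so its image is an annulus slit along
  the negative real axis. The principal logarithm gives the preimage.\<close>

lemma in_exp_image_box:
  assumes "w \<notin> \<real>\<^sub>\<le>\<^sub>0" "ln (cmod w) \<in> {a<..<b}"
  shows "w \<in> exp ` box (Complex a (-pi)) (Complex b pi)"
proof -
  have "w \<noteq> 0" using assms(1) by auto
  then have "exp (Ln w) = w" "Re (Ln w) = ln (cmod w)" by simp_all
  moreover have "\<bar>Im (Ln w)\<bar> < pi"
    using mpi_less_Im_Ln[of w] Im_Ln_le_pi[of w] Im_Ln_eq_pi[of w] assms(1) \<open>w \<noteq> 0\<close>
    by (auto simp: complex_nonpos_Reals_iff abs_less_iff less_le)
  ultimately show ?thesis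
    using assms(2) by (intro image_eqI[of _ _ "Ln w"]) (auto simp: in_box_complex_iff)
qed

lemma negligible_nonpos_Reals: "negligible (\<real>\<^sub>\<le>\<^sub>0 :: complex set)"
proof (rule negligible_subset)
  show "negligible {z. \<i> \<bullet> z = 0}" by (rule negligible_hyperplane) simp
qed (auto simp: complex_nonpos_Reals_iff inner_complex_def)

text \<open>In logarithmic coordinates the density 1/|w|^2 becomes 1, and what remains is the area
  of a rectangle of height 2 pi.\<close>

lemma has_integral_exp_box:
  assumes "a \<le> b"
  shows "((\<lambda>w. 1 / (cmod w)\<^sup>2) has_integral 2 * pi * (b - a)) (exp ` box (Complex a (-pi)) (Complex b pi))"
proof (rule has_integral_holomorphic_image)
  show "inj_on exp (box (Complex a (-pi)) (Complex b pi))"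
  proof (rule inj_onI)
    fix x y assume xy: "x \<in> box (Complex a (-pi)) (Complex b pi)" "y \<in> box (Complex a (-pi)) (Complex b pi)"
      and e: "exp x = exp y"
    show "x = y" by (rule exp_complex_eqI[OF _ e]) (use xy in \<open>auto simp: in_box_complex_iff\<close>)
  qed
  have "((\<lambda>z. 1) has_integral integral {a..b} (\<lambda>x. integral {-pi..pi} (\<lambda>y. 1::real))) (cbox (Complex a (-pi)) (Complex b pi))"
    using has_integral_complex_box[of "Complex a (-pi)" "Complex b pi" "\<lambda>_. 1"] by simp
  then show "((\<lambda>z. (cmod (deriv exp z))\<^sup>2 * (1 / (cmod (exp z))\<^sup>2)) has_integral 2 * pi * (b - a)) (box (Complex a (-pi)) (Complex b pi))"
    using assms by (simp add: has_integral_open_interval algebra_simps DERIV_imp_deriv[OF DERIV_exp])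
qed (auto intro: holomorphic_intros)

text \<open>The integrand is the squared modulus of the derivative of \<tau> + q(exp \<tau>), which
  is a logarithm of k(exp \<tau>) for k(z) = z exp(q(z)). Over a vertical segment of length 2 pi
  this function grows by 2 pi i, so its derivative has mean 1, and its squared modulus has mean at
  least 1.\<close>

lemma integral_exp_lift_ge:
  fixes q :: "complex \<Rightarrow> complex"
  assumes q: "q holomorphic_on ball 0 1" and ab: "a \<le> b" "b < 0"
  obtains I where "I \<ge> 2 * pi * (b - a)"
    "((\<lambda>\<tau>. (cmod (1 + exp \<tau> * deriv q (exp \<tau>)))\<^sup>2) has_integral I) (box (Complex a (-pi)) (Complex b pi))"
proof -
  let ?R = "cbox (Complex a (-pi)) (Complex b pi)"
  define k where "k \<tau> = 1 + exp \<tau> * deriv q (exp \<tau>)" for \<tau>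
  have exp_in: "exp \<tau> \<in> ball 0 1" if "Re \<tau> \<le> b" for \<tau>
    using that ab by simp
  have "deriv q holomorphic_on ball 0 1" using q by (intro holomorphic_deriv) auto
  then have cdq: "continuous_on (ball 0 1) (deriv q)" by (rule holomorphic_on_imp_continuous_on)
  have contk: "continuous_on {\<tau>. Re \<tau> \<le> b} k"
    unfolding k_def by (intro continuous_intros continuous_on_compose2[OF cdq]) (use exp_in in auto)
  have "?R \<subseteq> {\<tau>. Re \<tau> \<le> b}" by (auto simp: in_cbox_complex_iff)
  then have cont2: "continuous_on ?R (\<lambda>\<tau>. (cmod (k \<tau>))\<^sup>2)"
    by (intro continuous_intros continuous_on_subset[OF contk])
  have cont_line: "continuous_on {-pi..pi} (\<lambda>y. k (Complex x y))" if "x \<le> b" for x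
    using that by (intro continuous_on_compose2[OF contk] continuous_on_Complex continuous_intros) auto
  have inner: "2 * pi \<le> integral {-pi..pi} (\<lambda>y. (cmod (k (Complex x y)))\<^sup>2)" if x: "x \<le> b" for x
  proof -
    \<comment> \<open>The division by i compensates for the vertical direction of
      integration.\<close>
    define K where "K y = (Complex x y + q (exp (Complex x y))) / \<i>" for y
    have dC: "((\<lambda>y. Complex x y) has_vector_derivative \<i>) (at y within X)" for y X
      by (auto simp: has_vector_derivative_complex_iff intro!: derivative_eq_intros)
    have "(K has_vector_derivative k (Complex x y)) (at y within {-pi..pi})" for y
    proof -
      have "(q has_field_derivative deriv q (exp (Complex x y))) (at (exp (Complex x y)))"
        using exp_in[of "Complex x y"] x by (intro holomorphic_derivI[OF q]) auto
      then have "((\<lambda>z. (z + q (exp z)) / \<i>) has_field_derivative (1 + deriv q (exp (Complex x y)) * exp (Complex x y)) / \<i>) (at (Complex x y))"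
        by (auto intro!: derivative_eq_intros DERIV_chain2[of q])
      from field_vector_diff_chain_at[OF dC[of y UNIV] this]
      have "((\<lambda>z. (z + q (exp z)) / \<i>) \<circ> (\<lambda>y. Complex x y) has_vector_derivative \<i> * ((1 + deriv q (exp (Complex x y)) * exp (Complex x y)) / \<i>)) (at y)"
        by simp
      then have "(K has_vector_derivative k (Complex x y)) (at y)"
        by (simp add: K_def[abs_def] k_def o_def mult.commute add.commute)
      then show ?thesis by (rule has_vector_derivative_at_within)
    qed
    then have "((\<lambda>y. k (Complex x y)) has_integral K pi - K (-pi)) {-pi..pi}"
      by (intro fundamental_theorem_of_calculus) auto
    \<comment> \<open>By periodicity the terms with \<open>q\<close> cancel at the two
      endpoints.\<close>
    moreover have "exp (Complex x pi) = exp (Complex x (-pi))"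
      by (simp add: complex_eq_iff Re_exp Im_exp)
    then have "K pi - K (-pi) = 2 * pi"
      by (simp add: K_def diff_divide_distrib[symmetric]) (simp add: complex_eq_iff)
    ultimately have "((\<lambda>y. k (Complex x y)) has_integral of_real (2 * pi)) {-pi..pi}" by simp
    then have "((\<lambda>y. Re (k (Complex x y))) has_integral 2 * pi) {-pi..pi}"
      by (auto dest: has_integral_Re)
    from has_integral_diff[OF has_integral_mult_right[OF this, of 2] has_integral_const_real[of "1::real" "-pi" pi]]
    have lo: "((\<lambda>y. 2 * Re (k (Complex x y)) - 1) has_integral 2 * pi) {-pi..pi}" by simp
    have "(\<lambda>y. (cmod (k (Complex x y)))\<^sup>2) integrable_on {-pi..pi}"
      using cont_line[OF x] by (intro integrable_continuous_real continuous_intros)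
    then show ?thesis
    proof (rule has_integral_le[OF lo integrable_integral])
      fix y
      \<comment> \<open>Expanded, this is the tangent line bound for the square at 1, which replaces
        Jensen's inequality.\<close>
      have "0 \<le> (Re (k (Complex x y)) - 1)\<^sup>2 + (Im (k (Complex x y)))\<^sup>2" by simp
      then show "2 * Re (k (Complex x y)) - 1 \<le> (cmod (k (Complex x y)))\<^sup>2"
        unfolding cmod_power2 by (simp add: power2_diff)
    qed
  qed
  define I where "I = integral {a..b} (\<lambda>x. integral {-pi..pi} (\<lambda>y. (cmod (k (Complex x y)))\<^sup>2))"
  have I: "((\<lambda>\<tau>. (cmod (k \<tau>))\<^sup>2) has_integral I) ?R"
    using has_integral_complex_box[OF cont2] by (simp add: I_def)
  have "2 * pi * (b - a) = integral {a..b} (\<lambda>x. 2 * pi)" using ab by simp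
  also have "\<dots> \<le> I"
    unfolding I_def
  proof (rule integral_le)
    have "continuous_on (cbox (a, -pi) (b, pi)) (\<lambda>(x, y). (cmod (k (Complex x y)))\<^sup>2)"
      unfolding case_prod_unfold
      by (intro continuous_intros continuous_on_compose2[OF contk] continuous_on_Complex) (auto simp: cbox_Pair_eq)
    from integral_continuous_on_param[OF this[unfolded cbox_Pair_eq]]
    show "(\<lambda>x. integral {-pi..pi} (\<lambda>y. (cmod (k (Complex x y)))\<^sup>2)) integrable_on {a..b}"
      by (intro integrable_continuous_real) simp
  qed (use inner in auto)
  finally have "I \<ge> 2 * pi * (b - a)" .
  then show thesis using that[of I] I by (simp add: has_integral_open_interval k_def)
qed

text \<open>
  In the metric \<open>|dw|\<^sup>2/|w|\<^sup>2\<close> the images of the annulus \<open>\<rho> < |z| < r\<close> under \<open>k\<close> and \<open>1/k\<close> have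
  area at least \<open>2\<pi> ln (r/\<rho>)\<close>, by Jensen's inequality on circles. They are disjoint and,
  for small \<open>\<rho>\<close>, contained in an annulus of area about \<open>4\<pi> ln (1/(\<rho>|k'(0)|))\<close>.
\<close>

lemma bieberbach_eilenberg_injective:
  fixes k :: "complex \<Rightarrow> complex"
  assumes hol: "k holomorphic_on ball 0 1" and inj: "inj_on k (ball 0 1)" and k0: "k 0 = 0"
    and ne: "\<And>z z'. z \<in> ball 0 1 \<Longrightarrow> z' \<in> ball 0 1 \<Longrightarrow> k z * k z' \<noteq> 1"
  shows "cmod (deriv k 0) \<le> 1"
proof (rule ccontr)
  assume "\<not> cmod (deriv k 0) \<le> 1"
  then obtain c where c: "1 < c" "c < cmod (deriv k 0)" using dense by (meson linorder_not_le)
  \<comment> \<open>\<open>c\<close> bounds |k(z)/z| from below near 0. The smaller \<open>d\<close>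
    leaves room between \<rho>c and \<rho>d, and its excess over 1 gives the contradiction.\<close>
  obtain d where d: "1 < d" "d < c" using c dense by blast
  define q where "q z = (if z = 0 then deriv k 0 else (k z - k 0) / (z - 0))" for z
  have qhol: "q holomorphic_on ball 0 1"
    unfolding q_def using pole_lemma[OF hol, of 0] by simp
  have kq: "k z = z * q z" for z by (simp add: q_def k0)
  have k_nz: "k z \<noteq> 0" if "z \<in> ball 0 1" "z \<noteq> 0" for z
    using inj_onD[OF inj, of z 0] that k0 by auto
  have q_nz: "q z \<noteq> 0" if "z \<in> ball 0 1" for z
  proof (cases "z = 0")
    case True
    then show ?thesis using c by (auto simp: q_def)
  next
    case False
    then show ?thesis using k_nz[OF that] by (simp add: q_def k0)
  qed
  obtain l where l: "l holomorphic_on ball 0 1" "\<And>z. z \<in> ball 0 1 \<Longrightarrow> q z = exp (l z)"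
    using simply_connected_imp_holomorphic_log[OF qhol _ _ q_nz]
    by (metis convex_ball convex_imp_locally_path_connected convex_imp_simply_connected)
  \<comment> \<open>The midpoint of 1/d and 1, so that r d > 1.\<close>
  define r where "r = (1 + 1 / d) / 2"
  have r: "1 / d < r" "0 < r" "r < 1" using d by (auto simp: r_def field_simps add_pos_pos)
  have "isCont q 0"
    using holomorphic_on_imp_continuous_on[OF qhol] by (simp add: continuous_on_eq_continuous_at)
  then have "(q \<longlongrightarrow> q 0) (nhds 0)" using isCont_def tendsto_at_iff_tendsto_nhds by blast
  then have "((\<lambda>z. cmod (q z)) \<longlongrightarrow> cmod (q 0)) (nhds 0)" by (rule tendsto_norm)
  then have "\<forall>\<^sub>F z in nhds 0. c < cmod (q z)"
    by (rule order_tendstoD) (use c in \<open>simp add: q_def\<close>)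
  then obtain e where e: "e > 0" "\<And>z. dist z 0 < e \<Longrightarrow> c < cmod (q z)"
    unfolding eventually_nhds_metric by blast
  \<comment> \<open>Small enough for the bound by \<open>c\<close> on the circle of radius \<rho>,
    for an annulus between \<rho> and \<open>r\<close>, and for \<rho>d < 1.\<close>
  define \<rho> where "\<rho> = min (e / 2) (min (r / 2) (1 / (2 * d)))"
  have "\<rho> \<le> e / 2" "\<rho> \<le> r / 2" and \<rho>_le: "\<rho> \<le> 1 / (2 * d)"
    by (simp_all add: \<rho>_def)
  moreover have "0 < \<rho>" using e(1) r d by (simp add: \<rho>_def)
  moreover have "\<rho> * d \<le> 1 / 2"
    using mult_right_mono[OF \<rho>_le, of d] d by simp
  ultimately have \<rho>: "0 < \<rho>" "\<rho> < e" "\<rho> < r" "\<rho> * d < 1"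
    using e(1) r by auto
  have on_circle: "\<rho> * c \<le> cmod (k z)" if "cmod z = \<rho>" for z
    using e(2)[of z] that \<rho> by (simp add: kq norm_mult)
  \<comment> \<open>The image of the small disc covers the ball of radius \<rho>c. Injectivity keeps
    the image of the annulus out of this ball; since products of values are never 1, it keeps the
    reciprocals out as well.\<close>
  have ball_in: "ball 0 (\<rho> * c) \<subseteq> k ` cball 0 \<rho>"
  proof -
    have sub: "cball 0 \<rho> \<subseteq> ball (0::complex) 1" using \<rho> r by auto
    have "ball (k 0) (\<rho> * c) \<subseteq> k ` cball 0 \<rho>"
    proof (rule ball_subset_open_map_image)
      show "continuous_on (closure (cball 0 \<rho>)) k"
        using holomorphic_on_imp_continuous_on[OF hol] sub by (simp add: continuous_on_subset)
      have "ball 0 \<rho> \<subseteq> ball (0::complex) 1" using sub by auto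
      then show "open (k ` interior (cball 0 \<rho>))"
        using hol inj by (intro open_mapping_thm3) (auto intro: holomorphic_on_subset inj_on_subset)
      show "\<rho> * c \<le> cmod (k z - k 0)" if "z \<in> frontier (cball 0 \<rho>)" for z
        using on_circle[of z] that \<rho> by (simp add: k0)
    qed (use \<rho> c in auto)
    then show ?thesis by (simp add: k0)
  qed
  define A where "A = {z::complex. \<rho> < cmod z \<and> cmod z < 1}"
  have k_ge: "\<rho> * c \<le> cmod (k z)" if "z \<in> A" for z
  proof (rule ccontr)
    assume "\<not> \<rho> * c \<le> cmod (k z)"
    then have "k z \<in> k ` cball 0 \<rho>" using ball_in by auto
    then obtain z' where z': "cmod z' \<le> \<rho>" "k z = k z'" by auto
    then have "z = z'" using inj_onD[OF inj] that r \<rho> by (force simp: A_def)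
    then show False using z' that by (simp add: A_def)
  qed
  have k_le: "cmod (k z) \<le> 1 / (\<rho> * c)" if "z \<in> A" for z
  proof (rule ccontr)
    assume "\<not> cmod (k z) \<le> 1 / (\<rho> * c)"
    moreover have "0 < 1 / (\<rho> * c)" using \<rho> c by simp
    ultimately have "inverse (cmod (k z)) < inverse (1 / (\<rho> * c))"
      by (intro less_imp_inverse_less) (simp_all only: linorder_not_le)
    then have "cmod (1 / k z) < \<rho> * c" by (simp add: norm_divide inverse_eq_divide)
    then have "1 / k z \<in> k ` cball 0 \<rho>" using ball_in by auto
    then obtain z' where z': "cmod z' \<le> \<rho>" "1 / k z = k z'" by auto
    moreover have "z \<noteq> 0" "z \<in> ball 0 1" using that \<rho> by (auto simp: A_def)
    then have "k z \<noteq> 0" using k_nz by blast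
    ultimately have "k z * k z' = 1" by (simp flip: z'(2))
    then show False using ne[of z z'] z' that \<rho> r by (auto simp: A_def)
  qed
  define a where "a = ln \<rho>"
  define b where "b = ln r"
  have ab: "a \<le> b" "b < 0" using \<rho> r by (auto simp: a_def b_def)
  define R where "R = box (Complex a (-pi)) (Complex b pi)"
  have exp_A: "exp \<tau> \<in> A" "exp \<tau> \<in> ball 0 1" if "\<tau> \<in> R" for \<tau>
  proof -
    have "a < Re \<tau>" "Re \<tau> < b" using that by (auto simp: R_def in_box_complex_iff)
    then have "exp a < exp (Re \<tau>)" "exp (Re \<tau>) < exp b" by simp_all
    then have "\<rho> < exp (Re \<tau>)" "exp (Re \<tau>) < r" using \<rho> r by (simp_all add: a_def b_def)
    moreover have "Re \<tau> < 0" using \<open>Re \<tau> < b\<close> ab by simp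
    ultimately show "exp \<tau> \<in> A" "exp \<tau> \<in> ball 0 1" by (auto simp: A_def)
  qed
  have exp_inj: "inj_on exp R"
  proof (rule inj_onI)
    fix x y assume xy: "x \<in> R" "y \<in> R" and e: "exp x = exp y"
    show "x = y" by (rule exp_complex_eqI[OF _ e]) (use xy in \<open>auto simp: R_def in_box_complex_iff\<close>)
  qed
  define G where "G \<tau> = k (exp \<tau>)" for \<tau>
  have G_nz: "G \<tau> \<noteq> 0" if "\<tau> \<in> R" for \<tau>
    using k_nz[OF exp_A(2)[OF that]] by (simp add: G_def)
  have "exp ` R \<subseteq> ball 0 1" using exp_A(2) by blast
  then have G_inj: "inj_on G R"
    using comp_inj_on[OF exp_inj inj_on_subset[OF inj]] by (simp add: G_def[abs_def] o_def)
  have G_hol: "G holomorphic_on R"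
    unfolding G_def by (rule holomorphic_on_compose_gen[OF _ hol, unfolded o_def]) (use exp_A(2) in \<open>auto intro: holomorphic_intros\<close>)
  have dG: "(G has_field_derivative G \<tau> * (1 + exp \<tau> * deriv l (exp \<tau>))) (at \<tau>)" if \<tau>: "\<tau> \<in> R" for \<tau>
  proof -
    have "(l has_field_derivative deriv l (exp \<tau>)) (at (exp \<tau>))"
      using exp_A(2)[OF \<tau>] by (intro holomorphic_derivI[OF l(1)]) auto
    then have "((\<lambda>\<tau>. exp \<tau> * exp (l (exp \<tau>))) has_field_derivative exp \<tau> * exp (l (exp \<tau>)) * (1 + exp \<tau> * deriv l (exp \<tau>))) (at \<tau>)"
      by (auto intro!: derivative_eq_intros DERIV_chain2[of l] simp: algebra_simps)
    moreover have G_eq: "exp x * exp (l (exp x)) = G x" if "x \<in> R" for x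
      using exp_A(2)[OF that] l(2) kq by (simp add: G_def)
    ultimately show ?thesis
      using has_field_derivative_transform_within_open[of _ _ \<tau> R G] \<tau> G_eq[OF \<tau>] by (simp add: R_def open_box)
  qed
  have openR: "open R" by (simp add: R_def open_box)
  obtain I where I: "I \<ge> 2 * pi * (b - a)"
    "((\<lambda>\<tau>. (cmod (1 + exp \<tau> * deriv l (exp \<tau>)))\<^sup>2) has_integral I) R"
    using integral_exp_lift_ge[OF l(1) ab] unfolding R_def by blast
  let ?f = "\<lambda>w. 1 / (cmod w)\<^sup>2"
  have I1: "(?f has_integral I) (G ` R)"
  proof (rule has_integral_holomorphic_image[OF openR G_hol G_inj])
    show "((\<lambda>z. (cmod (deriv G z))\<^sup>2 * (1 / (cmod (G z))\<^sup>2)) has_integral I) R"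
      by (rule has_integral_eq[OF _ I(2)])
         (use G_nz in \<open>simp add: DERIV_imp_deriv[OF dG] norm_mult power_mult_distrib\<close>)
  qed simp
  \<comment> \<open>A function and its reciprocal have logarithmic derivatives of the same modulus,
    hence the same area integral.\<close>
  have I2: "(?f has_integral I) ((\<lambda>\<tau>. 1 / G \<tau>) ` R)"
  proof (rule has_integral_holomorphic_image[OF openR])
    show "(\<lambda>\<tau>. 1 / G \<tau>) holomorphic_on R" using G_hol G_nz by (intro holomorphic_intros) auto
    show "inj_on (\<lambda>\<tau>. 1 / G \<tau>) R" using G_inj by (auto simp: inj_on_def)
    have "deriv (\<lambda>\<tau>. 1 / G \<tau>) \<tau> = - ((1 + exp \<tau> * deriv l (exp \<tau>)) / G \<tau>)" if "\<tau> \<in> R" for \<tau>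
      using G_nz[OF that]
      by (intro DERIV_imp_deriv) (auto intro!: derivative_eq_intros dG[OF that] simp: power2_eq_square field_simps)
    then have "cmod (deriv (\<lambda>\<tau>. 1 / G \<tau>) \<tau>) = cmod (1 + exp \<tau> * deriv l (exp \<tau>)) / cmod (G \<tau>)" if "\<tau> \<in> R" for \<tau>
      using that by (simp only: norm_minus_cancel norm_divide)
    then show "((\<lambda>z. (cmod (deriv (\<lambda>\<tau>. 1 / G \<tau>) z))\<^sup>2 * (1 / (cmod (1 / G z))\<^sup>2)) has_integral I) R"
      by (intro has_integral_eq[OF _ I(2)])
         (use G_nz in \<open>simp add: norm_divide power_divide\<close>)
  qed simp
  have disj: "G ` R \<inter> (\<lambda>\<tau>. 1 / G \<tau>) ` R = {}"
  proof -
    have "G x \<noteq> 1 / G y" if "x \<in> R" "y \<in> R" for x y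
      using ne[OF exp_A(2)[OF that(1)] exp_A(2)[OF that(2)]] G_nz[OF that(2)] by (auto simp: G_def field_simps)
    then show ?thesis by auto
  qed
  \<comment> \<open>Both images lie in \<rho>d < |w| < 1/(\<rho>d), an annulus of logarithmic width
    2M and area 4 pi M.\<close>
  define M where "M = - ln (\<rho> * d)"
  have M: "M > 0" using \<rho> d by (simp add: M_def)
  define E where "E = exp ` box (Complex (-M) (-pi)) (Complex M pi)"
  have lnb: "ln (cmod (G \<tau>)) \<in> {-M<..<M}" if "\<tau> \<in> R" for \<tau>
  proof -
    have pos: "0 < \<rho> * d" "\<rho> * d < \<rho> * c" "0 < \<rho> * c" using \<rho> d c by auto
    have g: "\<rho> * c \<le> cmod (G \<tau>)" "cmod (G \<tau>) \<le> 1 / (\<rho> * c)"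
      using k_ge[OF exp_A(1)[OF that]] k_le[OF exp_A(1)[OF that]] by (simp_all add: G_def)
    have "0 < cmod (G \<tau>)" "\<rho> * d < cmod (G \<tau>)" using pos g by linarith+
    then have "-M < ln (cmod (G \<tau>))" unfolding M_def minus_minus by (subst ln_less_cancel_iff[OF pos(1)])
    moreover have "ln (cmod (G \<tau>)) \<le> ln (1 / (\<rho> * c))" using g pos G_nz[OF that] by (intro ln_mono) auto
    moreover have "ln (1 / (\<rho> * c)) = - ln (\<rho> * c)" using ln_inverse[of "\<rho> * c"] by (simp only: inverse_eq_divide)
    moreover have "ln (\<rho> * d) < ln (\<rho> * c)" using ln_less_cancel_iff[OF pos(1,3)] pos(2) by blast
    moreover note M_def
    ultimately show ?thesis unfolding greaterThanLessThan_iff by linarith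
  qed
  \<comment> \<open>The images may cross the negative real axis, which \<open>E\<close> omits; as a
    null set it can be added back.\<close>
  have "G ` R \<union> (\<lambda>\<tau>. 1 / G \<tau>) ` R \<subseteq> E \<union> \<real>\<^sub>\<le>\<^sub>0"
  proof -
    have "G \<tau> \<in> E \<union> \<real>\<^sub>\<le>\<^sub>0" "1 / G \<tau> \<in> E \<union> \<real>\<^sub>\<le>\<^sub>0" if "\<tau> \<in> R" for \<tau>
      using lnb[OF that] G_nz[OF that] in_exp_image_box[of "G \<tau>" "-M" M] in_exp_image_box[of "1 / G \<tau>" "-M" M]
      by (auto simp: E_def norm_divide ln_div)
    then show ?thesis by blast
  qed
  moreover have "(?f has_integral (I + I)) (G ` R \<union> (\<lambda>\<tau>. 1 / G \<tau>) ` R)"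
    by (rule has_integral_Un[OF I1 I2]) (simp add: disj)
  moreover have "(?f has_integral 2 * pi * (M - (-M))) (E \<union> \<real>\<^sub>\<le>\<^sub>0)"
  proof -
    have "(?f has_integral 2 * pi * (M - (-M))) E"
      unfolding E_def using M by (intro has_integral_exp_box) simp
    then show ?thesis
      by (subst has_integral_spike_set_eq[of _ E])
         (auto intro: negligible_subset[OF negligible_nonpos_Reals])
  qed
  ultimately have "I + I \<le> 2 * pi * (M - (-M))"
    by (rule has_integral_subset_le) auto
  then have "I \<le> (2 * pi) * M" by (simp add: algebra_simps)
  with I(1) have "(2 * pi) * (b - a) \<le> (2 * pi) * M" by (rule order_trans)
  then have "b - a \<le> M" by (rule mult_left_le_imp_le) simp
  \<comment> \<open>\<rho> cancels: b - a = ln r - ln \<rho>, while M = - ln \<rho> - ln d.\<close>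
  then have "ln r + ln d \<le> 0" using \<rho> d by (simp add: a_def b_def M_def ln_mult)
  then have "ln (r * d) \<le> 0" using r d by (simp add: ln_mult)
  moreover have "r * d > 1" using r d by (simp add: field_simps)
  ultimately show False using ln_gt_zero by fastforce
qed

text \<open>The inverse \<psi> of the Riemann map omits \<open>b\<close>, so 1 - \<psi>/b has a
  square root \<open>s\<close>. A square root of an injective zero-free function never takes
  opposite values, and its Cayley transform \<open>k\<close> then has no two values with product 1.
  The square root and the Cayley transform each halve the derivative at 0, hence the 4.\<close>

theorem koebe_quarter_riemann_map:
  assumes F: "open F" "simply_connected F" "0 \<in> F" "b \<notin> F"
  obtains \<phi> :: "complex \<Rightarrow> complex" where "\<phi> holomorphic_on F" "inj_on \<phi> F" "\<phi> 0 = 0"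
    "\<And>z. z \<in> F \<Longrightarrow> cmod (\<phi> z) < 1" "1 \<le> 4 * cmod b * cmod (deriv \<phi> 0)"
proof -
  have b0: "b \<noteq> 0" using F by auto
  obtain f0 g0 where fg0: "f0 holomorphic_on F" "g0 holomorphic_on ball 0 1"
     "\<And>z. z \<in> F \<Longrightarrow> f0 z \<in> ball 0 1 \<and> g0 (f0 z) = z"
     "\<And>z. z \<in> ball 0 1 \<Longrightarrow> g0 z \<in> F \<and> f0 (g0 z) = z"
    using Riemann_mapping_theorem[of F] F by blast
  define a where "a = f0 0"
  have a: "cmod a < 1" using fg0(3)[OF F(3)] by (simp add: a_def)
  \<comment> \<open>Composition with a disc automorphism moves the image of 0 to 0.\<close>
  define \<phi> where "\<phi> z = Moebius_function 0 a (f0 z)" for z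
  define \<psi> where "\<psi> z = g0 (Moebius_function 0 (-a) z)" for z
  have mo: "Moebius_function 0 u z \<in> ball 0 1" if "cmod u < 1" "z \<in> ball 0 1" for u z
    using Moebius_function_norm_lt_1[of u z 0] that by simp
  have \<phi>\<psi>: "\<phi> (\<psi> z) = z" "\<psi> z \<in> F" if "z \<in> ball 0 1" for z
    using fg0(4) mo[of "-a" z] that a Moebius_function_compose[of a "-a" z] by (auto simp: \<phi>_def \<psi>_def)
  have \<psi>\<phi>: "\<psi> (\<phi> z) = z" "\<phi> z \<in> ball 0 1" if "z \<in> F" for z
    using fg0(3)[OF that] mo[of a "f0 z"] a Moebius_function_compose[of "-a" a "f0 z"] by (auto simp: \<phi>_def \<psi>_def)
  have hol\<phi>: "\<phi> holomorphic_on F"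
    unfolding \<phi>_def by (rule holomorphic_on_compose_gen[OF fg0(1) Moebius_function_holomorphic[OF a], unfolded o_def]) (use fg0 in auto)
  have hol\<psi>: "\<psi> holomorphic_on ball 0 1"
    unfolding \<psi>_def by (rule holomorphic_on_compose_gen[OF Moebius_function_holomorphic fg0(2), unfolded o_def]) (use a mo in auto)
  have inj: "inj_on \<phi> F" by (rule inj_on_inverseI[of _ \<psi>]) (rule \<psi>\<phi>)
  have inj\<psi>: "inj_on \<psi> (ball 0 1)" by (rule inj_on_inverseI[of _ \<phi>]) (rule \<phi>\<psi>)
  have \<phi>0: "\<phi> 0 = 0" by (simp add: \<phi>_def a_def Moebius_function_eq_zero)
  have \<psi>0: "\<psi> 0 = 0" using \<psi>\<phi>[OF F(3)] \<phi>0 by simp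
  have d1: "deriv \<phi> 0 * deriv \<psi> 0 = 1"
  proof -
    have "(\<psi> has_field_derivative deriv \<psi> 0) (at 0)" by (rule holomorphic_derivI[OF hol\<psi>]) auto
    moreover have "(\<phi> has_field_derivative deriv \<phi> 0) (at (\<psi> 0))" unfolding \<psi>0 by (rule holomorphic_derivI[OF hol\<phi>]) (use F in auto)
    ultimately have "((\<lambda>z. \<phi> (\<psi> z)) has_field_derivative deriv \<phi> 0 * deriv \<psi> 0) (at 0)"
      by (rule DERIV_chain2[rotated])
    then have "((\<lambda>z. z) has_field_derivative deriv \<phi> 0 * deriv \<psi> 0) (at 0)"
      by (rule has_field_derivative_transform_within_open[of _ _ _ "ball 0 1"]) (use \<phi>\<psi> in auto)
    from DERIV_unique[OF this DERIV_ident] show ?thesis .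
  qed
  have nz: "1 - \<psi> z / b \<noteq> 0" if "z \<in> ball 0 1" for z
    using \<phi>\<psi>(2)[OF that] F(4) b0 by auto
  obtain s0 where s0: "s0 holomorphic_on ball 0 1" "\<And>z. z \<in> ball 0 1 \<Longrightarrow> 1 - \<psi> z / b = s0 z ^ 2"
  proof (rule simply_connected_imp_holomorphic_sqrt[of "\<lambda>z. 1 - \<psi> z / b" "ball 0 1"])
    show "(\<lambda>z. 1 - \<psi> z / b) holomorphic_on ball 0 1"
      using b0 by (intro holomorphic_intros hol\<psi>)
  qed (use nz in \<open>auto simp: convex_imp_locally_path_connected convex_imp_simply_connected\<close>)
  have "s0 0 ^ 2 = 1" using s0(2)[of 0] \<psi>0 by simp
  then have s00: "s0 0 * s0 0 = 1" by (simp add: power2_eq_square)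
  \<comment> \<open>\<open>s0 0\<close> is 1 or -1; the factor selects the branch with value 1 at
    0.\<close>
  define s where "s z = s0 0 * s0 z" for z
  have s: "s holomorphic_on ball 0 1" "\<And>z. z \<in> ball 0 1 \<Longrightarrow> 1 - \<psi> z / b = s z ^ 2" "s 0 = 1"
    using s0 s00 by (auto simp: s_def[abs_def] power_mult_distrib power2_eq_square intro!: holomorphic_intros)
  have s_opp: "s z \<noteq> - s z'" if "z \<in> ball 0 1" "z' \<in> ball 0 1" for z z'
  proof
    assume e: "s z = - s z'"
    then have "1 - \<psi> z / b = 1 - \<psi> z' / b" unfolding s(2)[OF that(1)] s(2)[OF that(2)] by simp
    then have "\<psi> z = \<psi> z'" using b0 by simp
    then have "z = z'" using inj_onD[OF inj\<psi>] that by simp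
    then have "s z = 0" using e by simp
    then show False using s(2)[OF that(1)] nz[OF that(1)] by simp
  qed
  have s1: "s z + 1 \<noteq> 0" if "z \<in> ball 0 1" for z
    using s_opp[OF that, of 0] s(3) by (auto simp: eq_neg_iff_add_eq_0)
  \<comment> \<open>\<open>k z * k z' = 1\<close> is equivalent to \<open>s z + s z' = 0\<close>,
    which \<open>s_opp\<close> excludes.\<close>
  define k where "k z = (s z - 1) / (s z + 1)" for z
  have "cmod (deriv k 0) \<le> 1"
  proof (rule bieberbach_eilenberg_injective)
    show "k holomorphic_on ball 0 1" unfolding k_def using s s1 by (intro holomorphic_intros) auto
    show "k 0 = 0" by (simp add: k_def s)
    show "inj_on k (ball 0 1)"
    proof (rule inj_onI)
      fix x y assume xy: "x \<in> ball 0 1" "y \<in> ball 0 1" "k x = k y"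
      then have "(s x - 1) * (s y + 1) = (s y - 1) * (s x + 1)"
        using s1 by (simp add: k_def frac_eq_eq)
      then have "s x = s y" by (simp add: algebra_simps)
      then have "1 - \<psi> x / b = 1 - \<psi> y / b" unfolding s(2)[OF xy(1)] s(2)[OF xy(2)] by simp
      then have "\<psi> x = \<psi> y" using b0 by simp
      then show "x = y" using inj_onD[OF inj\<psi>] xy by simp
    qed
    show "k z * k z' \<noteq> 1" if zz: "z \<in> ball 0 1" "z' \<in> ball 0 1" for z z'
    proof
      assume "k z * k z' = 1"
      then have "(s z - 1) * (s z' - 1) = (s z + 1) * (s z' + 1)"
        using s1 zz by (simp add: k_def divide_eq_eq)
      then have "2 * (s z + s z') = 0" by (simp add: algebra_simps)
      then have "s z = - s z'" unfolding mult_eq_0_iff by (simp add: eq_neg_iff_add_eq_0)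
      then show False using s_opp zz by blast
    qed
  qed
  moreover have "deriv k 0 = - deriv \<psi> 0 / (4 * b)"
  proof -
    have ds: "(s has_field_derivative deriv s 0) (at 0)" by (rule holomorphic_derivI[OF s(1)]) auto
    then have "((\<lambda>z. s z ^ 2) has_field_derivative 2 * deriv s 0) (at 0)"
      using s(3) by (auto intro!: derivative_eq_intros)
    then have 1: "((\<lambda>z. 1 - \<psi> z / b) has_field_derivative 2 * deriv s 0) (at 0)"
      by (rule has_field_derivative_transform_within_open[of _ _ _ "ball 0 1"]) (use s(2) in auto)
    have "(\<psi> has_field_derivative deriv \<psi> 0) (at 0)" by (rule holomorphic_derivI[OF hol\<psi>]) auto
    then have "((\<lambda>z. 1 - \<psi> z / b) has_field_derivative - (deriv \<psi> 0 / b)) (at 0)"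
      using b0 by (auto intro!: derivative_eq_intros)
    from DERIV_unique[OF 1 this] have 2: "2 * deriv s 0 = - (deriv \<psi> 0 / b)" .
    have "deriv k 0 = deriv s 0 / 2"
      unfolding k_def using ds s(3) by (intro DERIV_imp_deriv) (auto intro!: derivative_eq_intros simp: field_simps)
    then have "deriv k 0 = (2 * deriv s 0) / 4" by simp
    then have "deriv k 0 = - (deriv \<psi> 0 / b) / 4" unfolding 2 .
    then show ?thesis by (simp add: mult.commute)
  qed
  ultimately have "cmod (deriv \<psi> 0) \<le> 4 * cmod b" using b0 by (simp add: norm_divide norm_mult)
  then have "cmod (deriv \<psi> 0) * cmod (deriv \<phi> 0) \<le> 4 * cmod b * cmod (deriv \<phi> 0)"
    by (rule mult_right_mono) simp
  moreover have "cmod (deriv \<psi> 0) * cmod (deriv \<phi> 0) = 1" using d1 by (metis mult.commute norm_mult norm_one)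
  ultimately show thesis using that[OF hol\<phi> inj \<phi>0] \<psi>\<phi>(2) by simp
qed

section \<open>Continuous logarithms\<close>

lemma continuous_on_if_locally:
  fixes f :: "'a::t2_space \<Rightarrow> 'b::topological_space"
  assumes "\<And>x. x \<in> S \<Longrightarrow> \<exists>N. open N \<and> x \<in> N \<and> continuous_on (S \<inter> N) f"
  shows "continuous_on S f"
  unfolding continuous_on_eq_continuous_within
proof (rule ballI)
  fix x assume x: "x \<in> S"
  obtain N where N: "open N" "x \<in> N" "continuous_on (S \<inter> N) f" using assms[OF x] by blast
  then have "continuous (at x within (S \<inter> N)) f"
    using x by (simp add: continuous_on_eq_continuous_within)
  moreover have "at x within (S \<inter> N) = at x within S"
    by (rule at_within_nhd[OF N(2,1)]) auto
  ultimately show "continuous (at x within S) f" by simp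
qed

text \<open>The difference takes values in one coset of 2 pi i times the integers, a discrete set,
  and so is constant on a connected set. This rigidity is the means of comparing branches
  throughout.\<close>

lemma continuous_logs_diff_eq:
  fixes f g :: "'a::topological_space \<Rightarrow> complex"
  assumes K: "connected K" and f: "continuous_on K f" and g: "continuous_on K g"
    and eq: "\<And>x. x \<in> K \<Longrightarrow> exp (f x - g x) = c" and xy: "x \<in> K" "y \<in> K"
  shows "f x - g x = f y - g y"
proof -
  have "(\<lambda>x. f x - g x) constant_on K"
  proof (rule continuous_discrete_range_constant[OF K])
    show "continuous_on K (\<lambda>x. f x - g x)" using f g by (intro continuous_intros)
    fix u assume u: "u \<in> K"
    have "2 * pi \<le> norm ((f v - g v) - (f u - g u))" if v: "v \<in> K" "f v - g v \<noteq> f u - g u" for v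
    proof -
      have "exp (f v - g v) = exp (f u - g u)" using eq u v by simp
      then obtain n :: int where n: "f v - g v = f u - g u + (of_int (2 * n) * pi) * \<i>"
        unfolding exp_eq by blast
      then have "n \<noteq> 0" using v(2) by auto
      then have "1 \<le> \<bar>real_of_int n\<bar>" by linarith
      moreover have "norm ((f v - g v) - (f u - g u)) = 2 * \<bar>real_of_int n\<bar> * pi"
        unfolding n by (simp add: norm_mult)
      ultimately show ?thesis using pi_gt_zero by simp
    qed
    then show "\<exists>e>0. \<forall>v. v \<in> K \<and> f v - g v \<noteq> f u - g u \<longrightarrow> e \<le> norm (f v - g v - (f u - g u))"
      by (intro exI[of _ "2 * pi"]) auto
  qed
  then show ?thesis using xy unfolding constant_on_def by metis
qed

text \<open>Pulled back along \<open>cis\<close>, such a logarithm differs from i t by a constant,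
  yet its values at 0 and 2 pi coincide.\<close>

lemma no_continuous_log_on_circle:
  assumes f: "continuous_on (sphere 0 1) f" and exp: "\<And>z. z \<in> sphere 0 1 \<Longrightarrow> exp (f z) = (z::complex)"
  shows False
proof -
  have "f (cis 0) - \<i> * of_real 0 = f (cis (2 * pi)) - \<i> * of_real (2 * pi)"
  proof (rule continuous_logs_diff_eq[where K = "{0..2*pi}" and c = 1])
    show "continuous_on {0..2*pi} (\<lambda>t. f (cis t))"
      by (intro continuous_on_compose2[OF f] continuous_intros) auto
    show "exp (f (cis t) - \<i> * of_real t) = 1" if "t \<in> {0..2*pi}" for t
      using exp[of "cis t"] by (simp add: exp_diff cis_conv_exp)
  qed (auto intro!: continuous_intros)
  then show False by simp
qed

text \<open>Compactness of the connecting set is what allows the tube lemma to move it to nearby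
  sections.\<close>

lemma compact_connected_between:
  fixes S :: "'a::euclidean_space set"
  assumes "open S" "connected S" "x \<in> S" "y \<in> S"
  obtains K where "compact K" "connected K" "K \<subseteq> S" "x \<in> K" "y \<in> K"
proof -
  have "path_connected S" using assms connected_open_path_connected by blast
  then obtain g where "path g" "path_image g \<subseteq> S" "pathstart g = x" "pathfinish g = y"
    using assms unfolding path_connected_def by blast
  then show thesis
    using that[of "path_image g"] compact_path_image connected_path_image pathstart_in_path_image pathfinish_in_path_image by metis
qed

text \<open>Along a closed path in \<open>F\<close>, a logarithm of z - b on \<open>F\<close>
  returns to its initial value; the lift that computes the winding number about \<open>b\<close>
  differs from it by a constant and so closes up too.\<close>

lemma simply_connected_if_continuous_logs:
  fixes F :: "complex set"
  assumes F: "open F" "connected F"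
    and log: "\<And>b. b \<notin> F \<Longrightarrow> \<exists>l. continuous_on F l \<and> (\<forall>z\<in>F. exp (l z) = z - b)"
  shows "simply_connected F"
proof -
  have "winding_number \<gamma> b = 0" if \<gamma>: "path \<gamma>" "path_image \<gamma> \<subseteq> F" "pathfinish \<gamma> = pathstart \<gamma>" and b: "b \<notin> F" for \<gamma> b
  proof -
    obtain l where l: "continuous_on F l" "\<And>z. z \<in> F \<Longrightarrow> exp (l z) = z - b" using log[OF b] by blast
    have "b \<notin> path_image \<gamma>" using \<gamma> b by blast
    then obtain q where q: "path q" "pathfinish q - pathstart q = 2 * of_real pi * \<i> * winding_number \<gamma> b"
      "\<And>t. t \<in> {0..1} \<Longrightarrow> \<gamma> t = b + exp (q t)"
      using winding_number_as_continuous_log[OF \<gamma>(1)] by metis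
    have in_F: "\<gamma> t \<in> F" if "t \<in> {0..1}" for t using \<gamma>(2) that by (auto simp: path_image_def)
    have "q 0 - l (\<gamma> 0) = q 1 - l (\<gamma> 1)"
    proof (rule continuous_logs_diff_eq[where K = "{0..1}" and c = 1])
      show "continuous_on {0..1} q" using q(1) by (simp add: path_def)
      show "continuous_on {0..1} (\<lambda>t. l (\<gamma> t))"
        using \<gamma>(1) in_F by (intro continuous_on_compose2[OF l(1)]) (auto simp: path_def)
      show "exp (q t - l (\<gamma> t)) = 1" if "t \<in> {0..1}" for t
        using q(3)[OF that] l(2)[OF in_F[OF that]] by (simp add: exp_diff)
    qed auto
    then have "q 1 = q 0" using \<gamma>(3) by (simp add: pathfinish_def pathstart_def)
    then show ?thesis using q(2) by (simp add: pathfinish_def pathstart_def)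
  qed
  then show ?thesis
    using simply_connected_eq_winding_number_zero[OF F(1)] F(2) by blast
qed

text \<open>
  The families of continuous logarithms on the sections of \<open>G\<close> form a \<open>\<int>\<close>-torsor over the disc,
  whose weighted means yield a continuous \<open>c\<close> with \<open>y * c y\<close> having a single-valued
  logarithm on the unit circle.
\<close>

lemma no_connected_log_sections_over_disc:
  fixes G :: "(complex \<times> complex) set"
  defines "F \<equiv> \<lambda>x. {\<zeta>. (x, \<zeta>) \<in> G}"
  assumes G: "open G"
    and ne: "\<And>x. cmod x \<le> 1 \<Longrightarrow> F x \<noteq> {}"
    and conn: "\<And>x. cmod x \<le> 1 \<Longrightarrow> connected (F x)"
    and log: "\<And>x. cmod x \<le> 1 \<Longrightarrow> \<exists>l. continuous_on (F x) l \<and> (\<forall>\<zeta>\<in>F x. exp (l \<zeta>) = \<zeta>)"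
    and circle: "\<And>x \<zeta>. cmod x = 1 \<Longrightarrow> \<zeta> \<in> F x \<longleftrightarrow> x * \<zeta> \<in> F 1"
  shows False
proof -
  let ?D = "cball (0::complex) 1"
  have opF: "open (F x)" for x
  proof -
    have "F x = (\<lambda>\<zeta>. (x, \<zeta>)) -` G" by (auto simp: F_def)
    then show ?thesis using G by (auto intro!: open_vimage continuous_intros)
  qed
  \<comment> \<open>The branches \<open>l x\<close> and base points \<open>p x\<close> are chosen
    separately for each x, with no continuity in x.\<close>
  obtain l where l: "\<And>x. x \<in> ?D \<Longrightarrow> continuous_on (F x) (l x)" "\<And>x \<zeta>. x \<in> ?D \<Longrightarrow> \<zeta> \<in> F x \<Longrightarrow> exp (l x \<zeta>) = \<zeta>"
    using log by (simp add: Ball_def) metis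
  obtain p where p: "\<And>x. x \<in> ?D \<Longrightarrow> p x \<in> F x"
    using ne by (simp add: ex_in_conv[symmetric]) metis
  \<comment> \<open>The weight of x will be supported in distance at most r. With the margin 2r, a y
    with \<open>p x \<notin> F y\<close> has a whole neighbourhood on which this weight is
    zero.\<close>
  have "\<exists>r>0. \<forall>y. dist y x < 2 * r \<longrightarrow> p x \<in> F y" if x: "x \<in> ?D" for x
  proof -
    have "open ((\<lambda>y. (y, p x)) -` G)" using G by (intro open_vimage continuous_intros)
    moreover have "x \<in> (\<lambda>y. (y, p x)) -` G" using p[OF x] by (simp add: F_def)
    ultimately obtain e where "e > 0" "\<And>y. dist y x < e \<Longrightarrow> y \<in> (\<lambda>y. (y, p x)) -` G"
      unfolding open_dist by blast
    then show ?thesis by (intro exI[of _ "e / 2"]) (auto simp: F_def)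
  qed
  then obtain r where r: "\<And>x. x \<in> ?D \<Longrightarrow> r x > 0" "\<And>x y. x \<in> ?D \<Longrightarrow> dist y x < 2 * r x \<Longrightarrow> p x \<in> F y"
    by metis
  obtain X where X: "X \<subseteq> ?D" "finite X" "?D \<subseteq> (\<Union>x\<in>X. ball x (r x))"
  proof (rule compactE_image[OF compact_cball, of "?D" "\<lambda>x. ball x (r x)"])
    show "?D \<subseteq> (\<Union>x\<in>?D. ball x (r x))" using r(1) by force
  qed auto
  \<comment> \<open>Tent functions; normalised, they form a partition of unity on the disc.\<close>
  define \<theta> where "\<theta> x y = max 0 (r x - dist y x)" for x y
  define \<Theta> where "\<Theta> y = (\<Sum>x\<in>X. \<theta> x y)" for y
  have cont_\<theta>: "continuous_on S (\<theta> x)" for x S unfolding \<theta>_def by (intro continuous_intros)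
  have cont_\<Theta>: "continuous_on S \<Theta>" for S unfolding \<Theta>_def by (intro continuous_intros cont_\<theta>)
  have \<theta>_nn: "0 \<le> \<theta> x y" for x y by (simp add: \<theta>_def)
  have \<theta>_pos: "\<exists>x\<in>X. \<theta> x y > 0" if "y \<in> ?D" for y
    using X(3) that by (force simp: \<theta>_def dist_commute)
  have \<Theta>_pos: "\<Theta> y > 0" if "y \<in> ?D" for y
    unfolding \<Theta>_def using \<theta>_pos[OF that] \<theta>_nn X(2) sum_pos2 by metis
  define \<omega> where "\<omega> x y = complex_of_real (\<theta> x y / \<Theta> y)" for x y
  have \<omega>_sum: "(\<Sum>x\<in>X. \<omega> x y) = 1" if "y \<in> ?D" for y
    using \<Theta>_pos[OF that] by (simp add: \<omega>_def \<Theta>_def flip: of_real_sum sum_divide_distrib)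
  have cont_\<omega>: "continuous_on S (\<omega> x)" if "S \<subseteq> ?D" for x S
    unfolding \<omega>_def by (intro continuous_intros cont_\<theta> cont_\<Theta>) (use \<Theta>_pos that in force)
  have \<omega>_in: "p x \<in> F y" if "x \<in> X" "\<omega> x y \<noteq> 0" for x y
  proof -
    have "dist y x < r x" using that(2) by (auto simp: \<omega>_def \<theta>_def max_def split: if_splits)
    then show ?thesis using r X(1) that(1) by (smt (verit) subsetD)
  qed
  have vanish: "\<exists>N. open N \<and> y \<in> N \<and> (\<forall>y'\<in>N. \<omega> x y' = 0)" if x: "x \<in> X" "p x \<notin> F y" for x y
  proof (intro exI conjI ballI)
    show "open (- cball x (r x))" by (simp add: open_Compl)
    show "y \<in> - cball x (r x)"
      using r x X(1) by (smt (verit) ComplI dist_commute mem_cball subsetD)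
    show "\<omega> x y' = 0" if "y' \<in> - cball x (r x)" for y'
      using that by (simp add: \<omega>_def \<theta>_def dist_commute)
  qed
  \<comment> \<open>A connecting compact set in one section lies in all nearby ones by the tube
    lemma. Differences of branch values are therefore locally constant in y, although the branches
    themselves may jump.\<close>
  have transport: "\<exists>N. open N \<and> y \<in> N \<and> (\<forall>y' \<in> N \<inter> ?D. u \<in> F y' \<and> v \<in> F y' \<and> l y' v - l y' u = l y v - l y u)"
    if y: "y \<in> ?D" and uv: "u \<in> F y" "v \<in> F y" for y u v
  proof -
    have cy: "connected (F y)" using conn y by simp
    obtain K where K: "compact K" "connected K" "K \<subseteq> F y" "u \<in> K" "v \<in> K"
      using compact_connected_between[OF opF cy uv] .
    have "{y} \<times> K \<subseteq> G" using K(3) by (auto simp: F_def)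
    then obtain N where N: "y \<in> N" "open N" "N \<times> K \<subseteq> G"
      using Elementary_Topology.tube_lemma[OF K(1) G] by blast
    have "u \<in> F y' \<and> v \<in> F y' \<and> l y' v - l y' u = l y v - l y u" if y': "y' \<in> N \<inter> ?D" for y'
    proof -
      have KF: "K \<subseteq> F y'" using N y' by (auto simp: F_def)
      have "l y' v - l y v = l y' u - l y u"
      proof (rule continuous_logs_diff_eq[OF K(2), where c = 1])
        show "continuous_on K (l y')" using l(1) y' KF continuous_on_subset by blast
        show "continuous_on K (l y)" using l(1) y K continuous_on_subset by blast
        show "exp (l y' z - l y z) = 1" if "z \<in> K" for z
        proof -
          have "exp (l y' z) = z" "exp (l y z) = z" using l(2) y y' KF K(3) that by blast+
          moreover have "exp (l y z) \<noteq> 0" by simp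
          ultimately show ?thesis by (simp add: exp_diff)
        qed
      qed (use K in auto)
      then show ?thesis using KF K by (auto simp: algebra_simps)
    qed
    then show ?thesis using N by blast
  qed
  \<comment> \<open>The weights sum to 1, so replacing \<open>l y\<close> by another branch
    multiplies \<open>c y\<close> by exp(2 pi i n) = 1. This makes \<open>c\<close> continuous
    despite the arbitrary choices.\<close>
  define c where "c y = exp (\<Sum>x\<in>X. \<omega> x y * l y (p x))" for y
  have cont_c: "continuous_on ?D c"
  proof (rule continuous_on_if_locally)
    fix y assume y: "y \<in> ?D"
    obtain x0 where x0: "x0 \<in> X" "\<omega> x0 y \<noteq> 0"
      using \<theta>_pos[OF y] \<Theta>_pos[OF y] by (force simp: \<omega>_def)
    have px0: "p x0 \<in> F y" using \<omega>_in x0 by blast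
    \<comment> \<open>The default 0 is harmless: when \<open>p x\<close> is not in
      \<open>F y\<close>, the weight of x vanishes near y.\<close>
    define \<delta> where "\<delta> x = (if p x \<in> F y then l y (p x) - l y (p x0) else 0)" for x
    have "\<exists>N. open N \<and> y \<in> N \<and> (\<forall>y' \<in> N \<inter> ?D. p x0 \<in> F y' \<and> \<omega> x y' * (l y' (p x) - l y' (p x0)) = \<omega> x y' * \<delta> x)" if x: "x \<in> X" for x
    proof (cases "p x \<in> F y")
      case True
      then show ?thesis using transport[OF y px0 True] by (auto simp: \<delta>_def)
    next
      case False
      obtain N where N: "open N" "y \<in> N" "\<forall>y'\<in>N. \<omega> x y' = 0" using vanish[OF x False] by blast
      obtain N' where N': "open N'" "y \<in> N'" "\<forall>y'\<in>N' \<inter> ?D. p x0 \<in> F y'" using transport[OF y px0 px0] by blast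
      show ?thesis using N N' by (intro exI[of _ "N \<inter> N'"]) auto
    qed
    then obtain N where N: "\<And>x. x \<in> X \<Longrightarrow> open (N x) \<and> y \<in> N x \<and> (\<forall>y' \<in> N x \<inter> ?D. p x0 \<in> F y' \<and> \<omega> x y' * (l y' (p x) - l y' (p x0)) = \<omega> x y' * \<delta> x)"
      by metis
    define M where "M = (\<Inter>x\<in>X. N x)"
    have M: "open M" "y \<in> M" using N X(2) by (auto simp: M_def)
    have c_eq: "c y' = p x0 * exp (\<Sum>x\<in>X. \<omega> x y' * \<delta> x)" if y': "y' \<in> ?D \<inter> M" for y'
    proof -
      have 1: "p x0 \<in> F y'" using N[OF x0(1)] y' x0(1) by (auto simp: M_def)
      have "(\<Sum>x\<in>X. \<omega> x y' * l y' (p x)) = (\<Sum>x\<in>X. \<omega> x y' * l y' (p x0)) + (\<Sum>x\<in>X. \<omega> x y' * (l y' (p x) - l y' (p x0)))"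
        by (simp add: sum.distrib[symmetric] algebra_simps)
      also have "(\<Sum>x\<in>X. \<omega> x y' * l y' (p x0)) = l y' (p x0)"
        using \<omega>_sum[of y'] y' by (simp add: sum_distrib_right[symmetric])
      also have "(\<Sum>x\<in>X. \<omega> x y' * (l y' (p x) - l y' (p x0))) = (\<Sum>x\<in>X. \<omega> x y' * \<delta> x)"
        by (rule sum.cong) (use N y' in \<open>auto simp: M_def\<close>)
      finally show ?thesis using l(2)[OF _ 1] y' by (simp add: c_def exp_add)
    qed
    have "continuous_on (?D \<inter> M) (\<lambda>y'. p x0 * exp (\<Sum>x\<in>X. \<omega> x y' * \<delta> x))"
      by (intro continuous_intros cont_\<omega>) auto
    then have "continuous_on (?D \<inter> M) c"
      using c_eq continuous_on_cong by (metis (no_types, lifting))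
    then show "\<exists>N. open N \<and> y \<in> N \<and> continuous_on (?D \<inter> N) c" using M by blast
  qed
  obtain k where k: "continuous_on ?D k" "\<And>y. y \<in> ?D \<Longrightarrow> c y = exp (k y)"
    using continuous_logarithm_on_cball[OF cont_c] by (auto simp: c_def)
  \<comment> \<open>All terms use the single branch over 1: for y on the unit circle,
    \<open>circle\<close> places y * p x in the section over 1 whenever the weight is nonzero. Hence
    \<open>H\<close> is continuous.\<close>
  define H where "H y = (\<Sum>x\<in>X. \<omega> x y * l 1 (y * p x))" for y
  have cont_H: "continuous_on (sphere 0 1) H"
    unfolding H_def
  proof (rule continuous_on_sum, rule continuous_on_if_locally)
    fix x y assume x: "x \<in> X" and y: "y \<in> sphere (0::complex) 1"
    show "\<exists>N. open N \<and> y \<in> N \<and> continuous_on (sphere 0 1 \<inter> N) (\<lambda>y. \<omega> x y * l 1 (y * p x))"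
    proof (cases "p x \<in> F y")
      case True
      define N where "N = (\<lambda>y. y * p x) -` F 1"
      have "open N" unfolding N_def by (intro open_vimage opF continuous_intros)
      moreover have "y \<in> N" using True circle[of y "p x"] y by (simp add: N_def)
      moreover have "continuous_on (sphere 0 1 \<inter> N) (\<lambda>y. \<omega> x y * l 1 (y * p x))"
        by (intro continuous_intros cont_\<omega> continuous_on_compose2[OF l(1)]) (auto simp: N_def)
      ultimately show ?thesis by blast
    next
      case False
      obtain N where N: "open N" "y \<in> N" "\<forall>y'\<in>N. \<omega> x y' = 0" using vanish[OF x False] by blast
      then have "continuous_on (sphere 0 1 \<inter> N) (\<lambda>y. \<omega> x y * l 1 (y * p x)) \<longleftrightarrow> continuous_on (sphere 0 1 \<inter> N) (\<lambda>_. 0 :: complex)"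
        by (intro continuous_on_cong) auto
      then show ?thesis using N by auto
    qed
  qed
  have exp_H: "exp (H y) = y * c y" if y: "y \<in> sphere 0 1" for y
  proof -
    have yD: "y \<in> ?D" and ny: "cmod y = 1" using y by auto
    obtain x0 where x0: "x0 \<in> X" "\<omega> x0 y \<noteq> 0"
      using \<theta>_pos[OF yD] \<Theta>_pos[OF yD] by (force simp: \<omega>_def)
    have px0: "p x0 \<in> F y" using \<omega>_in x0 by blast
    \<comment> \<open>Rotation by y carries the section over y to the one over 1, so the two
      branches differ by a constant with exponential y. The average inherits this constant because
      the weights sum to 1.\<close>
    define \<kappa> where "\<kappa> = l 1 (y * p x0) - l y (p x0)"
    have exp_l: "exp (l 1 (y * \<zeta>) - l y \<zeta>) = y" if z: "\<zeta> \<in> F y" for \<zeta>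
    proof -
      have "exp (l 1 (y * \<zeta>)) = y * \<zeta>" "exp (l y \<zeta>) = \<zeta>" using l(2) z circle[OF ny] yD by auto
      moreover have "exp (l y \<zeta>) \<noteq> 0" by simp
      ultimately show ?thesis by (simp add: exp_diff)
    qed
    have kap: "l 1 (y * \<zeta>) - l y \<zeta> = \<kappa>" if z: "\<zeta> \<in> F y" for \<zeta>
      unfolding \<kappa>_def
    proof (rule continuous_logs_diff_eq[where K = "F y" and c = y])
      show "connected (F y)" using conn ny by simp
      show "continuous_on (F y) (\<lambda>\<zeta>. l 1 (y * \<zeta>))"
        by (intro continuous_on_compose2[OF l(1)] continuous_intros) (use circle[OF ny] in auto)
    qed (use exp_l px0 z l(1)[OF yD] in auto)
    have "H y = (\<Sum>x\<in>X. \<omega> x y * l y (p x) + \<omega> x y * \<kappa>)"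
      unfolding H_def
    proof (rule sum.cong)
      fix x assume x: "x \<in> X"
      show "\<omega> x y * l 1 (y * p x) = \<omega> x y * l y (p x) + \<omega> x y * \<kappa>"
        using kap[of "p x"] \<omega>_in[OF x] by (cases "\<omega> x y = 0") (auto simp: algebra_simps)
    qed simp
    also have "\<dots> = (\<Sum>x\<in>X. \<omega> x y * l y (p x)) + \<kappa>"
      using \<omega>_sum[OF yD] by (simp add: sum.distrib sum_distrib_right[symmetric])
    finally show ?thesis using exp_l[OF px0] by (simp add: c_def exp_add \<kappa>_def mult.commute)
  qed
  have kS: "continuous_on (sphere 0 1) k" by (rule continuous_on_subset[OF k(1)]) auto
  show False
  proof (rule no_continuous_log_on_circle)
    \<comment> \<open>\<open>exp (H y)\<close> is y * c y, and \<open>k\<close> is a logarithm of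
      \<open>c\<close> on the whole disc, so the difference is a logarithm of y itself.\<close>
    show "continuous_on (sphere 0 1) (\<lambda>y. H y - k y)" using cont_H kS by (intro continuous_intros)
    show "exp (H y - k y) = y" if "y \<in> sphere 0 1" for y
    proof -
      have "c y = exp (k y)" using k(2) that by simp
      then show ?thesis using exp_H[OF that] by (simp add: exp_diff)
    qed
  qed
qed

section \<open>Projections and supporting hyperplanes of \<open>\<complex>\<close>-convex domains\<close>

lemma continuous_on_vector_scale:
  fixes g :: "'a::topological_space \<Rightarrow> complex ^ 'n"
  assumes "continuous_on S f" "continuous_on S g"
  shows "continuous_on S (\<lambda>x. f x *s g x)"
  unfolding vector_scalar_mult_def using assms by (intro continuous_intros)

lemma C_convex_line_section:
  fixes \<Omega> :: "(complex ^ 'n) set" and x u :: "complex ^ 'n"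
  assumes C: "C_convex \<Omega>" and op: "open \<Omega>" and xy: "x \<in> \<Omega>"
  defines "S \<equiv> {s. x + s *s u \<in> \<Omega>}"
  shows "open S" "connected S" "simply_connected S"
proof -
  have cont: "continuous_on X (\<lambda>s::complex. x + s *s u)" for X
    by (intro continuous_intros continuous_on_vector_scale)
  have "S = (\<lambda>s. x + s *s u) -` \<Omega>" by (auto simp: S_def)
  then show opS: "open S" using open_vimage[OF op cont] by simp
  show "connected S" "simply_connected S"
  proof -
    have "connected S \<and> simply_connected S"
    proof (cases "u = 0")
      case True
      then have "S = UNIV" using xy by (auto simp: S_def)
      then show ?thesis by (simp add: convex_imp_simply_connected convex_connected)
    next
      case False
      then obtain i where i: "u $ i \<noteq> 0" by (auto simp: vec_eq_iff)
      let ?T = "\<Omega> \<inter> complex_line x u"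
      have "homeomorphism S ?T (\<lambda>s. x + s *s u) (\<lambda>z. (z $ i - x $ i) / u $ i)"
        unfolding homeomorphism_def
      proof (intro conjI)
        show "continuous_on ?T (\<lambda>z. (z $ i - x $ i) / u $ i)" using i by (intro continuous_intros) auto
        show "(\<lambda>z. (z $ i - x $ i) / u $ i) ` ?T = S"
        proof
          show "(\<lambda>z. (z $ i - x $ i) / u $ i) ` ?T \<subseteq> S"
            using i by (auto simp: complex_line_def S_def)
          show "S \<subseteq> (\<lambda>z. (z $ i - x $ i) / u $ i) ` ?T"
          proof
            fix s assume "s \<in> S"
            then show "s \<in> (\<lambda>z. (z $ i - x $ i) / u $ i) ` ?T"
              using i by (intro image_eqI[of _ _ "x + s *s u"]) (auto simp: complex_line_def S_def)
          qed
        qed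
      qed (use i cont in \<open>auto simp: complex_line_def S_def\<close>)
      then have hom: "S homeomorphic ?T" unfolding homeomorphic_def by blast
      have "x \<in> ?T" using xy by (auto simp: complex_line_def intro: range_eqI[of _ _ 0])
      then have "connected ?T" "simply_connected ?T"
        using C False unfolding C_convex_def by blast+
      then show ?thesis using hom homeomorphic_connectedness homeomorphic_simply_connected_eq by blast
    qed
    then show "connected S" "simply_connected S" by auto
  qed
qed

text \<open>
  The branch at \<open>z\<close> is reached from \<open>z0\<close> inside the complex line through both points, on which
  \<open>\<Omega>\<close> is simply connected.
\<close>

lemma C_convex_affine_log:
  fixes \<Omega> A :: "(complex ^ 'n) set" and l :: "complex ^ 'n \<Rightarrow> complex"
  assumes C: "C_convex \<Omega>" and op: "open \<Omega>"
    and A: "\<And>x y s. x \<in> A \<Longrightarrow> y \<in> A \<Longrightarrow> x + s *s (y - x) \<in> A"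
    and l: "continuous_on UNIV l" "\<And>x y s. l (x + s *s (y - x)) = l x + s * (l y - l x)"
    and nz: "\<And>z. z \<in> \<Omega> \<inter> A \<Longrightarrow> l z \<noteq> 0"
  shows "\<exists>h. continuous_on (\<Omega> \<inter> A) h \<and> (\<forall>z \<in> \<Omega> \<inter> A. exp (h z) = l z)"
proof (cases "\<Omega> \<inter> A = {}")
  case True
  then show ?thesis by auto
next
  case False
  then obtain z0 where z0: "z0 \<in> \<Omega>" "z0 \<in> A" by blast
  define S where "S z = {s. z0 + s *s (z - z0) \<in> \<Omega>}" for z
  define p where "p z s = l z0 + s * (l z - l z0)" for z s
  have S: "open (S z)" "connected (S z)" "simply_connected (S z)" for z
    unfolding S_def by (rule C_convex_line_section[OF C op z0(1)])+
  have p_nz: "p z s \<noteq> 0" if "z \<in> A" "s \<in> S z" for z s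
    using nz[of "z0 + s *s (z - z0)"] l(2) A[OF z0(2) that(1)] that(2) by (simp add: p_def S_def)
  have "\<exists>g. continuous_on (S z) g \<and> (\<forall>s \<in> S z. p z s = exp (g s))" if "z \<in> A" for z
  proof -
    have "continuous_on (S z) (p z)" unfolding p_def by (intro continuous_intros)
    from continuous_logarithm_on_simply_connected[OF this S(3) open_imp_locally_path_connected[OF S(1)] p_nz[OF that]]
    show ?thesis by metis
  qed
  then obtain g where g: "\<And>z. z \<in> A \<Longrightarrow> continuous_on (S z) (g z)" "\<And>z s. z \<in> A \<Longrightarrow> s \<in> S z \<Longrightarrow> p z s = exp (g z s)"
    by metis
  have S01: "0 \<in> S z" "1 \<in> S z" if "z \<in> \<Omega>" for z using that z0 by (auto simp: S_def)
  have p01: "p z 0 = l z0" "p z 1 = l z" for z by (auto simp: p_def)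
  have l0: "l z0 \<noteq> 0" using nz z0 by blast
  \<comment> \<open>The difference of \<open>g z\<close> between 0 and 1 does not depend on the
    chosen branch, which is why \<open>h\<close> can be continuous although \<open>g\<close> is
    chosen separately for each z.\<close>
  define h where "h z = Ln (l z0) + (g z 1 - g z 0)" for z
  have "exp (h z) = l z" if z: "z \<in> \<Omega> \<inter> A" for z
  proof -
    have "exp (g z 0) = l z0" "exp (g z 1) = l z"
      using g(2)[of z 0] g(2)[of z 1] S01[of z] z by (simp_all add: p01)
    then show ?thesis using l0 by (simp add: h_def exp_add exp_diff)
  qed
  moreover have "continuous_on (\<Omega> \<inter> A) h"
  proof (rule continuous_on_if_locally)
    fix z1 assume z1: "z1 \<in> \<Omega> \<inter> A"
    obtain K where K: "compact K" "connected K" "K \<subseteq> S z1" "0 \<in> K" "1 \<in> K"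
      using compact_connected_between[OF S(1,2)] S01[of z1] z1 by blast
    \<comment> \<open>The inequality keeps the quotient of the two values of \<open>p\<close> off
      the nonpositive reals, where the principal logarithm is continuous.\<close>
    define W where "W = {q. z0 + snd q *s (fst q - z0) \<in> \<Omega> \<and> cmod (p (fst q) (snd q) - p z1 (snd q)) < cmod (p z1 (snd q))}"
    have "open W"
      unfolding W_def
    proof (rule open_Collect_conj)
      have "open ((\<lambda>q::(complex ^ 'n) \<times> complex. z0 + snd q *s (fst q - z0)) -` \<Omega>)"
        by (intro open_vimage op continuous_intros continuous_on_vector_scale)
      then show "open {q. z0 + snd q *s (fst q - z0) \<in> \<Omega>}" by (simp add: vimage_def)
      show "open {q. cmod (p (fst q) (snd q) - p z1 (snd q)) < cmod (p z1 (snd q))}"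
        unfolding p_def
        by (intro open_Collect_less continuous_intros continuous_on_compose2[OF l(1)]) auto
    qed
    moreover have "{z1} \<times> K \<subseteq> W"
      using K(3) p_nz[of z1] z1 by (auto simp: W_def S_def)
    ultimately obtain N where N: "z1 \<in> N" "open N" "N \<times> K \<subseteq> W"
      using Elementary_Topology.tube_lemma[OF K(1), of W z1] by blast
    have quot: "u / v \<notin> \<real>\<^sub>\<le>\<^sub>0" if "cmod (u - v) < cmod v" for u v :: complex
    proof
      assume "u / v \<in> \<real>\<^sub>\<le>\<^sub>0"
      then have "Re (u / v) \<le> 0" by (simp add: complex_nonpos_Reals_iff)
      moreover have "v \<noteq> 0" using that by auto
      then have "cmod (u / v - 1) < 1" using that by (simp add: norm_divide diff_divide_distrib[symmetric] divide_simps)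
      then have "\<bar>Re (u / v - 1)\<bar> < 1" using abs_Re_le_cmod le_less_trans by blast
      ultimately show False by simp
    qed
    have NK: "s \<in> S z" "cmod (p z s - p z1 s) < cmod (p z1 s)" if "z \<in> N" "s \<in> K" for z s
      using N(3) that by (auto simp: W_def S_def)
    have h_eq: "h z = h z1 + Ln (l z / l z1)" if z: "z \<in> \<Omega> \<inter> A \<inter> N" for z
    proof -
      have KS: "K \<subseteq> S z" using NK z by blast
      \<comment> \<open>Both sides are values of one constant function on \<open>K\<close>. The
        quotient at 0 is 1, so the change of \<open>h\<close> from \<open>z1\<close> to
        \<open>z\<close> is a principal logarithm.\<close>
      have "(g z 0 - g z1 0) - Ln (p z 0 / p z1 0) = (g z 1 - g z1 1) - Ln (p z 1 / p z1 1)"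
      proof (rule continuous_logs_diff_eq[OF K(2), where c = 1])
        show "continuous_on K (\<lambda>s. g z s - g z1 s)"
          using z z1 KS K(3) by (intro continuous_intros continuous_on_subset[OF g(1)]) auto
        show "continuous_on K (\<lambda>s. Ln (p z s / p z1 s))"
        proof (intro continuous_on_Ln' continuous_on_divide)
          show "continuous_on K (p z)" "continuous_on K (p z1)" unfolding p_def by (intro continuous_intros)+
          show "\<forall>s\<in>K. p z1 s \<noteq> 0" using p_nz z1 K(3) by blast
          show "p z s / p z1 s \<notin> \<real>\<^sub>\<le>\<^sub>0" if "s \<in> K" for s using quot NK(2) z that by blast
        qed
        show "exp (g z s - g z1 s - Ln (p z s / p z1 s)) = 1" if s: "s \<in> K" for s
        proof -
          have "p z s \<noteq> 0" "p z1 s \<noteq> 0" using p_nz z z1 K(3) KS s by blast+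
          moreover have "exp (g z s) = p z s" "exp (g z1 s) = p z1 s"
            using g(2) z z1 K(3) KS s by (metis IntD1 IntD2 subsetD)+
          ultimately show ?thesis by (simp add: exp_diff)
        qed
      qed (use K in auto)
      then show ?thesis using l0 by (simp add: h_def p01 algebra_simps)
    qed
    have "continuous_on (\<Omega> \<inter> A \<inter> N) (\<lambda>z. h z1 + Ln (l z / l z1))"
    proof (intro continuous_intros continuous_on_subset[OF l(1)])
      show "l z / l z1 \<notin> \<real>\<^sub>\<le>\<^sub>0" if "z \<in> \<Omega> \<inter> A \<inter> N" for z
        using quot NK(2)[of z 1] that K(5) by (simp add: p01)
    qed (use nz z1 in auto)
    then have "continuous_on (\<Omega> \<inter> A \<inter> N) h"
      using h_eq continuous_on_cong by (metis (no_types, lifting))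
    then show "\<exists>N. open N \<and> z1 \<in> N \<and> continuous_on (\<Omega> \<inter> A \<inter> N) h" using N by blast
  qed
  ultimately show ?thesis by blast
qed

text \<open>A logarithm on the domain is constant on the fibres of \<open>L\<close>, because the
  line through two points of a fibre meets the domain in a connected set on which L(z) - b does not
  change. It thus descends to the image, where translation along \<open>v\<close> supplies local
  continuous sections. The affine set \<open>A\<close> lets this serve both the whole domain and its
  slices.\<close>

lemma C_convex_image_logs:
  fixes \<Omega> A :: "(complex ^ 'n) set" and L :: "complex ^ 'n \<Rightarrow> complex"
  assumes C: "C_convex \<Omega>" and op: "open \<Omega>"
    and A: "\<And>x y s. x \<in> A \<Longrightarrow> y \<in> A \<Longrightarrow> x + s *s (y - x) \<in> A"
    and L: "bounded_linear L" "\<And>c x. L (c *s x) = c * L x"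
    and v: "L v = 1" "\<And>x s. x \<in> A \<Longrightarrow> x + s *s v \<in> A"
  shows "open (L ` (\<Omega> \<inter> A))" "connected (L ` (\<Omega> \<inter> A))"
    "b \<notin> L ` (\<Omega> \<inter> A) \<Longrightarrow> \<exists>l. continuous_on (L ` (\<Omega> \<inter> A)) l \<and> (\<forall>\<zeta> \<in> L ` (\<Omega> \<inter> A). exp (l \<zeta>) = \<zeta> - b)"
proof -
  note Lin = bounded_linear.linear[OF L(1)]
  have L_line: "L (x + s *s u) = L x + s * L u" for x s u by (simp add: linear_add[OF Lin] L(2))
  have L_diff: "L (x - y) = L x - L y" for x y by (rule linear_diff[OF Lin])
  have near: "open {\<zeta>. x + (\<zeta> - L x) *s v \<in> \<Omega>}" for x
  proof -
    have "open ((\<lambda>\<zeta>::complex. x + (\<zeta> - L x) *s v) -` \<Omega>)"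
      by (intro open_vimage op continuous_intros continuous_on_vector_scale)
    then show ?thesis by (simp add: vimage_def)
  qed
  have L_near: "L (x + (\<zeta> - L x) *s v) = \<zeta>" for x \<zeta> unfolding L_line v(1) by simp
  show "open (L ` (\<Omega> \<inter> A))"
    unfolding open_subopen[of "L ` (\<Omega> \<inter> A)"]
  proof (rule ballI)
    fix y assume "y \<in> L ` (\<Omega> \<inter> A)"
    then obtain x where x: "x \<in> \<Omega>" "x \<in> A" "y = L x" by blast
    have "{\<zeta>. x + (\<zeta> - L x) *s v \<in> \<Omega>} \<subseteq> L ` (\<Omega> \<inter> A)"
    proof
      fix \<zeta> assume "\<zeta> \<in> {\<zeta>. x + (\<zeta> - L x) *s v \<in> \<Omega>}"
      then have "x + (\<zeta> - L x) *s v \<in> \<Omega> \<inter> A" using v(2)[OF x(2)] by blast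
      then show "\<zeta> \<in> L ` (\<Omega> \<inter> A)" using L_near[of x \<zeta>] by (metis imageI)
    qed
    then show "\<exists>T. open T \<and> y \<in> T \<and> T \<subseteq> L ` (\<Omega> \<inter> A)"
      using near[of x] x by (intro exI[of _ "{\<zeta>. x + (\<zeta> - L x) *s v \<in> \<Omega>}"]) auto
  qed
  have cont_line: "continuous_on X (\<lambda>s::complex. x + s *s u)" for X and x u :: "complex ^ 'n"
    by (intro continuous_intros continuous_on_vector_scale)
  note S = C_convex_line_section[OF C op]
  have in_A: "x + s *s (y - x) \<in> \<Omega> \<inter> A" if "x \<in> \<Omega> \<inter> A" "y \<in> \<Omega> \<inter> A" "s \<in> {s. x + s *s (y - x) \<in> \<Omega>}" for x y s
    using that A by auto
  show "connected (L ` (\<Omega> \<inter> A))"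
  proof (rule connected_linear_image[OF Lin])
    have "connected_component (\<Omega> \<inter> A) x y" if xy: "x \<in> \<Omega> \<inter> A" "y \<in> \<Omega> \<inter> A" for x y
      unfolding connected_component_def
    proof (intro exI conjI)
      let ?S = "{s. x + s *s (y - x) \<in> \<Omega>}"
      show "connected ((\<lambda>s. x + s *s (y - x)) ` ?S)"
        by (rule connected_continuous_image[OF cont_line S(2)]) (use xy in auto)
      show "(\<lambda>s. x + s *s (y - x)) ` ?S \<subseteq> \<Omega> \<inter> A" using in_A xy by blast
      show "x \<in> (\<lambda>s. x + s *s (y - x)) ` ?S" using xy by (intro image_eqI[of _ _ 0]) auto
      show "y \<in> (\<lambda>s. x + s *s (y - x)) ` ?S" using xy by (intro image_eqI[of _ _ 1]) auto
    qed
    then show "connected (\<Omega> \<inter> A)" by (auto simp: connected_iff_connected_component)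
  qed
  assume b: "b \<notin> L ` (\<Omega> \<inter> A)"
  have "\<exists>h. continuous_on (\<Omega> \<inter> A) h \<and> (\<forall>z \<in> \<Omega> \<inter> A. exp (h z) = L z - b)"
  proof (rule C_convex_affine_log[OF C op A])
    show "continuous_on UNIV (\<lambda>z. L z - b)"
      by (intro continuous_intros linear_continuous_on L(1))
    show "L (x + s *s (y - x)) - b = L x - b + s * (L y - b - (L x - b))" for x y s
      unfolding L_line L_diff by simp
  qed (use b in auto)
  then obtain h where h: "continuous_on (\<Omega> \<inter> A) h" "\<And>z. z \<in> \<Omega> \<inter> A \<Longrightarrow> exp (h z) = L z - b" by blast
  have fibre: "h x = h y" if xy: "x \<in> \<Omega> \<inter> A" "y \<in> \<Omega> \<inter> A" and eq: "L x = L y" for x y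
  proof -
    let ?S = "{s. x + s *s (y - x) \<in> \<Omega>}"
    have "h (x + 0 *s (y - x)) - 0 = h (x + 1 *s (y - x)) - 0"
    proof (rule continuous_logs_diff_eq[where K = ?S and c = "L x - b" and f = "\<lambda>s. h (x + s *s (y - x))" and g = "\<lambda>_. 0" and x = 0 and y = 1])
      show "connected ?S" by (rule S(2)) (use xy in auto)
      show "continuous_on ?S (\<lambda>s. h (x + s *s (y - x)))"
        by (rule continuous_on_compose2[OF h(1) cont_line]) (use in_A xy in blast)
      show "exp (h (x + s *s (y - x)) - 0) = L x - b" if "s \<in> ?S" for s
        using h(2)[OF in_A[OF xy that]] eq unfolding L_line L_diff by simp
    qed (use xy in auto)
    then show ?thesis by simp
  qed
  \<comment> \<open>An arbitrary section is enough: by \<open>fibre\<close> it may be replaced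
    locally by the affine one along \<open>v\<close>.\<close>
  define sec where "sec \<zeta> = (SOME x. x \<in> \<Omega> \<inter> A \<and> L x = \<zeta>)" for \<zeta>
  have sec: "sec \<zeta> \<in> \<Omega> \<inter> A \<and> L (sec \<zeta>) = \<zeta>" if "\<zeta> \<in> L ` (\<Omega> \<inter> A)" for \<zeta>
    unfolding sec_def by (rule someI_ex) (use that in blast)
  have "continuous_on (L ` (\<Omega> \<inter> A)) (\<lambda>\<zeta>. h (sec \<zeta>))"
  proof (rule continuous_on_if_locally)
    fix \<zeta>0 assume z: "\<zeta>0 \<in> L ` (\<Omega> \<inter> A)"
    define x where "x = sec \<zeta>0"
    have x: "x \<in> \<Omega>" "x \<in> A" "L x = \<zeta>0" using sec[OF z] by (auto simp: x_def)
    let ?N = "{\<zeta>. x + (\<zeta> - L x) *s v \<in> \<Omega>}"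
    have inN: "x + (\<zeta> - L x) *s v \<in> \<Omega> \<inter> A" if "\<zeta> \<in> ?N" for \<zeta> using that v(2)[OF x(2)] by blast
    have "continuous_on (L ` (\<Omega> \<inter> A) \<inter> ?N) (\<lambda>\<zeta>. h (x + (\<zeta> - L x) *s v))"
      by (intro continuous_on_compose2[OF h(1)] continuous_intros continuous_on_vector_scale) (use inN in blast)
    moreover have "h (sec \<zeta>) = h (x + (\<zeta> - L x) *s v)" if "\<zeta> \<in> L ` (\<Omega> \<inter> A) \<inter> ?N" for \<zeta>
    proof (rule fibre)
      show "sec \<zeta> \<in> \<Omega> \<inter> A" "L (sec \<zeta>) = L (x + (\<zeta> - L x) *s v)" unfolding L_near using sec that by auto
      show "x + (\<zeta> - L x) *s v \<in> \<Omega> \<inter> A" using inN that by blast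
    qed
    ultimately have "continuous_on (L ` (\<Omega> \<inter> A) \<inter> ?N) (\<lambda>\<zeta>. h (sec \<zeta>))"
      using continuous_on_cong by (metis (no_types, lifting))
    then show "\<exists>N. open N \<and> \<zeta>0 \<in> N \<and> continuous_on (L ` (\<Omega> \<inter> A) \<inter> N) (\<lambda>\<zeta>. h (sec \<zeta>))"
      using near[of x] x by (intro exI[of _ ?N]) auto
  qed
  moreover have "exp (h (sec \<zeta>)) = \<zeta> - b" if "\<zeta> \<in> L ` (\<Omega> \<inter> A)" for \<zeta>
    using h(2) sec[OF that] by force
  ultimately show "\<exists>l. continuous_on (L ` (\<Omega> \<inter> A)) l \<and> (\<forall>\<zeta> \<in> L ` (\<Omega> \<inter> A). exp (l \<zeta>) = \<zeta> - b)"
    by blast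
qed

text \<open>The linear map \<open>g\<close> kills a basis of \<open>M\<close> and fixes
  \<open>v\<close>; a nonzero coordinate of \<open>v\<close> turns it into a scalar
  functional.\<close>

lemma complex_functional_separating_subspace:
  fixes M :: "(complex ^ 'n) set"
  assumes M: "vec.subspace M" and v: "v \<notin> M"
  obtains L :: "complex ^ 'n \<Rightarrow> complex" where
    "bounded_linear L" "\<And>c x. L (c *s x) = c * L x" "\<And>m. m \<in> M \<Longrightarrow> L m = 0" "L v = 1"
proof -
  obtain B where B: "B \<subseteq> M" "vec.independent B" "M \<subseteq> vec.span B"
    using vec.maximal_independent_subset[of M] by metis
  have spanB: "vec.span B = M" using B M vec.span_minimal by blast
  then have "vec.independent (insert v B)" using B v by (intro vec.independent_insertI) auto
  then obtain g where g: "Vector_Spaces.linear (*s) (*s) g" "\<And>x. x \<in> insert v B \<Longrightarrow> g x = (if x = v then v else 0)"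
    using vec.linear_independent_extend[of "insert v B" "\<lambda>x. if x = v then v else 0"] by blast
  have "v \<noteq> 0" using v vec.subspace_0[OF M] by auto
  then obtain i where i: "v $ i \<noteq> 0" by (auto simp: vec_eq_iff)
  define L where "L x = g x $ i / v $ i" for x
  have g_add: "g (x + y) = g x + g y" and g_scale: "g (c *s x) = c *s g x" for x y c
    using vec.linear_add[OF g(1)] vec.linear_scale[OF g(1)] by auto
  have hom: "L (c *s x) = c * L x" for c x by (simp add: L_def g_scale)
  have "linear L"
  proof (rule linearI)
    show "L (x + y) = L x + L y" for x y by (simp add: L_def g_add add_divide_distrib)
    have "r *\<^sub>R x = complex_of_real r *s x" for r and x :: "complex ^ 'n" by (simp add: vec_eq_iff scaleR_conv_of_real[where 'a = complex])
    then show "L (r *\<^sub>R x) = r *\<^sub>R L x" for r x by (simp add: hom scaleR_conv_of_real)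
  qed
  then have bl: "bounded_linear L" by (simp add: linear_conv_bounded_linear)
  have "L m = 0" if "m \<in> M" for m
  proof -
    have "m \<in> vec.span B" using that spanB by simp
    then have "g m = 0"
    proof (induction rule: vec.span_induct_alt)
      case base
      then show ?case using g_scale[of 0 0] by simp
    next
      case (step c x y)
      have "x \<noteq> v" using step v B by auto
      then show ?case using g(2)[of x] step by (simp add: g_add g_scale)
    qed
    then show ?thesis by (simp add: L_def)
  qed
  moreover have "L v = 1" using g(2)[of v] i by (simp add: L_def)
  ultimately show thesis using that bl hom by blast
qed

text \<open>
  Take a maximal complex subspace \<open>M\<close> with \<open>a + M\<close> outside \<open>\<Omega>\<close>. If it had codimension at least
  two, the sections of \<open>\<Omega>\<close> by \<open>a + M + \<complex>v\<close>, with \<open>v\<close> in a hemisphere of a complementary sphere,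
  would contradict \<open>no_connected_log_sections_over_disc\<close>.
\<close>

lemma C_convex_complex_hyperplane:
  fixes \<Omega> :: "(complex ^ 'n) set"
  assumes C: "C_convex \<Omega>" and op: "open \<Omega>" and a: "a \<notin> \<Omega>"
  obtains L :: "complex ^ 'n \<Rightarrow> complex" where
    "bounded_linear L" "\<And>c x. L (c *s x) = c * L x" "\<And>z. z \<in> \<Omega> \<Longrightarrow> L (z - a) \<noteq> 0"
proof (rule ccontr)
  note witness = that
  assume no: "\<not> thesis"
  have ex: "\<exists>z\<in>\<Omega>. L (z - a) = 0" if "bounded_linear L" "\<And>c x. L (c *s x) = c * L x" for L :: "complex ^ 'n \<Rightarrow> complex"
    using no witness[OF that] by blast
  let ?P = "\<lambda>M. vec.subspace M \<and> (\<forall>m\<in>M. a + m \<notin> \<Omega>)"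
  have P0: "?P {0}" using a by simp
  obtain N where N: "\<And>S :: (complex ^ 'n) set. vec.dim S \<le> N"
    using vec.dim_subset_UNIV by metis
  then have bound: "\<forall>M. ?P M \<longrightarrow> vec.dim M < Suc N" by (simp add: less_Suc_eq_le)
  obtain M where "?P M \<and> (\<forall>M'. ?P M' \<longrightarrow> vec.dim M' \<le> vec.dim M)"
    using ex_has_greatest_nat[of ?P, OF P0 bound] by blast
  then have M: "vec.subspace M" "\<And>m. m \<in> M \<Longrightarrow> a + m \<notin> \<Omega>" and
    max: "\<And>M'. ?P M' \<Longrightarrow> vec.dim M' \<le> vec.dim M"
    by blast+
  have spanM: "vec.span M = M" using M(1) by simp
  \<comment> \<open>Otherwise \<open>M\<close> could be enlarged by \<open>v\<close>, against its
    maximal dimension.\<close>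
  have hit: "\<exists>\<zeta>. \<exists>m\<in>M. a + m + \<zeta> *s v \<in> \<Omega>" if v: "v \<notin> M" for v
  proof (rule ccontr)
    assume no_hit: "\<not> ?thesis"
    have "?P (vec.span (insert v M))"
    proof (intro conjI ballI vec.subspace_span)
      fix m assume "m \<in> vec.span (insert v M)"
      then obtain k where "m - k *s v \<in> M" unfolding vec.span_insert spanM by blast
      then show "a + m \<notin> \<Omega>" using no_hit by (auto dest!: spec[of _ k] bspec[of _ _ "m - k *s v"] simp: add.assoc)
    qed
    then have "vec.dim (insert v M) \<le> vec.dim M" using max[of "vec.span (insert v M)"] by simp
    then have "vec.span M = vec.span (insert v M)" by (intro vec.dim_eq_span) auto
    then show False using v spanM vec.span_base[of v "insert v M"] by auto
  qed
  have diff_notin: "z - a \<notin> M" if "z \<in> \<Omega>" for z using M(2)[of "z - a"] that by auto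
  \<comment> \<open>The zero functional in \<open>ex\<close> shows only that the domain is nonempty.
    A functional that vanishes on \<open>M\<close> but not on \<open>u1\<close> then yields
    \<open>u2\<close>, independent of \<open>u1\<close> modulo \<open>M\<close>: codimension at
    least two.\<close>
  obtain z1 where z1: "z1 \<in> \<Omega>" using ex[of "\<lambda>_. 0"] by (auto intro: bounded_linear_zero)
  define u1 where "u1 = z1 - a"
  have u1: "u1 \<notin> M" using diff_notin[OF z1] by (simp add: u1_def)
  obtain L1 :: "complex ^ 'n \<Rightarrow> complex" where L1: "bounded_linear L1" "\<And>c x. L1 (c *s x) = c * L1 x"
    "\<And>m. m \<in> M \<Longrightarrow> L1 m = 0" "L1 u1 = 1"
    using complex_functional_separating_subspace[OF M(1) u1] by blast
  obtain z2 where z2: "z2 \<in> \<Omega>" "L1 (z2 - a) = 0" using ex[OF L1(1,2)] by blast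
  define u2 where "u2 = z2 - a"
  have u2: "u2 \<notin> M" "L1 u2 = 0" using diff_notin[OF z2(1)] z2(2) by (auto simp: u2_def)
  have comb: "x *s u1 + y *s u2 \<notin> M" if "x \<noteq> 0 \<or> y \<noteq> 0" for x y
  proof
    assume inM: "x *s u1 + y *s u2 \<in> M"
    have "L1 (x *s u1 + y *s u2) = x"
      by (simp add: linear_add[OF bounded_linear.linear[OF L1(1)]] L1 u2)
    then have x: "x = 0" using L1(3)[OF inM] by simp
    then have "y \<noteq> 0" using that by simp
    have "y *s u2 \<in> M" using inM x by simp
    then have "inverse y *s (y *s u2) \<in> M" by (rule vec.subspace_scale[OF M(1)])
    then show False using u2 \<open>y \<noteq> 0\<close> by (simp add: vector_smult_assoc)
  qed
  \<comment> \<open>The disc parametrises a hemisphere in the span of \<open>u1\<close> and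
    \<open>u2\<close>. On its boundary \<open>v x\<close> is \<open>x *s v 1\<close>, which makes
    the sections there rotated copies of the section over 1; \<open>max 0\<close> keeps the root
    continuous outside the disc.\<close>
  define v where "v x = x *s u1 + complex_of_real (sqrt (max 0 (1 - (cmod x)\<^sup>2))) *s u2" for x
  have v_notin: "v x \<notin> M" for x
  proof (cases "x = 0")
    case True
    then show ?thesis unfolding v_def by (intro comb) simp
  next
    case False
    then show ?thesis unfolding v_def by (intro comb) simp
  qed
  have cont_v: "continuous_on S v" for S
    unfolding v_def by (intro continuous_intros continuous_on_vector_scale)
  define G where "G = {q. \<exists>m\<in>M. a + m + snd q *s v (fst q) \<in> \<Omega>}"
  have sec: "{\<zeta>. (x, \<zeta>) \<in> G} = {\<zeta>. \<exists>m\<in>M. a + m + \<zeta> *s v x \<in> \<Omega>}" for x by (auto simp: G_def)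
  have conn_log: "connected {\<zeta>. (x, \<zeta>) \<in> G} \<and> (\<exists>l. continuous_on {\<zeta>. (x, \<zeta>) \<in> G} l \<and> (\<forall>\<zeta>\<in>{\<zeta>. (x, \<zeta>) \<in> G}. exp (l \<zeta>) = \<zeta>))" for x
  proof -
    obtain L :: "complex ^ 'n \<Rightarrow> complex" where L: "bounded_linear L" "\<And>c x. L (c *s x) = c * L x"
      "\<And>m. m \<in> M \<Longrightarrow> L m = 0" "L (v x) = 1"
      using complex_functional_separating_subspace[OF M(1) v_notin] by blast
    note Lin = bounded_linear.linear[OF L(1)]
    define A where "A = {a + m + \<zeta> *s v x | m \<zeta>. m \<in> M}"
    let ?F = "{\<zeta>. (x, \<zeta>) \<in> G}"
    have A_line: "y + s *s (z - y) \<in> A" if yz: "y \<in> A" "z \<in> A" for y z s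
    proof -
      obtain m \<zeta> m' \<zeta>' where e: "y = a + m + \<zeta> *s v x" "z = a + m' + \<zeta>' *s v x" "m \<in> M" "m' \<in> M"
        using yz by (auto simp: A_def)
      have "y + s *s (z - y) = a + (m + s *s (m' - m)) + (\<zeta> + s * (\<zeta>' - \<zeta>)) *s v x"
        by (simp add: e vec_eq_iff algebra_simps)
      moreover have "m + s *s (m' - m) \<in> M"
        using e M(1) by (intro vec.subspace_add vec.subspace_scale vec.subspace_diff)
      ultimately show ?thesis unfolding A_def by blast
    qed
    have A_v: "y + s *s v x \<in> A" if y: "y \<in> A" for y s
    proof -
      obtain m \<zeta> where e: "y = a + m + \<zeta> *s v x" "m \<in> M" using y by (auto simp: A_def)
      then have "y + s *s v x = a + m + (\<zeta> + s) *s v x" by (simp add: vec_eq_iff algebra_simps)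
      then show ?thesis using e unfolding A_def by blast
    qed
    have LA: "L (a + m + \<zeta> *s v x) = L a + \<zeta>" if "m \<in> M" for m \<zeta>
      using L(3)[OF that] L(4) by (simp add: linear_add[OF Lin] L(2))
    have img: "L ` (\<Omega> \<inter> A) = (\<lambda>\<zeta>. L a + \<zeta>) ` ?F"
    proof
      show "L ` (\<Omega> \<inter> A) \<subseteq> (\<lambda>\<zeta>. L a + \<zeta>) ` ?F"
        using LA by (fastforce simp: A_def sec)
      show "(\<lambda>\<zeta>. L a + \<zeta>) ` ?F \<subseteq> L ` (\<Omega> \<inter> A)"
      proof
        fix w assume "w \<in> (\<lambda>\<zeta>. L a + \<zeta>) ` ?F"
        then obtain \<zeta> m where "m \<in> M" "a + m + \<zeta> *s v x \<in> \<Omega>" "w = L a + \<zeta>" by (auto simp: sec)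
        then show "w \<in> L ` (\<Omega> \<inter> A)" using LA by (intro image_eqI[of _ _ "a + m + \<zeta> *s v x"]) (auto simp: A_def)
      qed
    qed
    have img': "?F = (\<lambda>\<zeta>. \<zeta> - L a) ` (L ` (\<Omega> \<inter> A))" unfolding img by (simp add: image_image)
    note IL = C_convex_image_logs[OF C op A_line L(1,2,4) A_v]
    have "connected ?F" unfolding img' by (intro connected_continuous_image IL(2) continuous_intros)
    \<comment> \<open>a + M misses the domain, so 0 lies in no section; hence logarithms of L - L(a)
      on the image become logarithms of \<zeta> on the section.\<close>
    moreover have "L a \<notin> L ` (\<Omega> \<inter> A)"
    proof
      assume "L a \<in> L ` (\<Omega> \<inter> A)"
      then have "0 \<in> ?F" unfolding img' by force
      then show False using M(2) by (auto simp: sec)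
    qed
    then obtain l where l: "continuous_on (L ` (\<Omega> \<inter> A)) l" "\<And>\<zeta>. \<zeta> \<in> L ` (\<Omega> \<inter> A) \<Longrightarrow> exp (l \<zeta>) = \<zeta> - L a"
      using IL(3) by blast
    have "continuous_on ?F (\<lambda>\<zeta>. l (L a + \<zeta>))"
      by (intro continuous_on_compose2[OF l(1)] continuous_intros) (simp add: img)
    moreover have "exp (l (L a + \<zeta>)) = \<zeta>" if "\<zeta> \<in> ?F" for \<zeta>
      using l(2)[of "L a + \<zeta>"] that unfolding img by simp
    ultimately show ?thesis by blast
  qed
  show False
  proof (rule no_connected_log_sections_over_disc[of G])
    have "G = (\<Union>m\<in>M. (\<lambda>q. a + m + snd q *s v (fst q)) -` \<Omega>)" by (auto simp: G_def)
    moreover have "open ((\<lambda>q::complex \<times> complex. a + m + snd q *s v (fst q)) -` \<Omega>)" for m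
      by (intro open_vimage op continuous_intros continuous_on_vector_scale continuous_on_compose2[OF cont_v[of UNIV]]) auto
    ultimately show "open G" by auto
    show "{\<zeta>. (x, \<zeta>) \<in> G} \<noteq> {}" for x using hit[OF v_notin] unfolding sec by blast
    show "\<zeta> \<in> {\<zeta>. (x, \<zeta>) \<in> G} \<longleftrightarrow> x * \<zeta> \<in> {\<zeta>. (1, \<zeta>) \<in> G}" if "cmod x = 1" for x \<zeta>
    proof -
      have "\<zeta> *s v x = (x * \<zeta>) *s v 1" using that by (simp add: v_def vector_smult_assoc mult.commute)
      then show ?thesis by (simp add: sec)
    qed
  qed (use conn_log in blast)+
qed

section \<open>The volume estimate\<close>

lemma azukawa_indicatrix_C_convex_subset:
  fixes \<Omega> :: "(complex ^ 'n) set"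
  assumes C: "C_convex \<Omega>" and op: "open \<Omega>" and w: "w \<in> \<Omega>"
    and X: "X \<in> azukawa_indicatrix \<Omega> w"
  shows "w + (1/4) *\<^sub>R X \<in> \<Omega>"
proof (rule ccontr)
  define a where "a = w + (1/4) *\<^sub>R X"
  assume "w + (1/4) *\<^sub>R X \<notin> \<Omega>"
  then obtain L :: "complex ^ 'n \<Rightarrow> complex" where L: "bounded_linear L" "\<And>c x. L (c *s x) = c * L x"
    and nz: "\<And>z. z \<in> \<Omega> \<Longrightarrow> L (z - a) \<noteq> 0"
    using C_convex_complex_hyperplane[OF C op] unfolding a_def by blast
  note Lin = bounded_linear.linear[OF L(1)]
  \<comment> \<open>\<open>L\<close> does not vanish at w - a, so it takes the value 1; this
    direction makes the image of the domain open.\<close>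
  have "L (inverse (L (w - a)) *s (w - a)) = 1" unfolding L(2) using nz[OF w] by simp
  then obtain v where v: "L v = 1" by blast
  note img = C_convex_image_logs[where A = UNIV, OF C op UNIV_I L v UNIV_I, unfolded Int_UNIV_right]
  define F where "F = (\<lambda>\<zeta>. - L w + \<zeta>) ` (L ` \<Omega>)"
  have F: "open F" "simply_connected F" "0 \<in> F"
  proof -
    show "open F" unfolding F_def by (intro open_translation img(1))
    have "simply_connected (L ` \<Omega>)"
      using img by (intro simply_connected_if_continuous_logs) auto
    then show "simply_connected F"
      unfolding F_def using homeomorphic_translation homeomorphic_simply_connected_eq by blast
    show "0 \<in> F" unfolding F_def using w by force
  qed
  have "L (a - w) \<notin> F"
  proof
    assume "L (a - w) \<in> F"
    then obtain z where "z \<in> \<Omega>" "L (a - w) = L z - L w" by (auto simp: F_def)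
    then have "L (z - a) = 0" by (simp add: linear_diff[OF Lin])
    then show False using nz \<open>z \<in> \<Omega>\<close> by blast
  qed
  then obtain \<phi> where \<phi>: "\<phi> holomorphic_on F" "inj_on \<phi> F" "\<phi> 0 = 0"
    "\<And>z. z \<in> F \<Longrightarrow> cmod (\<phi> z) < 1" "1 \<le> 4 * cmod (L (a - w)) * cmod (deriv \<phi> 0)"
    using koebe_quarter_riemann_map[OF F] by blast
  have "cmod (deriv \<phi> 0 * L X) < 1"
  proof (rule azukawa_indicatrix_injective_less[OF op L F(1,3) \<phi>(1-4) _ X])
    show "L (z - w) \<in> F" if "z \<in> \<Omega>" for z
      using that by (auto simp: F_def linear_diff[OF Lin])
  qed
  \<comment> \<open>With the scale 1/4 the Koebe bound reads 1 \<le> |\<phi>'(0) L(X)|, the opposite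
    of what membership in the indicatrix gives.\<close>
  moreover have LX: "L (a - w) = L X / 4" unfolding a_def add_diff_cancel_left' linear_cmul[OF Lin] by (simp add: scaleR_conv_of_real)
  ultimately show False using \<phi>(5) unfolding LX by (simp add: norm_mult norm_divide mult.commute)
qed

theorem theorem5:
  fixes \<Omega> :: "(complex ^ 'n) set" and w :: "complex ^ 'n"
  assumes "is_domain \<Omega>" and "w \<in> \<Omega>"
  shows "(C_convex \<Omega> \<longrightarrow>
            bergman_kernel \<Omega> w
              \<le> ennreal (16 ^ CARD('n)) / emeasure lebesgue (azukawa_indicatrix \<Omega> w)) \<and>
         (convex \<Omega> \<longrightarrow>
            bergman_kernel \<Omega> w
              \<le> ennreal (4 ^ CARD('n)) / emeasure lebesgue (azukawa_indicatrix \<Omega> w)) \<and>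
         (convex \<Omega> \<and> symmetric_wrt \<Omega> w \<longrightarrow>
            bergman_kernel \<Omega> w
              \<le> ennreal ((16 / pi\<^sup>2) ^ CARD('n)) / emeasure lebesgue (azukawa_indicatrix \<Omega> w))"
proof (intro conjI impI)
  have op: "open \<Omega>" using assms(1) by (simp add: is_domain_def)
  have bound: "bergman_kernel \<Omega> w \<le> ennreal (C ^ CARD('n)) / emeasure lebesgue (azukawa_indicatrix \<Omega> w)"
    if "t > 0" "1 / t\<^sup>2 = C" "\<And>X. X \<in> azukawa_indicatrix \<Omega> w \<Longrightarrow> w + t *\<^sub>R X \<in> \<Omega>" for t C :: real
    using bergman_kernel_le_if_scaled_azukawa_subset[OF op that(1,3)] unfolding that(2) .
  show "bergman_kernel \<Omega> w \<le> ennreal (16 ^ CARD('n)) / emeasure lebesgue (azukawa_indicatrix \<Omega> w)"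
    if "C_convex \<Omega>"
    by (rule bound[of "1/4"])
       (simp_all add: power2_eq_square azukawa_indicatrix_C_convex_subset[OF that op assms(2), simplified])
  show "bergman_kernel \<Omega> w \<le> ennreal (4 ^ CARD('n)) / emeasure lebesgue (azukawa_indicatrix \<Omega> w)"
    if "convex \<Omega>"
    by (rule bound[of "1/2"])
       (simp_all add: power2_eq_square azukawa_indicatrix_convex_subset[OF that op assms(2), simplified])
  show "bergman_kernel \<Omega> w \<le> ennreal ((16 / pi\<^sup>2) ^ CARD('n)) / emeasure lebesgue (azukawa_indicatrix \<Omega> w)"
    if "convex \<Omega> \<and> symmetric_wrt \<Omega> w"
    by (rule bound[of "pi/4"])
       (use azukawa_indicatrix_convex_symmetric_subset[OF _ op assms(2)] that in \<open>simp_all add: power_divide\<close>)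
qed

end
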